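(* Let $T>0$, let $d,k,m\in\mathbb{N}$, and let $(\Omega,\mathcal{F},\mathbb{P})$ be a fixed probability space. For each $n\in\mathbb{N}$, let $W_n$ be an $\mathbb{R}^k$-valued Wiener process on a filtered probability space $(\Omega,\mathcal{F},\{\mathcal{F}^n_t\}_{t\in[0,T]},\mathbb{P})$, and let $W$ be an $\mathbb{R}^k$-valued Wiener process on a filtered probability space $(\Omega,\mathcal{F},\{\mathcal{F}_t\}_{t\in[0,T]},\mathbb{P})$. Fix $p>2$ and $r\ge1$. For each $n$, let $V_n$ be an $L^1(\mathbb{T}^d;\mathbb{R}^{m\times k})$-valued $\{\mathcal{F}^n_t\}$-predictable process, and let $V$ be an $L^1(\mathbb{T}^d;\mathbb{R}^{m\times k})$-valued $\{\mathcal{F}_t\}$-predictable process, such that $$V_n\rightharpoonup V\ \text{ weakly in } L^r(\Omega\times[0,T]\times\mathbb{T}^d;\mathbb{R}^{m\times k})\text{ as } n\to\infty,$$ $$\sup_n\mathbb{E}\,\|V_n\|^p_{L^p([0,T];L^1(\mathbb{T}^d;\mathbb{R}^{m\times k}))}<\infty.$$ Suppose further that $W_n\to W$ in $C([0,T];\mathbb{R}^k)$, $\mathbb{P}$-almost surely. Fix $q>d/2$, and suppose that for a given $\beta\in H^q(\mathbb{T}^d)$, $$\mathbb{E}\int_h^T\Big|\int_{\mathbb{T}^d}\beta(x)\big(V_n(t)-V_n(t-h)\big)\,\mathrm{d}x\Big|\,\mathrm{d}t\longrightarrow0\quad\text{as } h\downarrow0,\ \text{uniformly in } n.$$ Then for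 every $t\in[0,T]$, $$\int_0^t\int_{\mathbb{T}^d}\beta\,V_n\,\mathrm{d}x\,\mathrm{d}W_n\rightharpoonup\int_0^t\int_{\mathbb{T}^d}\beta\,V\,\mathrm{d}x\,\mathrm{d}W\quad\text{weakly in } L^2(\Omega;\mathbb{R}^m)\text{ as } n\to\infty.$$
   Context: $\mathbb{T}^d$ is the $d$-dimensional torus and $H^q(\mathbb{T}^d)$ is the usual $L^2$-based Sobolev space. $\int_{\mathbb{T}^d}\beta V_n\,\mathrm{d}x$ is computed entrywise and is an $\mathbb{R}^{m\times k}$-valued process; the stochastic integral is the $\mathbb{R}^m$-valued Itô integral. *)

theory Defs
  imports "HOL-Probability.Probability"
begin

section \<open>Lebesgue spaces, strong and weak convergence\<close>

text \<open>
  \<open>Lp M p\<close> consists of representatives; functions that agree almost everywhere are at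
  \<open>Lp_norm\<close>-distance zero. Exponents are finite and at least \<open>1\<close>.
\<close>

definition Lp :: "'a measure \<Rightarrow> real \<Rightarrow> ('a \<Rightarrow> 'b::euclidean_space) set" where
  "Lp M p = {f \<in> borel_measurable M. integrable M (\<lambda>x. norm (f x) powr p)}"

definition Lp_norm :: "'a measure \<Rightarrow> real \<Rightarrow> ('a \<Rightarrow> 'b::euclidean_space) \<Rightarrow> real" where
  "Lp_norm M p f = (\<integral>x. norm (f x) powr p \<partial>M) powr (1 / p)"

definition Lp_converges ::
  "'a measure \<Rightarrow> real \<Rightarrow> (nat \<Rightarrow> 'a \<Rightarrow> 'b::euclidean_space) \<Rightarrow> ('a \<Rightarrow> 'b) \<Rightarrow> bool" where
  "Lp_converges M p f g \<longleftrightarrow>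
     (\<forall>n. f n \<in> Lp M p) \<and> g \<in> Lp M p \<and>
     (\<lambda>n. Lp_norm M p (\<lambda>x. f n x - g x)) \<longlonglongrightarrow> 0"

text \<open>
  The topological dual of \<open>Lp M p\<close>. Additivity and boundedness force such a functional to
  respect equality almost everywhere, so it is a functional on the quotient space.
\<close>

definition Lp_dual :: "'a measure \<Rightarrow> real \<Rightarrow> (('a \<Rightarrow> 'b::euclidean_space) \<Rightarrow> real) set" where
  "Lp_dual M p = {\<phi>.
     (\<forall>f\<in>Lp M p. \<forall>g\<in>Lp M p. \<phi> (\<lambda>x. f x + g x) = \<phi> f + \<phi> g) \<and>
     (\<forall>c. \<forall>f\<in>Lp M p. \<phi> (\<lambda>x. c *\<^sub>R f x) = c * \<phi> f) \<and>
     (\<exists>C. \<forall>f\<in>Lp M p. \<bar>\<phi> f\<bar> \<le> C * Lp_norm M p f)}"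

definition Lp_converges_weakly ::
  "'a measure \<Rightarrow> real \<Rightarrow> (nat \<Rightarrow> 'a \<Rightarrow> 'b::euclidean_space) \<Rightarrow> ('a \<Rightarrow> 'b) \<Rightarrow> bool" where
  "Lp_converges_weakly M p f g \<longleftrightarrow>
     (\<forall>n. f n \<in> Lp M p) \<and> g \<in> Lp M p \<and>
     (\<forall>\<phi>\<in>Lp_dual M p. (\<lambda>n. \<phi> (f n)) \<longlonglongrightarrow> \<phi> g)"

text \<open>
  The Borel \<open>\<sigma>\<close>-algebra of \<open>L\<^sup>1(N)\<close>, on representatives: it is generated by the sets that are
  open for the \<open>L\<^sup>1\<close>-pseudometric.
\<close>

definition L1_borel :: "'a measure \<Rightarrow> ('a \<Rightarrow> 'b::euclidean_space) measure" where
  "L1_borel N = sigma {f. integrable N f}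
     {U. U \<subseteq> {f. integrable N f} \<and>
         (\<forall>f\<in>U. \<exists>e>0. \<forall>g. integrable N g \<and> (\<integral>x. norm (g x - f x) \<partial>N) < e \<longrightarrow> g \<in> U)}"


section \<open>The torus and its Sobolev spaces\<close>

text \<open>
  The torus \<open>(\<real>/\<int>)\<^sup>d\<close> as a measure space, realised on the fundamental domain \<open>[0,1)\<^sup>d\<close>.
\<close>

definition torus :: "(real^'d) measure" where
  "torus = restrict_space lborel {x. \<forall>i. 0 \<le> x $ i \<and> x $ i < 1}"

definition fourier_coeff :: "(real^'d \<Rightarrow> real) \<Rightarrow> int^'d \<Rightarrow> complex" where
  "fourier_coeff \<beta> \<xi> =
     (\<integral>x. complex_of_real (\<beta> x) * cis (- 2 * pi * (\<Sum>i\<in>UNIV. of_int (\<xi> $ i) * x $ i)) \<partial>torus)"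

definition sobolev_torus :: "real \<Rightarrow> (real^'d \<Rightarrow> real) set" where
  "sobolev_torus q = {\<beta> \<in> Lp torus 2.
     (\<lambda>\<xi>. (1 + (\<Sum>i\<in>UNIV. (of_int (\<xi> $ i))\<^sup>2)) powr q * (cmod (fourier_coeff \<beta> \<xi>))\<^sup>2)
       summable_on UNIV}"

definition torus_pairing :: "(real^'d \<Rightarrow> real) \<Rightarrow> (real^'d \<Rightarrow> 'b::euclidean_space) \<Rightarrow> 'b" where
  "torus_pairing \<beta> f = (\<integral>x. \<beta> x *\<^sub>R f x \<partial>torus)"


section \<open>Filtrations, predictable processes and Wiener processes on a bounded time interval\<close>

definition time_measure :: "real \<Rightarrow> real measure" where
  "time_measure T = restrict_space lborel {0..T}"

text \<open>The usual conditions (completeness, right-continuity) are not imposed.\<close>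

definition filtration_upto :: "'w measure \<Rightarrow> real \<Rightarrow> (real \<Rightarrow> 'w measure) \<Rightarrow> bool" where
  "filtration_upto M T F \<longleftrightarrow>
     (\<forall>t\<in>{0..T}. subalgebra M (F t)) \<and>
     (\<forall>s\<in>{0..T}. \<forall>t\<in>{0..T}. s \<le> t \<longrightarrow> sets (F s) \<subseteq> sets (F t))"

definition predictable_algebra ::
  "'w measure \<Rightarrow> real \<Rightarrow> (real \<Rightarrow> 'w measure) \<Rightarrow> ('w \<times> real) measure" where
  "predictable_algebra M T F = sigma (space M \<times> {0..T})
     ({A \<times> {0} | A. A \<in> sets (F 0)} \<union>
      {A \<times> {s<..t} | A s t. 0 \<le> s \<and> s < t \<and> t \<le> T \<and> A \<in> sets (F s)})"

definition L1_predictable ::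
  "'w measure \<Rightarrow> real \<Rightarrow> (real \<Rightarrow> 'w measure) \<Rightarrow>
   (real \<Rightarrow> 'w \<Rightarrow> real^'d \<Rightarrow> 'b::euclidean_space) \<Rightarrow> bool" where
  "L1_predictable M T F V \<longleftrightarrow>
     (\<lambda>(\<omega>, t). V t \<omega>) \<in> predictable_algebra M T F \<rightarrow>\<^sub>M L1_borel torus"

definition wiener_process ::
  "'w measure \<Rightarrow> real \<Rightarrow> (real \<Rightarrow> 'w measure) \<Rightarrow> (real \<Rightarrow> 'w \<Rightarrow> real^'k) \<Rightarrow> bool" where
  "wiener_process M T F W \<longleftrightarrow>
     (\<forall>t\<in>{0..T}. W t \<in> borel_measurable (F t)) \<and>
     (AE \<omega> in M. W 0 \<omega> = 0) \<and>
     (AE \<omega> in M. continuous_on {0..T} (\<lambda>t. W t \<omega>)) \<and>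
     (\<forall>s t. 0 \<le> s \<and> s < t \<and> t \<le> T \<longrightarrow>
        prob_space.indep_set M (sets (F s))
          {(\<lambda>\<omega>. W t \<omega> - W s \<omega>) -` B \<inter> space M | B. B \<in> sets borel} \<and>
        distributed M lborel (\<lambda>\<omega>. W t \<omega> - W s \<omega>)
          (\<lambda>x. ennreal (\<Prod>i\<in>UNIV. normal_density 0 (sqrt (t - s)) (x $ i))))"


section \<open>The Ito integral\<close>

text \<open>
  An elementary process is \<open>\<Sum>j<N. \<xi>\<^sub>j 1\<^bsub>(\<tau>\<^sub>j, \<tau>\<^sub>j\<^sub>+\<^sub>1]\<^esub>\<close> with \<open>\<xi>\<^sub>j\<close> bounded and \<open>F(\<tau>\<^sub>j)\<close>-measurable.
\<close>

definition elementary ::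
  "'w measure \<Rightarrow> real \<Rightarrow> (real \<Rightarrow> 'w measure) \<Rightarrow>
   nat \<Rightarrow> (nat \<Rightarrow> real) \<Rightarrow> (nat \<Rightarrow> 'w \<Rightarrow> real^'k^'m) \<Rightarrow> bool" where
  "elementary M T F N \<tau> \<xi> \<longleftrightarrow>
     (\<forall>j<N. 0 \<le> \<tau> j \<and> \<tau> j \<le> \<tau> (Suc j) \<and> \<tau> (Suc j) \<le> T \<and>
        \<xi> j \<in> borel_measurable (F (\<tau> j)) \<and> bounded (\<xi> j ` space M))"

definition elementary_process ::
  "nat \<Rightarrow> (nat \<Rightarrow> real) \<Rightarrow> (nat \<Rightarrow> 'w \<Rightarrow> real^'k^'m) \<Rightarrow> 'w \<times> real \<Rightarrow> real^'k^'m" where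
  "elementary_process N \<tau> \<xi> =
     (\<lambda>(\<omega>, t). \<Sum>j<N. indicator {\<tau> j<..\<tau> (Suc j)} t *\<^sub>R \<xi> j \<omega>)"

definition elementary_integral ::
  "(real \<Rightarrow> 'w \<Rightarrow> real^'k) \<Rightarrow> nat \<Rightarrow> (nat \<Rightarrow> real) \<Rightarrow> (nat \<Rightarrow> 'w \<Rightarrow> real^'k^'m) \<Rightarrow>
   real \<Rightarrow> 'w \<Rightarrow> real^'m" where
  "elementary_integral W N \<tau> \<xi> t \<omega> =
     (\<Sum>j<N. \<xi> j \<omega> *v (W (min t (\<tau> (Suc j))) \<omega> - W (min t (\<tau> j)) \<omega>))"

text \<open>
  \<open>I\<close> is a version of \<open>\<integral>\<^sub>0\<^sup>t \<Phi> dW\<close> if it is the \<open>L\<^sup>2(\<Omega>)\<close>-limit of the integrals of elementary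
  processes that converge to \<open>\<Phi>\<close> in \<open>L\<^sup>2(\<Omega> \<times> [0,T])\<close>. For predictable square-integrable \<open>\<Phi>\<close> such an \<open>I\<close>
  exists and is unique up to equality almost surely.
\<close>

definition is_ito_integral ::
  "'w measure \<Rightarrow> real \<Rightarrow> (real \<Rightarrow> 'w measure) \<Rightarrow> (real \<Rightarrow> 'w \<Rightarrow> real^'k) \<Rightarrow>
   (real \<Rightarrow> 'w \<Rightarrow> real^'k^'m) \<Rightarrow> real \<Rightarrow> ('w \<Rightarrow> real^'m) \<Rightarrow> bool" where
  "is_ito_integral M T F W \<Phi> t I \<longleftrightarrow>
     (\<exists>N \<tau> \<xi>. (\<forall>i. elementary M T F (N i) (\<tau> i) (\<xi> i)) \<and>
        Lp_converges (M \<Otimes>\<^sub>M time_measure T) 2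
          (\<lambda>i. elementary_process (N i) (\<tau> i) (\<xi> i)) (\<lambda>(\<omega>, s). \<Phi> s \<omega>) \<and>
        Lp_converges M 2 (\<lambda>i. elementary_integral W (N i) (\<tau> i) (\<xi> i) t) I)"

definition ito_integral ::
  "'w measure \<Rightarrow> real \<Rightarrow> (real \<Rightarrow> 'w measure) \<Rightarrow> (real \<Rightarrow> 'w \<Rightarrow> real^'k) \<Rightarrow>
   (real \<Rightarrow> 'w \<Rightarrow> real^'k^'m) \<Rightarrow> real \<Rightarrow> 'w \<Rightarrow> real^'m" where
  "ito_integral M T F W \<Phi> t = (SOME I. is_ito_integral M T F W \<Phi> t I)"

end

theory Submission
  imports Defs
begin

text \<open>
  Write \<open>\<Phi>\<^sub>n = \<integral> \<beta> V\<^sub>n dx\<close>. Since \<open>q > d/2\<close>, the Fourier coefficients of \<open>\<beta>\<close> are absolutely summable, so \<open>\<beta>\<close> is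
  essentially bounded and \<open>\<Phi>\<^sub>n\<close> is bounded in \<open>L\<^sup>p(\<Omega> \<times> [0,T])\<close> with \<open>p > 2\<close>. Interpolating with the uniform \<open>L\<^sup>1\<close> modulus
  of continuity in time gives a uniform \<open>L\<^sup>2\<close> modulus, which the weak limit \<open>\<Phi>\<close> inherits by duality. Replace
  \<open>\<Phi>\<^sub>n\<close> on each cell of a grid of mesh \<open>\<delta>\<close> by its average over the preceding cell: the \<open>L\<^sup>2\<close> error is controlled by the
  modulus at scale \<open>2 \<delta>\<close>, hence uniformly in \<open>n\<close>, and by the Ito isometry (only an inequality, with a dimensional
  constant, is needed) so is the error of the stochastic integral. For a fixed grid the integral is a finite sum of
  products of an average, which converges weakly, and an increment of \<open>W\<^sub>n\<close>, which converges strongly in \<open>L\<^sup>2\<close>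
  because it converges almost surely with constant second moment.
\<close>

section \<open>Square-integrable functions\<close>

text \<open>Three obstacles shape the proof. (1) The passage from summable Fourier coefficients to
  boundedness of \<beta> goes by duality: the coefficients bound the pairing of \<beta> with a
  trigonometric polynomial by \<open>C\<close> times its L1 norm, and this bound survives the
  passage to continuous functions (Stone-Weierstrass), to indicators of compact sets, and by inner
  regularity to an almost everywhere bound. (2) \<open>ito_integral\<close> is a \<open>SOME\<close>
  choice. Existence of a version has to be proved for every \<open>n\<close> and for the limit,
  while the estimates are proved for all versions at once. The time modulus serves existence as well
  as convergence. (3) Each \<open>n\<close> has its own filtration, so no common martingale argument
  is at hand: every integral is compared with its own step integral, with constants free of
  \<open>n\<close>, and only finitely many products of average, increment and bounded test are sent
  to the limit. Integrands are extended by zero to the whole time line, where translations preserve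
  the measure; the price is two strips of width \<open>h\<close>. \<open>msq\<close> takes values in
  \<open>ennreal\<close>, so Fatou and Tonelli need no integrability conditions.\<close>

definition msq :: "'a measure \<Rightarrow> ('a \<Rightarrow> 'b::euclidean_space) \<Rightarrow> ennreal" where
  "msq M f = (\<integral>\<^sup>+x. ennreal ((norm (f x))\<^sup>2) \<partial>M)"

lemma Lp2_iff: "f \<in> Lp M 2 \<longleftrightarrow> f \<in> borel_measurable M \<and> msq M f < \<infinity>"
  by (auto simp: Lp_def msq_def integrable_iff_bounded)

lemma Lp2_measurable: "f \<in> Lp M 2 \<Longrightarrow> f \<in> borel_measurable M"
  by (simp add: Lp_def)

lemma Lp2_integrable_square: "f \<in> Lp M 2 \<Longrightarrow> integrable M (\<lambda>x. (norm (f x))\<^sup>2)"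
  by (simp add: Lp_def)

lemma msq_eq_integral: "f \<in> Lp M 2 \<Longrightarrow> msq M f = ennreal (\<integral>x. (norm (f x))\<^sup>2 \<partial>M)"
  unfolding msq_def by (rule nn_integral_eq_integral) (auto dest: Lp2_integrable_square)

lemma Lp_norm2_eq: "Lp_norm M 2 f = sqrt (\<integral>x. (norm (f x))\<^sup>2 \<partial>M)"
  unfolding Lp_norm_def by (simp add: powr_half_sqrt)

lemma msq_mono: "(\<And>x. x \<in> space M \<Longrightarrow> norm (f x) \<le> norm (g x)) \<Longrightarrow> msq M f \<le> msq M g"
  unfolding msq_def by (intro nn_integral_mono ennreal_leI power_mono) auto

lemma norm_diff_square_le: "(norm (a - b))\<^sup>2 \<le> 2 * (norm a)\<^sup>2 + 2 * (norm b)\<^sup>2"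
  for a b :: "'a::real_normed_vector"
proof -
  have "(norm (a - b))\<^sup>2 \<le> (norm a + norm b)\<^sup>2"
    by (intro power_mono norm_triangle_ineq4) auto
  also have "\<dots> \<le> 2 * (norm a)\<^sup>2 + 2 * (norm b)\<^sup>2"
    using sum_squares_bound[of "norm a" "norm b"] by (simp add: power2_eq_square algebra_simps)
  finally show ?thesis .
qed

lemma msq_diff_le:
  assumes [measurable]: "f \<in> borel_measurable M" "g \<in> borel_measurable M"
  shows "msq M (\<lambda>x. f x - g x) \<le> 2 * msq M f + 2 * msq M g"
proof -
  have "msq M (\<lambda>x. f x - g x) \<le> (\<integral>\<^sup>+x. 2 * ennreal ((norm (f x))\<^sup>2) + 2 * ennreal ((norm (g x))\<^sup>2) \<partial>M)"
    unfolding msq_def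
  proof (rule nn_integral_mono)
    fix x
    have "ennreal ((norm (f x - g x))\<^sup>2) \<le> ennreal (2 * (norm (f x))\<^sup>2 + 2 * (norm (g x))\<^sup>2)"
      by (intro ennreal_leI norm_diff_square_le)
    then show "ennreal ((norm (f x - g x))\<^sup>2) \<le> 2 * ennreal ((norm (f x))\<^sup>2) + 2 * ennreal ((norm (g x))\<^sup>2)"
      by (simp add: ennreal_plus ennreal_mult)
  qed
  then show ?thesis
    unfolding msq_def by (simp add: nn_integral_add nn_integral_cmult)
qed

lemma msq_uminus: "msq M (\<lambda>x. - f x) = msq M f"
  by (simp add: msq_def)

lemma msq_minus_commute: "msq M (\<lambda>x. f x - g x) = msq M (\<lambda>x. g x - f x)"
  by (simp add: msq_def norm_minus_commute)

lemma msq_add_le: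
  assumes "f \<in> borel_measurable M" "g \<in> borel_measurable M"
  shows "msq M (\<lambda>x. f x + g x) \<le> 2 * msq M f + 2 * msq M g"
  using msq_diff_le[of f M "\<lambda>x. - g x"] assms by (simp add: msq_uminus)

lemma msq_triangle:
  assumes [measurable]: "f \<in> borel_measurable M" "g \<in> borel_measurable M" "h \<in> borel_measurable M"
  shows "msq M (\<lambda>x. f x - h x) \<le> 2 * msq M (\<lambda>x. f x - g x) + 2 * msq M (\<lambda>x. g x - h x)"
  using msq_add_le[of "\<lambda>x. f x - g x" M "\<lambda>x. g x - h x"] by simp

lemma msq_scaleR:
  assumes [measurable]: "f \<in> borel_measurable M"
  shows "msq M (\<lambda>x. c *\<^sub>R f x) = ennreal (c\<^sup>2) * msq M f"
  unfolding msq_def by (subst nn_integral_cmult[symmetric]) (auto simp: power_mult_distrib ennreal_mult)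

lemma Lp2_diff: "f \<in> Lp M 2 \<Longrightarrow> g \<in> Lp M 2 \<Longrightarrow> (\<lambda>x. f x - g x) \<in> Lp M 2"
  unfolding Lp2_iff using msq_diff_le[of f M g]
  by (auto simp: ennreal_mult_less_top intro: le_less_trans)

lemma Lp2_add: "f \<in> Lp M 2 \<Longrightarrow> g \<in> Lp M 2 \<Longrightarrow> (\<lambda>x. f x + g x) \<in> Lp M 2"
  unfolding Lp2_iff using msq_add_le[of f M g]
  by (auto simp: ennreal_mult_less_top intro: le_less_trans)

lemma Lp2_scaleR: "f \<in> Lp M 2 \<Longrightarrow> (\<lambda>x. c *\<^sub>R f x) \<in> Lp M 2"
  unfolding Lp2_iff by (auto simp: msq_scaleR ennreal_mult_less_top)

lemma Lp_converges2:
  "Lp_converges M 2 f g \<longleftrightarrow> (\<forall>n. f n \<in> Lp M 2) \<and> g \<in> Lp M 2 \<and> (\<lambda>n. msq M (\<lambda>x. f n x - g x)) \<longlonglongrightarrow> 0"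
proof -
  { assume *: "\<forall>n. f n \<in> Lp M 2" "g \<in> Lp M 2"
    have "(\<lambda>n. msq M (\<lambda>x. f n x - g x)) \<longlonglongrightarrow> 0 \<longleftrightarrow>
          (\<lambda>n. ennreal (\<integral>x. (norm (f n x - g x))\<^sup>2 \<partial>M)) \<longlonglongrightarrow> ennreal 0"
      using * by (simp add: msq_eq_integral Lp2_diff)
    also have "\<dots> \<longleftrightarrow> (\<lambda>n. (\<integral>x. (norm (f n x - g x))\<^sup>2 \<partial>M)) \<longlonglongrightarrow> 0"
      by (rule tendsto_ennreal_iff) auto
    also have "\<dots> \<longleftrightarrow> (\<lambda>n. Lp_norm M 2 (\<lambda>x. f n x - g x)) \<longlonglongrightarrow> 0"
    proof
      assume "(\<lambda>n. (\<integral>x. (norm (f n x - g x))\<^sup>2 \<partial>M)) \<longlonglongrightarrow> 0"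
      from tendsto_real_sqrt[OF this] show "(\<lambda>n. Lp_norm M 2 (\<lambda>x. f n x - g x)) \<longlonglongrightarrow> 0"
        by (simp add: Lp_norm2_eq)
    next
      assume "(\<lambda>n. Lp_norm M 2 (\<lambda>x. f n x - g x)) \<longlonglongrightarrow> 0"
      from tendsto_power[OF this, of 2] show "(\<lambda>n. (\<integral>x. (norm (f n x - g x))\<^sup>2 \<partial>M)) \<longlonglongrightarrow> 0"
        by (simp add: Lp_norm2_eq)
    qed
    finally have "(\<lambda>n. msq M (\<lambda>x. f n x - g x)) \<longlonglongrightarrow> 0 \<longleftrightarrow> (\<lambda>n. Lp_norm M 2 (\<lambda>x. f n x - g x)) \<longlonglongrightarrow> 0" . }
  then show ?thesis unfolding Lp_converges_def by blast
qed

lemma abs_inner_le_squares: "\<bar>a \<bullet> b\<bar> \<le> (norm a)\<^sup>2 / 2 + (norm b)\<^sup>2 / 2"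
  for a b :: "'a::real_inner"
  using Cauchy_Schwarz_ineq2[of a b] sum_squares_bound[of "norm a" "norm b"] by simp

lemma Lp2_integrable_inner:
  assumes "f \<in> Lp M 2" "g \<in> Lp M 2"
  shows "integrable M (\<lambda>x. f x \<bullet> g x)"
proof (rule Bochner_Integration.integrable_bound)
  show "integrable M (\<lambda>x. (norm (f x))\<^sup>2 / 2 + (norm (g x))\<^sup>2 / 2)"
    using assms by (intro Bochner_Integration.integrable_add integrable_divide Lp2_integrable_square)
  show "(\<lambda>x. f x \<bullet> g x) \<in> borel_measurable M"
    using assms[THEN Lp2_measurable] by measurable
qed (use abs_inner_le_squares in auto)

lemma Lp2_inner_bound:
  assumes f: "f \<in> Lp M 2" and g: "g \<in> Lp M 2"
  shows "\<bar>\<integral>x. f x \<bullet> g x \<partial>M\<bar> \<le> Lp_norm M 2 f * Lp_norm M 2 g"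
proof -
  let ?A = "\<integral>x. (norm (f x))\<^sup>2 \<partial>M" and ?B = "\<integral>x. (norm (g x))\<^sup>2 \<partial>M"
  note [measurable] = assms[THEN Lp2_measurable]
  have "ennreal \<bar>\<integral>x. f x \<bullet> g x \<partial>M\<bar> \<le> (\<integral>\<^sup>+x. ennreal (norm (f x \<bullet> g x)) \<partial>M)"
    using integral_norm_bound_ennreal[OF Lp2_integrable_inner[OF assms]] by simp
  also have "\<dots> \<le> (\<integral>\<^sup>+x. ennreal (norm (f x)) * ennreal (norm (g x)) \<partial>M)"
    by (intro nn_integral_mono) (auto simp: Cauchy_Schwarz_ineq2 simp flip: ennreal_mult)
  finally have "(ennreal \<bar>\<integral>x. f x \<bullet> g x \<partial>M\<bar>)\<^sup>2 \<le> (\<integral>\<^sup>+x. ennreal (norm (f x)) * ennreal (norm (g x)) \<partial>M)\<^sup>2"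
    by (intro power_mono) auto
  also have "\<dots> \<le> (\<integral>\<^sup>+x. (ennreal (norm (f x)))\<^sup>2 \<partial>M) * (\<integral>\<^sup>+x. (ennreal (norm (g x)))\<^sup>2 \<partial>M)"
    by (rule Cauchy_Schwarz_nn_integral) auto
  also have "\<dots> = msq M f * msq M g"
    by (simp add: msq_def ennreal_power)
  also have "\<dots> = ennreal (?A * ?B)"
    by (simp add: msq_eq_integral assms ennreal_mult)
  finally have "(\<integral>x. f x \<bullet> g x \<partial>M)\<^sup>2 \<le> ?A * ?B"
    by (simp add: ennreal_power)
  then show ?thesis
    unfolding Lp_norm2_eq real_sqrt_mult[symmetric] by (rule real_le_rsqrt[where x="\<bar>_\<bar>", simplified])
qed

text \<open>The decay \<open>(1/4)^k\<close> leaves room for the weight \<open>2^k\<close>: the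
  weighted squares are still summable almost everywhere, and the arithmetic-geometric inequality
  \<open>2 * norm d \<le> (1/2)^k + 2^k * (norm d)\<^sup>2\<close> converts this into summability of
  the norms.\<close>

lemma msq_AE_summable:
  fixes d :: "nat \<Rightarrow> 'a \<Rightarrow> 'b::euclidean_space"
  assumes [measurable]: "\<And>k. d k \<in> borel_measurable M" and d: "\<And>k. msq M (d k) \<le> ennreal ((1/4)^k)"
  shows "AE x in M. summable (\<lambda>k. norm (d k x))"
proof -
  have "(\<integral>\<^sup>+x. (\<Sum>k. ennreal (2^k * (norm (d k x))\<^sup>2)) \<partial>M) = (\<Sum>k. \<integral>\<^sup>+x. ennreal (2^k * (norm (d k x))\<^sup>2) \<partial>M)"
    by (rule nn_integral_suminf) auto
  also have "\<dots> \<le> (\<Sum>k. ennreal ((1/2)^k))"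
  proof (intro suminf_le summableI)
    fix k
    have "(\<integral>\<^sup>+x. ennreal (2^k * (norm (d k x))\<^sup>2) \<partial>M) = ennreal (2^k) * msq M (d k)"
      unfolding msq_def by (subst nn_integral_cmult[symmetric]) (auto simp: ennreal_mult)
    also have "\<dots> \<le> ennreal (2^k) * ennreal ((1/4)^k)"
      by (intro mult_left_mono d) auto
    also have "\<dots> = ennreal ((1/2)^k)"
      by (auto simp: ennreal_mult[symmetric] power_mult_distrib[symmetric])
    finally show "(\<integral>\<^sup>+x. ennreal (2^k * (norm (d k x))\<^sup>2) \<partial>M) \<le> ennreal ((1/2)^k)" .
  qed
  also have "\<dots> = ennreal (\<Sum>k. (1/2)^k)"
    by (intro suminf_ennreal2) auto
  also have "\<dots> < \<infinity>" by simp
  finally have "AE x in M. (\<Sum>k. ennreal (2^k * (norm (d k x))\<^sup>2)) \<noteq> \<infinity>"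
    by (intro nn_integral_PInf_AE) (auto simp: less_top)
  then show ?thesis
  proof eventually_elim
    case (elim x)
    have "summable (\<lambda>k. 2^k * (norm (d k x))\<^sup>2)"
      using elim by (intro summable_suminf_not_top) auto
    then have s: "summable (\<lambda>k. ((1/2)^k + 2^k * (norm (d k x))\<^sup>2) / 2)"
      by (intro summable_divide summable_add) auto
    show ?case
    proof (rule summable_comparison_test'[OF s])
      fix n :: nat assume "n \<ge> 0"
      define a where "a = sqrt (2^n)"
      have a: "a > 0" "a\<^sup>2 = 2^n" by (auto simp: a_def)
      have "2 * ((1/a) * (a * norm (d n x))) \<le> (1/a)\<^sup>2 + (a * norm (d n x))\<^sup>2"
        using sum_squares_bound[of "1/a" "a * norm (d n x)"] a(1) by (simp add: mult.assoc)
      then show "norm (norm (d n x)) \<le> ((1/2)^n + 2^n * (norm (d n x))\<^sup>2) / 2"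
        using a by (simp add: power_mult_distrib power_divide power_one_over)
    qed
  qed
qed

lemma ennreal_tendsto_0I:
  fixes f :: "'a \<Rightarrow> ennreal"
  assumes "\<And>e. e > 0 \<Longrightarrow> \<forall>\<^sub>F x in F. f x < ennreal e"
  shows "(f \<longlongrightarrow> 0) F"
proof (rule order_tendstoI)
  fix a :: ennreal assume "0 < a"
  then obtain b where "0 < b" "b < a" using dense by blast
  then obtain e where "b = ennreal e" "e > 0"
    by (cases b) auto
  then show "\<forall>\<^sub>F x in F. f x < a"
    using assms[of e] \<open>b < a\<close> by (auto elim: eventually_mono)
qed auto

text \<open>Riesz-Fischer: a subsequence with geometrically small steps converges almost everywhere,
  and Fatou along that subsequence carries the Cauchy bound over to its limit.\<close>

theorem Lp2_complete:
  fixes f :: "nat \<Rightarrow> 'a \<Rightarrow> 'b::euclidean_space"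
  assumes f: "\<And>n. f n \<in> Lp M 2"
    and Cauchy: "\<And>e. e > 0 \<Longrightarrow> \<exists>N. \<forall>m\<ge>N. \<forall>n\<ge>N. msq M (\<lambda>x. f m x - f n x) \<le> ennreal e"
  obtains g where "Lp_converges M 2 f g"
proof -
  note [measurable] = Lp2_measurable[OF f]
  have "\<exists>N. \<forall>k::nat. \<forall>m\<ge>N k. \<forall>n\<ge>N k. msq M (\<lambda>x. f m x - f n x) \<le> ennreal ((1/4)^k)"
    by (intro choice allI Cauchy) auto
  then obtain N where N: "\<And>k m n. m \<ge> N k \<Longrightarrow> n \<ge> N k \<Longrightarrow> msq M (\<lambda>x. f m x - f n x) \<le> ennreal ((1/4)^k)"
    by blast
  \<comment> \<open>Summing all thresholds up to \<open>k\<close> puts both \<open>s k\<close> and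
    \<open>s (Suc k)\<close> beyond \<open>N k\<close>; the extra \<open>k\<close> makes
    \<open>s\<close> tend to infinity, so that it passes any given \<open>K\<close> in the Fatou
    step.\<close>
  define s where "s k = k + (\<Sum>i\<le>k. N i)" for k :: nat
  have s_ge: "k \<le> s k" for k by (simp add: s_def)
  have s_N: "N j \<le> s k" if "j \<le> k" for j k
    unfolding s_def using that by (intro trans_le_add2 member_le_sum) auto
  have AE: "AE x in M. summable (\<lambda>k. norm (f (s (Suc k)) x - f (s k) x))"
    by (rule msq_AE_summable) (auto intro!: N s_N)
  define g where "g x = lim (\<lambda>k. f (s k) x)" for x
  have [measurable]: "g \<in> borel_measurable M"
    unfolding g_def by measurable
  have lim: "AE x in M. (\<lambda>k. f (s k) x) \<longlonglongrightarrow> g x"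
    using AE
  proof eventually_elim
    case (elim x)
    from summable_norm_cancel[OF elim] have "convergent (\<lambda>n. \<Sum>k<n. f (s (Suc k)) x - f (s k) x)"
      by (simp add: summable_iff_convergent)
    then have "convergent (\<lambda>n. (f (s n) x - f (s 0) x) + f (s 0) x)"
      using sum_lessThan_telescope[of "\<lambda>k. f (s k) x"] by (intro convergent_add convergent_const) simp
    then show ?case
      unfolding g_def by (simp add: convergent_LIMSEQ_iff)
  qed
  have conv: "msq M (\<lambda>x. f n x - g x) \<le> ennreal e"
    if e: "e > 0" and K: "\<forall>m\<ge>K. \<forall>n\<ge>K. msq M (\<lambda>x. f m x - f n x) \<le> ennreal e" and "n \<ge> K" for e K n
  proof -
    have "msq M (\<lambda>x. f n x - g x) = (\<integral>\<^sup>+x. liminf (\<lambda>k. ennreal ((norm (f n x - f (s k) x))\<^sup>2)) \<partial>M)"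
      unfolding msq_def
    proof (rule nn_integral_cong_AE, use lim in eventually_elim)
      case (elim x)
      have "(\<lambda>k. ennreal ((norm (f n x - f (s k) x))\<^sup>2)) \<longlonglongrightarrow> ennreal ((norm (f n x - g x))\<^sup>2)"
        by (intro tendsto_intros elim tendsto_ennrealI)
      then show ?case
        by (simp add: tendsto_iff_Liminf_eq_Limsup)
    qed
    also have "\<dots> \<le> liminf (\<lambda>k. msq M (\<lambda>x. f n x - f (s k) x))"
      unfolding msq_def by (rule nn_integral_liminf) auto
    also have "\<dots> \<le> limsup (\<lambda>k. msq M (\<lambda>x. f n x - f (s k) x))"
      by (rule Liminf_le_Limsup) auto
    also have "\<dots> \<le> ennreal e"
    proof (rule Limsup_bounded)
      show "\<forall>\<^sub>F k in sequentially. msq M (\<lambda>x. f n x - f (s k) x) \<le> ennreal e"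
        using eventually_ge_at_top[of K]
      proof eventually_elim
        case (elim k)
        with s_ge[of k] K \<open>n \<ge> K\<close> show ?case by auto
      qed
    qed
    finally show ?thesis .
  qed
  have lim0: "(\<lambda>n. msq M (\<lambda>x. f n x - g x)) \<longlonglongrightarrow> 0"
  proof (rule ennreal_tendsto_0I)
    fix e :: real assume "e > 0"
    obtain K where "\<forall>m\<ge>K. \<forall>n\<ge>K. msq M (\<lambda>x. f m x - f n x) \<le> ennreal (e/2)"
      using Cauchy[of "e/2"] \<open>e > 0\<close> by auto
    then have "\<forall>n\<ge>K. msq M (\<lambda>x. f n x - g x) \<le> ennreal (e/2)"
      using conv[of "e/2" K] \<open>e > 0\<close> by simp
    then show "\<forall>\<^sub>F n in sequentially. msq M (\<lambda>x. f n x - g x) < ennreal e"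
      unfolding eventually_sequentially using \<open>e > 0\<close>
      by (intro exI[of _ K]) (auto intro!: le_less_trans[of _ "ennreal (e/2)"] ennreal_lessI)
  qed
  obtain K where "\<forall>m\<ge>K. \<forall>n\<ge>K. msq M (\<lambda>x. f m x - f n x) \<le> ennreal 1"
    using Cauchy[of 1] by auto
  then have "msq M (\<lambda>x. f K x - g x) \<le> ennreal 1" using conv[of 1 K K] by simp
  then have "msq M (\<lambda>x. g x - f K x) < \<infinity>"
    by (subst msq_minus_commute) (auto intro: le_less_trans)
  then have "(\<lambda>x. g x - f K x) \<in> Lp M 2"
    by (simp add: Lp2_iff)
  from Lp2_add[OF this f[of K]] have "g \<in> Lp M 2" by simp
  then show ?thesis
    using that[of g] f lim0 by (simp add: Lp_converges2)
qed

lemma Lp2_norm_square: "f \<in> Lp M 2 \<Longrightarrow> ennreal ((Lp_norm M 2 f)\<^sup>2) = msq M f"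
  by (simp add: msq_eq_integral Lp_norm2_eq)

lemma Lp_norm2_nonneg: "0 \<le> Lp_norm M 2 f"
  by (simp add: Lp_norm2_eq)

lemma Lp_norm2_le:
  assumes "f \<in> Lp M 2" "msq M f \<le> ennreal (c\<^sup>2)" "c \<ge> 0"
  shows "Lp_norm M 2 f \<le> c"
proof -
  have "(Lp_norm M 2 f)\<^sup>2 \<le> c\<^sup>2"
    using assms(2) unfolding Lp2_norm_square[OF assms(1), symmetric] by simp
  then show ?thesis using assms(3) by (rule power2_le_imp_le)
qed

lemma Lp2_inner_tendsto:
  assumes "Lp_converges M 2 f g" and h: "h \<in> Lp M 2"
  shows "(\<lambda>n. \<integral>x. f n x \<bullet> h x \<partial>M) \<longlonglongrightarrow> (\<integral>x. g x \<bullet> h x \<partial>M)"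
proof -
  have f: "\<And>n. f n \<in> Lp M 2" and g: "g \<in> Lp M 2" and lim: "(\<lambda>n. Lp_norm M 2 (\<lambda>x. f n x - g x)) \<longlonglongrightarrow> 0"
    using assms(1) by (auto simp: Lp_converges_def)
  have "(\<lambda>n. (\<integral>x. f n x \<bullet> h x \<partial>M) - (\<integral>x. g x \<bullet> h x \<partial>M)) \<longlonglongrightarrow> 0"
  proof (rule Lim_null_comparison)
    show "(\<lambda>n. Lp_norm M 2 (\<lambda>x. f n x - g x) * Lp_norm M 2 h) \<longlonglongrightarrow> 0"
      using tendsto_mult[OF lim tendsto_const[of "Lp_norm M 2 h"]] by simp
    show "\<forall>\<^sub>F n in sequentially. norm ((\<integral>x. f n x \<bullet> h x \<partial>M) - (\<integral>x. g x \<bullet> h x \<partial>M))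
      \<le> Lp_norm M 2 (\<lambda>x. f n x - g x) * Lp_norm M 2 h"
    proof (intro always_eventually allI)
      fix n
      have "(\<integral>x. f n x \<bullet> h x \<partial>M) - (\<integral>x. g x \<bullet> h x \<partial>M) = (\<integral>x. (f n x - g x) \<bullet> h x \<partial>M)"
        by (subst Bochner_Integration.integral_diff[symmetric])
           (auto simp: inner_diff_left intro!: Lp2_integrable_inner f g h)
      then show "norm ((\<integral>x. f n x \<bullet> h x \<partial>M) - (\<integral>x. g x \<bullet> h x \<partial>M)) \<le> Lp_norm M 2 (\<lambda>x. f n x - g x) * Lp_norm M 2 h"
        using Lp2_inner_bound[OF Lp2_diff[OF f[of n] g] h] by simp
    qed
  qed
  then show ?thesis by (simp add: LIM_zero_iff)
qed

text \<open>The representing function is the limit of a minimising sequence of \<open>\<parallel>f\<parallel>\<^sup>2 - 2 \<phi>(f)\<close>.\<close>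

theorem Lp2_Riesz:
  fixes \<phi> :: "('a \<Rightarrow> 'b::euclidean_space) \<Rightarrow> real"
  assumes "\<phi> \<in> Lp_dual M 2"
  obtains g where "g \<in> Lp M 2" "\<And>f. f \<in> Lp M 2 \<Longrightarrow> \<phi> f = (\<integral>x. f x \<bullet> g x \<partial>M)"
proof -
  have add: "\<And>f g. f \<in> Lp M 2 \<Longrightarrow> g \<in> Lp M 2 \<Longrightarrow> \<phi> (\<lambda>x. f x + g x) = \<phi> f + \<phi> g"
    and scale: "\<And>c f. f \<in> Lp M 2 \<Longrightarrow> \<phi> (\<lambda>x. c *\<^sub>R f x) = c * \<phi> f"
    using assms by (auto simp: Lp_dual_def)
  obtain C where C: "\<And>f. f \<in> Lp M 2 \<Longrightarrow> \<bar>\<phi> f\<bar> \<le> C * Lp_norm M 2 f"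
    using assms unfolding Lp_dual_def by blast
  define S where "S f = (\<integral>x. (norm (f x))\<^sup>2 \<partial>M)" for f :: "'a \<Rightarrow> 'b"
  define J where "J f = S f - 2 * \<phi> f" for f
  have S_expand: "S (\<lambda>x. f x + c *\<^sub>R h x) = S f + 2 * c * (\<integral>x. f x \<bullet> h x \<partial>M) + c\<^sup>2 * S h"
    if f: "f \<in> Lp M 2" and h: "h \<in> Lp M 2" for f h c
  proof -
    have "S (\<lambda>x. f x + c *\<^sub>R h x) = (\<integral>x. (norm (f x))\<^sup>2 + 2 * c * (f x \<bullet> h x) + c\<^sup>2 * (norm (h x))\<^sup>2 \<partial>M)"
      unfolding S_def by (intro Bochner_Integration.integral_cong refl)
        (simp only: power2_norm_eq_inner inner_add_left inner_add_right, simp add: inner_commute algebra_simps power2_eq_square)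
    also have "\<dots> = S f + 2 * c * (\<integral>x. f x \<bullet> h x \<partial>M) + c\<^sup>2 * S h"
      unfolding S_def using Lp2_integrable_square[OF f] Lp2_integrable_square[OF h] Lp2_integrable_inner[OF f h]
      by (simp add: Bochner_Integration.integral_add)
    finally show ?thesis .
  qed
  have J_expand: "J (\<lambda>x. f x + c *\<^sub>R h x) = J f + 2 * c * ((\<integral>x. f x \<bullet> h x \<partial>M) - \<phi> h) + c\<^sup>2 * S h"
    if f: "f \<in> Lp M 2" and h: "h \<in> Lp M 2" for f h c
    unfolding J_def S_expand[OF that] using add[OF f Lp2_scaleR[OF h, of c]] scale[OF h, of c]
    by (simp add: algebra_simps)
  \<comment> \<open>Completing the square in \<open>S f - 2 * C * sqrt (S f)\<close>; the infimum
    \<open>d\<close> below is therefore finite.\<close>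
  have J_lower: "- C\<^sup>2 \<le> J f" if "f \<in> Lp M 2" for f
  proof -
    have S: "S f = (Lp_norm M 2 f)\<^sup>2" by (simp add: S_def Lp_norm2_eq)
    have "0 \<le> (Lp_norm M 2 f - C)\<^sup>2" by simp
    then show ?thesis
      using C[OF that] unfolding J_def S by (simp add: power2_eq_square algebra_simps)
  qed
  define d where "d = Inf (J ` Lp M 2)"
  have zero: "(\<lambda>x. 0) \<in> Lp M 2" by (simp add: Lp_def)
  have bdd: "bdd_below (J ` Lp M 2)"
    using J_lower by (intro bdd_belowI[of _ "- C\<^sup>2"]) auto
  have d: "d \<le> J f" if "f \<in> Lp M 2" for f
    unfolding d_def using that bdd by (intro cInf_lower) auto
  have "\<exists>f. f \<in> Lp M 2 \<and> J f < d + inverse (real (Suc n))" for n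
  proof -
    have "Inf (J ` Lp M 2) < d + inverse (real (Suc n))" by (simp add: d_def)
    from cInf_lessD[OF _ this] zero show ?thesis by auto
  qed
  then obtain f where f: "\<And>n. f n \<in> Lp M 2" and Jf: "\<And>n. J (f n) < d + inverse (real (Suc n))"
    by metis
  \<comment> \<open>Parallelogram argument: the midpoint of \<open>f m\<close> and
    \<open>f n\<close> cannot fall below the infimum \<open>d\<close>, and the sum of
    \<open>J\<close> at the two points minus twice \<open>J\<close> at the midpoint is exactly half
    of \<open>S\<close> of their difference.\<close>
  have S_diff: "S (\<lambda>x. f m x - f n x) \<le> 2 * inverse (real (Suc m)) + 2 * inverse (real (Suc n))" for m n
  proof -
    let ?h = "\<lambda>x. f m x - f n x"
    have h: "?h \<in> Lp M 2" by (intro Lp2_diff f)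
    have 1: "J (f m) = J (f n) + 2 * ((\<integral>x. f n x \<bullet> ?h x \<partial>M) - \<phi> ?h) + S ?h"
      using J_expand[OF f[of n] h, of 1] by simp
    have 2: "J (\<lambda>x. f n x + (1/2) *\<^sub>R ?h x) = J (f n) + ((\<integral>x. f n x \<bullet> ?h x \<partial>M) - \<phi> ?h) + S ?h / 4"
      using J_expand[OF f[of n] h, of "1/2"] by (simp add: power2_eq_square)
    have "d \<le> J (\<lambda>x. f n x + (1/2) *\<^sub>R ?h x)"
      by (intro d Lp2_add Lp2_scaleR f h)
    with 1 2 Jf[of m] Jf[of n] show ?thesis by simp
  qed
  have lim0: "(\<lambda>n. inverse (real (Suc n))) \<longlonglongrightarrow> 0" by (rule LIMSEQ_inverse_real_of_nat)
  obtain g where g: "Lp_converges M 2 f g"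
  proof (rule Lp2_complete[OF f])
    fix e :: real assume "e > 0"
    then have "\<forall>\<^sub>F n in sequentially. inverse (real (Suc n)) < e / 4"
      using order_tendstoD(2)[OF lim0, of "e/4"] by simp
    then obtain N where N: "\<And>n. n \<ge> N \<Longrightarrow> inverse (real (Suc n)) < e / 4"
      by (auto simp: eventually_sequentially)
    have "msq M (\<lambda>x. f m x - f n x) \<le> ennreal e" if "m \<ge> N" "n \<ge> N" for m n
    proof -
      have "S (\<lambda>x. f m x - f n x) \<le> e"
        using S_diff[of m n] N[OF that(1)] N[OF that(2)] by linarith
      then show ?thesis
        unfolding S_def by (subst msq_eq_integral) (auto intro!: Lp2_diff f ennreal_leI)
    qed
    then show "\<exists>N. \<forall>m\<ge>N. \<forall>n\<ge>N. msq M (\<lambda>x. f m x - f n x) \<le> ennreal e" by blast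
  qed
  show ?thesis
  proof (rule that)
    show "g \<in> Lp M 2" using g by (simp add: Lp_converges_def)
    fix h :: "'a \<Rightarrow> 'b" assume h: "h \<in> Lp M 2"
    define a where "a = (\<integral>x. g x \<bullet> h x \<partial>M) - \<phi> h"
    \<comment> \<open>First variation at the minimiser, obtained by perturbing the minimising
      sequence by a multiple \<open>c\<close> of \<open>h\<close> and passing to the limit. A
      quadratic in \<open>c\<close> that is nonnegative everywhere and has no constant term has no
      linear term either.\<close>
    have ge: "0 \<le> 2 * c * a + c\<^sup>2 * S h" for c
    proof (rule LIMSEQ_le_const)
      show "(\<lambda>n. 2 * c * ((\<integral>x. f n x \<bullet> h x \<partial>M) - \<phi> h) + c\<^sup>2 * S h + inverse (real (Suc n)))
              \<longlonglongrightarrow> 2 * c * a + c\<^sup>2 * S h"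
      proof -
        have "(\<lambda>n. 2 * c * ((\<integral>x. f n x \<bullet> h x \<partial>M) - \<phi> h) + c\<^sup>2 * S h + inverse (real (Suc n)))
                \<longlonglongrightarrow> 2 * c * ((\<integral>x. g x \<bullet> h x \<partial>M) - \<phi> h) + c\<^sup>2 * S h + 0"
          by (intro tendsto_add tendsto_mult tendsto_diff tendsto_const Lp2_inner_tendsto[OF g h] lim0)
        then show ?thesis by (simp only: a_def add_0_right)
      qed
      have "0 \<le> 2 * c * ((\<integral>x. f n x \<bullet> h x \<partial>M) - \<phi> h) + c\<^sup>2 * S h + inverse (real (Suc n))" for n
        using d[OF Lp2_add[OF f[of n] Lp2_scaleR[OF h, of c]]] Jf[of n]
        unfolding J_expand[OF f h] by simp
      then show "\<exists>N. \<forall>n\<ge>N. 0 \<le> 2 * c * ((\<integral>x. f n x \<bullet> h x \<partial>M) - \<phi> h) + c\<^sup>2 * S h + inverse (real (Suc n))"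
        by blast
    qed
    have "a = 0"
    proof (rule ccontr)
      assume "a \<noteq> 0"
      have S: "S h \<ge> 0" by (simp add: S_def)
      \<comment> \<open>\<open>D\<close> exceeds \<open>S h\<close> and stays positive when
        \<open>S h = 0\<close>. With \<open>c = - a / D\<close> the linear term is \<open>-2\<close>
        times \<open>a\<^sup>2 / D\<close>, while the quadratic term is at most
        \<open>a\<^sup>2 / D\<close>.\<close>
      define D where "D = 1 + S h"
      define c where "c = - a / D"
      have D: "D > 0" "S h / D \<le> 1" using S by (auto simp: D_def)
      have "c\<^sup>2 * S h = a\<^sup>2 / D * (S h / D)" by (simp add: c_def power2_eq_square)
      also have "\<dots> \<le> a\<^sup>2 / D * 1" using D by (intro mult_left_mono) auto
      finally have "c\<^sup>2 * S h \<le> a\<^sup>2 / D" by simp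
      moreover have "2 * c * a = - 2 * (a\<^sup>2 / D)" by (simp add: c_def power2_eq_square)
      moreover have "a\<^sup>2 / D > 0" using D \<open>a \<noteq> 0\<close> by simp
      ultimately show False using ge[of c] by linarith
    qed
    then show "\<phi> h = (\<integral>x. h x \<bullet> g x \<partial>M)"
      by (simp add: a_def inner_commute)
  qed
qed

section \<open>Weak convergence in L2 tested by bounded functions\<close>

lemma Lp2_bounded:
  assumes "finite_measure M" "Y \<in> borel_measurable M" "\<And>x. x \<in> space M \<Longrightarrow> norm (Y x) \<le> B"
  shows "Y \<in> Lp M 2"
proof -
  interpret finite_measure M by fact
  have "msq M Y \<le> (\<integral>\<^sup>+x. ennreal (B\<^sup>2) \<partial>M)"
    unfolding msq_def using assms(3) by (intro nn_integral_mono ennreal_leI power_mono) auto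
  also have "\<dots> < \<infinity>"
  proof -
    have "emeasure M (space M) < top" using emeasure_finite[of "space M"] top.not_eq_extremum by blast
    then show ?thesis by (simp add: ennreal_mult_less_top)
  qed
  finally show ?thesis using assms(2) by (simp add: Lp2_iff)
qed

text \<open>Large values are sent to \<open>0\<close> rather than scaled back to the ball, so that
  \<open>y \<bullet> truncate K y = (norm (truncate K y))\<^sup>2\<close>;
  \<open>msq_weak_lower_bound\<close> relies on this identity.\<close>

definition truncate :: "nat \<Rightarrow> 'b::real_normed_vector \<Rightarrow> 'b" where
  "truncate K y = (if norm y \<le> real K then y else 0)"

lemma truncate_measurable [measurable]:
  "truncate K \<in> borel_measurable (borel :: 'b::euclidean_space measure)"
  unfolding truncate_def by measurable

lemma norm_truncate_le: "norm (truncate K y) \<le> real K"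
  by (simp add: truncate_def)

lemma msq_truncate_tendsto:
  assumes f: "f \<in> Lp M 2"
  shows "(\<lambda>K. msq M (\<lambda>x. truncate K (f x) - f x)) \<longlonglongrightarrow> 0"
proof -
  note [measurable] = Lp2_measurable[OF f]
  have "(\<lambda>K. \<integral>\<^sup>+x. ennreal ((norm (truncate K (f x) - f x))\<^sup>2) \<partial>M) \<longlonglongrightarrow> (\<integral>\<^sup>+x. 0 \<partial>M)"
  proof (rule nn_integral_dominated_convergence[where w="\<lambda>x. ennreal ((norm (f x))\<^sup>2)"])
    show "(\<integral>\<^sup>+x. ennreal ((norm (f x))\<^sup>2) \<partial>M) < \<infinity>"
      using f by (simp add: Lp2_iff msq_def)
    show "AE x in M. (\<lambda>K. ennreal ((norm (truncate K (f x) - f x))\<^sup>2)) \<longlonglongrightarrow> 0"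
    proof (rule AE_I2)
      fix x
      obtain K0 :: nat where "norm (f x) \<le> real K0" using real_arch_simple by blast
      then have "\<forall>\<^sub>F K in sequentially. ennreal ((norm (truncate K (f x) - f x))\<^sup>2) = 0"
        unfolding eventually_sequentially by (intro exI[of _ K0]) (auto simp: truncate_def)
      then show "(\<lambda>K. ennreal ((norm (truncate K (f x) - f x))\<^sup>2)) \<longlonglongrightarrow> 0"
        by (rule tendsto_eventually)
    qed
  qed (auto simp: truncate_def intro!: ennreal_leI)
  then show ?thesis by (simp add: msq_def)
qed

text \<open>Weak convergence only has to be tested against bounded functions, because those are dense.\<close>

lemma Lp2_weakly_bounded_tests:
  assumes M: "finite_measure M"
    and f: "\<And>n. f n \<in> Lp M 2" and g: "g \<in> Lp M 2"
    and bd: "\<And>n. msq M (f n) \<le> c" "c < \<infinity>"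
    and test: "\<And>Y B. Y \<in> borel_measurable M \<Longrightarrow> (\<And>x. norm (Y x) \<le> B) \<Longrightarrow>
       (\<lambda>n. \<integral>x. f n x \<bullet> Y x \<partial>M) \<longlonglongrightarrow> (\<integral>x. g x \<bullet> Y x \<partial>M)"
    and h: "h \<in> Lp M 2"
  shows "(\<lambda>n. \<integral>x. f n x \<bullet> h x \<partial>M) \<longlonglongrightarrow> (\<integral>x. g x \<bullet> h x \<partial>M)"
proof (rule LIMSEQ_I)
  fix e :: real assume e: "0 < e"
  note [measurable] = Lp2_measurable[OF h]
  define C where "C = sqrt (enn2real c)"
  have c_eq: "c = ennreal (C\<^sup>2)" using bd(2) by (cases c) (auto simp: C_def)
  have C0: "C \<ge> 0" by (simp add: C_def)
  have nf: "Lp_norm M 2 (f n) \<le> C" for n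
    using bd(1)[of n] C0 unfolding c_eq by (intro Lp_norm2_le f)
  \<comment> \<open>One positive bound for the norms of all \<open>f n\<close> and of
    \<open>g\<close>, so that a single truncation level \<open>K\<close> of the test function serves
    the whole sequence.\<close>
  define D where "D = 1 + C + Lp_norm M 2 g"
  have D: "D > 0" "C \<le> D" "Lp_norm M 2 g \<le> D" using C0 Lp_norm2_nonneg[of M g] by (auto simp: D_def)
  have tr: "(\<lambda>x. truncate K (h x)) \<in> Lp M 2" for K
    by (rule Lp2_bounded[OF M, where B="real K"]) (auto simp: norm_truncate_le)
  then have "Lp_converges M 2 (\<lambda>K x. truncate K (h x)) h"
    using msq_truncate_tendsto[OF h] h by (simp add: Lp_converges2)
  then have "(\<lambda>K. Lp_norm M 2 (\<lambda>x. truncate K (h x) - h x)) \<longlonglongrightarrow> 0" by (simp add: Lp_converges_def)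
  then obtain K where K: "Lp_norm M 2 (\<lambda>x. truncate K (h x) - h x) < e / (4 * D)"
    using e D order_tendstoD(2)[of _ 0 sequentially "e / (4 * D)"] by (fastforce simp: eventually_sequentially)
  have app: "\<bar>(\<integral>x. u x \<bullet> h x \<partial>M) - (\<integral>x. u x \<bullet> truncate K (h x) \<partial>M)\<bar> \<le> e / 4"
    if u: "u \<in> Lp M 2" and "Lp_norm M 2 u \<le> D" for u
  proof -
    have "(\<integral>x. u x \<bullet> truncate K (h x) \<partial>M) - (\<integral>x. u x \<bullet> h x \<partial>M) = (\<integral>x. u x \<bullet> (truncate K (h x) - h x) \<partial>M)"
      by (subst Bochner_Integration.integral_diff[symmetric])
         (auto simp: inner_diff_right intro!: Lp2_integrable_inner u h tr)
    moreover have "\<bar>\<integral>x. u x \<bullet> (truncate K (h x) - h x) \<partial>M\<bar> \<le> D * (e / (4 * D))"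
      using Lp2_inner_bound[OF u Lp2_diff[OF tr[of K] h]] that(2) K D(1)
      by (intro order_trans[OF Lp2_inner_bound[OF u Lp2_diff[OF tr[of K] h]]] mult_mono) (auto simp: Lp_norm2_nonneg)
    moreover have "D * (e / (4 * D)) = e / 4" using D(1) by simp
    ultimately show ?thesis by linarith
  qed
  have "(\<lambda>n. \<integral>x. f n x \<bullet> truncate K (h x) \<partial>M) \<longlonglongrightarrow> (\<integral>x. g x \<bullet> truncate K (h x) \<partial>M)"
    by (rule test[where B="real K"]) (auto simp: norm_truncate_le)
  from LIMSEQ_D[OF this, of "e/4"] e obtain N where
    N: "\<And>n. n \<ge> N \<Longrightarrow> norm ((\<integral>x. f n x \<bullet> truncate K (h x) \<partial>M) - (\<integral>x. g x \<bullet> truncate K (h x) \<partial>M)) < e / 4"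
    by auto
  have "norm ((\<integral>x. f n x \<bullet> h x \<partial>M) - (\<integral>x. g x \<bullet> h x \<partial>M)) < e" if "n \<ge> N" for n
    using N[OF that] app[OF f[of n]] app[OF g] nf[of n] D e by (simp add: abs_if split: if_splits)
  then show "\<exists>N. \<forall>n\<ge>N. norm ((\<integral>x. f n x \<bullet> h x \<partial>M) - (\<integral>x. g x \<bullet> h x \<partial>M)) < e" by blast
qed

text \<open>\<open>Lp_dual\<close> consists of abstract functionals; \<open>Lp2_Riesz\<close> turns
  each into integration against a square-integrable function, after which density leaves only
  bounded tests.\<close>

lemma Lp2_converges_weaklyI:
  assumes "finite_measure M"
    and "\<And>n. f n \<in> Lp M 2" and "g \<in> Lp M 2"
    and "\<And>n. msq M (f n) \<le> c" "c < \<infinity>"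
    and "\<And>Y B. Y \<in> borel_measurable M \<Longrightarrow> (\<And>x. norm (Y x) \<le> B) \<Longrightarrow>
       (\<lambda>n. \<integral>x. f n x \<bullet> Y x \<partial>M) \<longlonglongrightarrow> (\<integral>x. g x \<bullet> Y x \<partial>M)"
  shows "Lp_converges_weakly M 2 f g"
  unfolding Lp_converges_weakly_def
proof (intro conjI allI ballI)
  fix \<phi> :: "('a \<Rightarrow> 'b) \<Rightarrow> real" assume "\<phi> \<in> Lp_dual M 2"
  then obtain h where h: "h \<in> Lp M 2" and \<phi>: "\<And>f. f \<in> Lp M 2 \<Longrightarrow> \<phi> f = (\<integral>x. f x \<bullet> h x \<partial>M)"
    using Lp2_Riesz by blast
  have "(\<lambda>n. \<integral>x. f n x \<bullet> h x \<partial>M) \<longlonglongrightarrow> (\<integral>x. g x \<bullet> h x \<partial>M)"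
    by (rule Lp2_weakly_bounded_tests[OF assms(1-5) _ h]) (rule assms(6))
  then show "(\<lambda>n. \<phi> (f n)) \<longlonglongrightarrow> \<phi> g" using \<phi> assms(2,3) by simp
qed (use assms in auto)

text \<open>Weak lower semicontinuity of the L2 norm, with \<open>f\<close> not yet known to be
  square-integrable. Testing against truncations of \<open>f\<close> itself bounds their squared
  norms by \<open>c\<close>, and Fatou removes the truncation. The finite-measure set
  \<open>A\<close> keeps the bounded tests in L2 when \<open>M\<close> is infinite, as it is on the
  whole time line.\<close>

lemma msq_weak_lower_bound:
  assumes [measurable]: "f \<in> borel_measurable M" and A: "A \<in> sets M" "emeasure M A < \<infinity>"
    and f0: "\<And>x. x \<in> space M \<Longrightarrow> x \<notin> A \<Longrightarrow> f x = 0"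
    and fn: "\<And>n. fn n \<in> Lp M 2" and bd: "\<forall>\<^sub>F n in sequentially. msq M (fn n) \<le> ennreal c"
    and c0: "c \<ge> 0"
    and test: "\<And>Y B. Y \<in> borel_measurable M \<Longrightarrow> (\<And>x. norm (Y x) \<le> B) \<Longrightarrow> (\<And>x. x \<notin> A \<Longrightarrow> Y x = 0) \<Longrightarrow>
       (\<lambda>n. \<integral>x. fn n x \<bullet> Y x \<partial>M) \<longlonglongrightarrow> (\<integral>x. f x \<bullet> Y x \<partial>M)"
  shows "msq M f \<le> ennreal c"
proof -
  note [measurable] = A(1)
  define Y where "Y K x = indicator A x *\<^sub>R truncate K (f x)" for K x
  have [measurable]: "Y K \<in> borel_measurable M" for K unfolding Y_def by measurable
  have Y_bd: "norm (Y K x) \<le> real K" for K x by (simp add: Y_def indicator_def norm_truncate_le)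
  have Y_L2: "Y K \<in> Lp M 2" for K
  proof -
    have "msq M (Y K) \<le> (\<integral>\<^sup>+x. ennreal ((real K)\<^sup>2) * indicator A x \<partial>M)"
      unfolding msq_def using norm_truncate_le[of K]
      by (intro nn_integral_mono) (auto simp: Y_def indicator_def intro!: ennreal_leI power_mono)
    also have "\<dots> < \<infinity>" using A by (simp add: nn_integral_cmult_indicator ennreal_mult_less_top)
    finally show ?thesis by (simp add: Lp2_iff)
  qed
  have Y_le: "msq M (Y K) \<le> ennreal c" for K
  proof -
    have "(\<integral>x. f x \<bullet> Y K x \<partial>M) = (\<integral>x. (norm (Y K x))\<^sup>2 \<partial>M)"
      by (intro Bochner_Integration.integral_cong refl)
         (auto simp: Y_def truncate_def indicator_def power2_norm_eq_inner)
    then have "(\<lambda>n. \<integral>x. fn n x \<bullet> Y K x \<partial>M) \<longlonglongrightarrow> (\<integral>x. (norm (Y K x))\<^sup>2 \<partial>M)"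
      using test[of "Y K" "real K"] Y_bd by (simp add: Y_def)
    \<comment> \<open>The inner product is at most half the sum of the squares; half of the square
      of the test function can then be absorbed into the left-hand side.\<close>
    then have "(\<integral>x. (norm (Y K x))\<^sup>2 \<partial>M) \<le> c / 2 + (\<integral>x. (norm (Y K x))\<^sup>2 \<partial>M) / 2"
    proof (rule tendsto_upperbound)
      show "\<forall>\<^sub>F n in sequentially. (\<integral>x. fn n x \<bullet> Y K x \<partial>M) \<le> c / 2 + (\<integral>x. (norm (Y K x))\<^sup>2 \<partial>M) / 2"
        using bd
      proof eventually_elim
        case (elim n)
        have "(\<integral>x. fn n x \<bullet> Y K x \<partial>M) \<le> (\<integral>x. (norm (fn n x))\<^sup>2 / 2 + (norm (Y K x))\<^sup>2 / 2 \<partial>M)"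
          by (intro integral_mono order_trans[OF abs_ge_self abs_inner_le_squares] Lp2_integrable_inner fn Y_L2 Bochner_Integration.integrable_add integrable_divide
              Lp2_integrable_square)
        also have "\<dots> = (\<integral>x. (norm (fn n x))\<^sup>2 \<partial>M) / 2 + (\<integral>x. (norm (Y K x))\<^sup>2 \<partial>M) / 2"
          using Lp2_integrable_square[OF fn[of n]] Lp2_integrable_square[OF Y_L2[of K]] by simp
        also have "(\<integral>x. (norm (fn n x))\<^sup>2 \<partial>M) \<le> c"
          using elim c0 unfolding msq_eq_integral[OF fn[of n]] by (simp add: ennreal_le_iff)
        finally show ?case by simp
      qed
    qed auto
    then show ?thesis unfolding msq_eq_integral[OF Y_L2[of K]] by (intro ennreal_leI) simp
  qed
  have "msq M f = (\<integral>\<^sup>+x. liminf (\<lambda>K. ennreal ((norm (Y K x))\<^sup>2)) \<partial>M)"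
    unfolding msq_def
  proof (rule nn_integral_cong)
    fix x assume x: "x \<in> space M"
    obtain K0 :: nat where K0: "norm (f x) \<le> real K0" using real_arch_simple by blast
    have "\<forall>\<^sub>F K in sequentially. ennreal ((norm (Y K x))\<^sup>2) = ennreal ((norm (f x))\<^sup>2)"
      unfolding eventually_sequentially using f0[OF x] K0
      by (intro exI[of _ K0]) (auto simp: Y_def truncate_def indicator_def)
    then have "(\<lambda>K. ennreal ((norm (Y K x))\<^sup>2)) \<longlonglongrightarrow> ennreal ((norm (f x))\<^sup>2)"
      by (rule tendsto_eventually)
    then show "ennreal ((norm (f x))\<^sup>2) = liminf (\<lambda>K. ennreal ((norm (Y K x))\<^sup>2))"
      by (simp add: tendsto_iff_Liminf_eq_Limsup)
  qed
  also have "\<dots> \<le> liminf (\<lambda>K. msq M (Y K))"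
    unfolding msq_def by (rule nn_integral_liminf) auto
  also have "\<dots> \<le> limsup (\<lambda>K. msq M (Y K))"
    by (rule Liminf_le_Limsup) auto
  also have "\<dots> \<le> ennreal c"
    by (rule Limsup_bounded) (use Y_le in auto)
  finally show ?thesis .
qed

section \<open>Sobolev functions of order above half the dimension are bounded\<close>

definition cube :: "(real^'d) set" where
  "cube = {x. \<forall>i. 0 \<le> x $ i \<and> x $ i < 1}"

lemma cube_measurable [measurable]: "cube \<in> sets borel"
proof -
  have "cube = (\<Inter>i\<in>UNIV. {x::real^'d. 0 \<le> x $ i \<and> x $ i < 1})" by (auto simp: cube_def)
  also have "\<dots> \<in> sets borel" by (intro sets.finite_INT) auto
  finally show ?thesis .
qed

lemma torus_eq: "torus = restrict_space lborel cube"
  by (simp add: torus_def cube_def)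

lemma space_torus: "space torus = cube"
  by (simp add: torus_eq space_restrict_space)

lemma cube_Basis: "x \<in> cube \<longleftrightarrow> (\<forall>b\<in>Basis. 0 \<le> x \<bullet> b \<and> x \<bullet> b < 1)"
  by (auto simp: cube_def Basis_vec_def cart_eq_inner_axis)

lemma indicator_cube: "indicator cube x = (\<Prod>b\<in>Basis. indicator {0..<1} (x \<bullet> b) :: 'a::comm_semiring_1)"
proof (cases "x \<in> cube")
  case True then show ?thesis by (simp add: cube_Basis)
next
  case False
  then obtain b where "b \<in> Basis" "x \<bullet> b \<notin> {0..<1}" by (auto simp: cube_Basis)
  then have "(\<Prod>b\<in>Basis. indicator {0..<1} (x \<bullet> b) :: 'a) = 0"
    by (intro prod_zero bexI[of _ b]) auto
  then show ?thesis using False by simp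
qed

lemma integral_torus:
  fixes f :: "real^'d \<Rightarrow> 'b::{banach, second_countable_topology}"
  shows "(\<integral>x. f x \<partial>torus) = (\<integral>x. indicator cube x *\<^sub>R f x \<partial>lborel)"
  unfolding torus_eq by (subst integral_restrict_space) auto

lemma emeasure_cube: "emeasure lborel (cube :: (real^'d) set) = 1"
proof -
  have "emeasure lborel (cube :: (real^'d) set) = (\<integral>\<^sup>+x. (\<Prod>b\<in>Basis. indicator {0..<1} (x \<bullet> b)) \<partial>(lborel :: (real^'d) measure))"
    by (simp flip: indicator_cube)
  also have "\<dots> = (\<Prod>b\<in>(Basis::(real^'d) set). (\<integral>\<^sup>+x. indicator {0..<1::real} x \<partial>lborel))"
    by (rule nn_integral_lborel_prod) auto
  finally show ?thesis by simp
qed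

lemma prob_space_torus: "prob_space (torus :: (real^'d) measure)"
  by (rule prob_spaceI) (simp add: torus_eq space_restrict_space emeasure_restrict_space emeasure_cube)

lemma integral_lborel_prod:
  fixes f :: "'a::euclidean_space \<Rightarrow> real \<Rightarrow> 'b::{real_normed_field, banach, second_countable_topology}"
  assumes int: "\<And>b. b \<in> Basis \<Longrightarrow> integrable lborel (f b)"
  shows "(\<integral>x. (\<Prod>b\<in>Basis. f b (x \<bullet> b)) \<partial>lborel) = (\<Prod>b\<in>Basis. \<integral>t. f b t \<partial>lborel)"
proof -
  interpret product_sigma_finite "\<lambda>_::'a. lborel :: real measure" ..
  have [measurable]: "f b \<in> borel_measurable borel" if "b \<in> Basis" for b
    using int[OF that] by auto
  have "(\<integral>x. (\<Prod>b\<in>Basis. f b (x \<bullet> b)) \<partial>lborel)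
     = (\<integral>x. (\<Prod>b\<in>Basis. f b ((\<Sum>c\<in>Basis. x c *\<^sub>R c) \<bullet> b)) \<partial>(\<Pi>\<^sub>M b\<in>(Basis::'a set). lborel))"
    by (subst lborel_eq, subst integral_distr) auto
  also have "\<dots> = (\<integral>x. (\<Prod>b\<in>Basis. f b (x b)) \<partial>(\<Pi>\<^sub>M b\<in>(Basis::'a set). lborel))"
    by (intro Bochner_Integration.integral_cong prod.cong refl)
       (simp add: inner_sum_left inner_Basis if_distrib sum.delta cong: if_cong)
  also have "\<dots> = (\<Prod>b\<in>Basis. \<integral>t. f b t \<partial>lborel)"
    by (rule product_integral_prod) (auto intro: int)
  finally show ?thesis .
qed

section \<open>Characters and trigonometric polynomials on the torus\<close>

definition tchar :: "int^'d \<Rightarrow> real^'d \<Rightarrow> complex" where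
  "tchar \<xi> x = cis (2 * pi * (\<Sum>i\<in>UNIV. of_int (\<xi> $ i) * x $ i))"

lemma tchar_add: "tchar (\<xi> + \<eta>) x = tchar \<xi> x * tchar \<eta> x"
  by (simp add: tchar_def cis_mult algebra_simps sum.distrib)

lemma norm_tchar [simp]: "norm (tchar \<xi> x) = 1"
  by (simp add: tchar_def)

lemma tchar_measurable [measurable]: "tchar \<xi> \<in> borel_measurable borel"
  unfolding tchar_def by (intro borel_measurable_continuous_onI continuous_intros)

lemma tchar_measurable_torus [measurable]: "tchar \<xi> \<in> borel_measurable torus"
  unfolding torus_eq by (intro measurable_restrict_space1) simp

lemma fourier_coeff_tchar: "fourier_coeff \<beta> \<xi> = (\<integral>x. complex_of_real (\<beta> x) * tchar (- \<xi>) x \<partial>torus)"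
  by (simp add: fourier_coeff_def tchar_def sum_negf)

lemma cis_measurable: "(\<lambda>t. cis (2 * pi * (a * t))) \<in> borel_measurable borel"
  by (intro borel_measurable_continuous_onI continuous_intros)

lemma integral_cis_period:
  "(\<integral>t. indicator {0..<1} t *\<^sub>R cis (2 * pi * (of_int k * t)) \<partial>lborel) = (if k = 0 then 1 else 0)"
proof -
  \<comment> \<open>The endpoint \<open>1\<close> is added, at the cost of a null set, because the
    fundamental theorem of calculus is applied on a closed interval.\<close>
  have AE: "(\<integral>t. indicator {0..<1} t *\<^sub>R cis (2 * pi * (of_int k * t)) \<partial>lborel)
     = (\<integral>t. indicator {0..1} t *\<^sub>R cis (2 * pi * (of_int k * t)) \<partial>lborel)"
  proof (rule integral_cong_AE)
    show "AE t in lborel. indicator {0..<1} t *\<^sub>R cis (2 * pi * (of_int k * t)) = indicator {0..1} t *\<^sub>R cis (2 * pi * (of_int k * t))"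
      using AE_lborel_singleton[of "1::real"] by eventually_elim (auto simp: indicator_def)
  qed (auto intro!: borel_measurable_scaleR cis_measurable)
  show ?thesis
  proof (cases "k = 0")
    case True then show ?thesis unfolding AE by (simp add: measure_def)
  next
    case False
    define a where "a = 2 * pi * of_int k"
    have a: "a \<noteq> 0" using False by (simp add: a_def)
    have "(\<integral>t. indicator {0..1} t *\<^sub>R cis (a * t) \<partial>lborel) = cis (a * 1) / (\<i> * of_real a) - cis (a * 0) / (\<i> * of_real a)"
    proof (rule integral_FTC_Icc)
      fix t :: real
      have "((\<lambda>z. exp (\<i> * of_real a * z) / (\<i> * of_real a)) has_field_derivative exp (\<i> * of_real a * of_real t)) (at (of_real t))"
        using a by (auto intro!: derivative_eq_intros)
      from has_vector_derivative_real_field[OF this]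
      show "((\<lambda>t. cis (a * t) / (\<i> * of_real a)) has_vector_derivative cis (a * t)) (at t within {0..1})"
        by (simp add: cis_conv_exp mult.assoc)
    qed (auto intro!: continuous_intros)
    also have "cis (a * 1) = 1"
      using cis_multiple_2pi[of "of_int k"] by (simp add: a_def mult.assoc)
    finally show ?thesis using False unfolding AE by (simp add: a_def mult.assoc)
  qed
qed

text \<open>The integral factors over the coordinates, and a single nonzero frequency kills the
  product. Together with \<open>tchar_add\<close> this is the orthogonality of the
  characters.\<close>

lemma integral_tchar: "(\<integral>x. tchar \<xi> x \<partial>torus) = (if \<xi> = 0 then 1 else 0)" for \<xi> :: "int^'d"
proof -
  define \<zeta> :: "real^'d" where "\<zeta> = (\<chi> i. of_int (\<xi> $ i))"
  have "tchar \<xi> x = (\<Prod>b\<in>Basis. cis (2 * pi * ((\<zeta> \<bullet> b) * (x \<bullet> b))))" for x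
  proof -
    have "(\<Sum>i\<in>UNIV. of_int (\<xi> $ i) * x $ i) = \<zeta> \<bullet> x" by (simp add: inner_vec_def \<zeta>_def)
    also have "\<dots> = (\<Sum>b\<in>Basis. (\<zeta> \<bullet> b) * (x \<bullet> b))" by (rule euclidean_inner)
    finally show ?thesis
      by (simp add: tchar_def cis_conv_exp exp_sum sum_distrib_left sum_distrib_right)
  qed
  then have "(\<integral>x. tchar \<xi> x \<partial>torus) = (\<integral>x. (\<Prod>b\<in>Basis. indicator {0..<1} (x \<bullet> b) *\<^sub>R cis (2 * pi * ((\<zeta> \<bullet> b) * (x \<bullet> b)))) \<partial>(lborel::(real^'d) measure))"
    unfolding integral_torus indicator_cube by (simp add: scaleR_conv_of_real prod.distrib)
  also have "\<dots> = (\<Prod>b\<in>Basis. \<integral>t. indicator {0..<1} t *\<^sub>R cis (2 * pi * ((\<zeta> \<bullet> b) * t)) \<partial>lborel)"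
  proof (rule integral_lborel_prod)
    fix b :: "real^'d"
    show "integrable lborel (\<lambda>t. indicator {0..<1} t *\<^sub>R cis (2 * pi * ((\<zeta> \<bullet> b) * t)))"
      by (rule Bochner_Integration.integrable_bound[of _ "indicator {0..<1::real}"])
         (auto intro!: borel_measurable_scaleR cis_measurable)
  qed
  also have "\<dots> = (\<Prod>b\<in>Basis. if \<zeta> \<bullet> b = 0 then 1 else 0)"
  proof (rule prod.cong[OF refl])
    fix b :: "real^'d" assume "b \<in> Basis"
    then obtain i where b: "b = axis i 1" by (auto simp: Basis_vec_def)
    have "\<zeta> \<bullet> b = of_int (\<xi> $ i)" by (simp add: b \<zeta>_def inner_axis)
    then show "(\<integral>t. indicator {0..<1} t *\<^sub>R cis (2 * pi * ((\<zeta> \<bullet> b) * t)) \<partial>lborel) = (if \<zeta> \<bullet> b = 0 then 1 else 0)"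
      using integral_cis_period[of "\<xi> $ i"] by simp
  qed
  also have "\<dots> = (if \<xi> = 0 then 1 else 0)"
  proof (cases "\<xi> = 0")
    case True
    then have "\<zeta> = 0" by (simp add: \<zeta>_def vec_eq_iff)
    then show ?thesis using True by simp
  next
    case False
    then obtain i where "\<xi> $ i \<noteq> 0" by (auto simp: vec_eq_iff)
    then have "\<zeta> \<bullet> axis i 1 \<noteq> 0" by (simp add: \<zeta>_def inner_axis)
    moreover have "(axis i 1 :: real^'d) \<in> Basis" by (auto simp: Basis_vec_def)
    ultimately have "(\<Prod>b\<in>(Basis::(real^'d) set). if \<zeta> \<bullet> b = 0 then 1 else (0::complex)) = 0"
      by (intro prod_zero) auto
    then show ?thesis using False by simp
  qed
  finally show ?thesis .
qed

text \<open>Trigonometric polynomials as the span of the characters. Only sums are built in; closure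
  under products follows from \<open>tchar_add\<close>. Both closures are used for polynomials in
  the coordinates of \<open>torus_embedding\<close>.\<close>

inductive trig :: "(real^'d \<Rightarrow> complex) \<Rightarrow> bool" where
  char: "trig (\<lambda>x. c * tchar \<xi> x)"
| add: "trig f \<Longrightarrow> trig g \<Longrightarrow> trig (\<lambda>x. f x + g x)"

lemma trig_const: "trig (\<lambda>x. c)"
  using trig.char[of c 0] by (simp add: tchar_def)

lemma trig_mult: assumes "trig f" "trig g" shows "trig (\<lambda>x. f x * g x)"
  using assms
proof (induction arbitrary: g rule: trig.induct)
  case (char c \<xi>)
  from char show ?case
  proof (induction rule: trig.induct)
    case (char d \<eta>)
    show ?case using trig.char[of "c * d" "\<xi> + \<eta>"] by (simp add: tchar_add mult_ac)
  next
    case (add f g)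
    then show ?case using trig.add by (fastforce simp: distrib_left)
  qed
next
  case (add f h)
  then show ?case using trig.add by (fastforce simp: distrib_right)
qed

lemma trig_sum: "finite A \<Longrightarrow> (\<And>i. i \<in> A \<Longrightarrow> trig (f i)) \<Longrightarrow> trig (\<lambda>x. \<Sum>i\<in>A. f i x)"
  by (induction A rule: finite_induct) (auto intro: trig_const trig.add)

text \<open>Terms of equal frequency are collected, so that orthogonality can read off each
  coefficient as an integral.\<close>

lemma trig_representation:
  assumes "trig g"
  shows "\<exists>S c. finite S \<and> g = (\<lambda>x. \<Sum>\<xi>\<in>S. c \<xi> * tchar \<xi> x)"
  using assms
proof (induction rule: trig.induct)
  case (char c \<xi>)
  show ?case by (intro exI[of _ "{\<xi>}"] exI[of _ "\<lambda>_. c"]) auto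
next
  case (add f g)
  then obtain S c T d where *: "finite S" "f = (\<lambda>x. \<Sum>\<xi>\<in>S. c \<xi> * tchar \<xi> x)"
    "finite T" "g = (\<lambda>x. \<Sum>\<xi>\<in>T. d \<xi> * tchar \<xi> x)" by blast
  have "(\<Sum>\<xi>\<in>S. c \<xi> * tchar \<xi> x) = (\<Sum>\<xi>\<in>S\<union>T. (if \<xi> \<in> S then c \<xi> else 0) * tchar \<xi> x)"
    "(\<Sum>\<xi>\<in>T. d \<xi> * tchar \<xi> x) = (\<Sum>\<xi>\<in>S\<union>T. (if \<xi> \<in> T then d \<xi> else 0) * tchar \<xi> x)" for x
    using * by (auto intro!: sum.mono_neutral_cong_left)
  then show ?case using *
    by (intro exI[of _ "S \<union> T"] exI[of _ "\<lambda>\<xi>. (if \<xi> \<in> S then c \<xi> else 0) + (if \<xi> \<in> T then d \<xi> else 0)"])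
       (auto simp: sum.distrib distrib_right)
qed

lemma integrable_torus_bounded:
  fixes f g :: "real^'d \<Rightarrow> 'b::{real_normed_field, banach, second_countable_topology}"
  assumes "integrable torus f" "g \<in> borel_measurable torus" "\<And>x. norm (g x) \<le> B"
  shows "integrable torus (\<lambda>x. f x * g x)"
proof (rule Bochner_Integration.integrable_bound)
  show "integrable torus (\<lambda>x. B * norm (f x))" using assms by auto
  show "(\<lambda>x. f x * g x) \<in> borel_measurable torus" using assms by auto
  have "norm (f x) * norm (g x) \<le> B * norm (f x)" for x
    using mult_right_mono[OF assms(3) norm_ge_zero, of x "f x"] by (simp add: mult.commute)
  then show "AE x in torus. norm (f x * g x) \<le> norm (B * norm (f x))"
    by (intro AE_I2) (simp add: norm_mult, meson abs_ge_self order_trans abs_mult)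
qed

text \<open>Expanding \<open>g\<close> turns the pairing into the finite sum of
  \<open>c \<xi> * fourier_coeff \<beta> (- \<xi>)\<close>, and each \<open>c \<xi>\<close>, being a
  Fourier coefficient of \<open>g\<close>, is at most the L1 norm of \<open>g\<close>. Thus \<beta>
  acts on trigonometric polynomials like a function bounded by \<open>C\<close>.\<close>

lemma trig_pairing_bound:
  fixes \<beta> :: "real^'d \<Rightarrow> real"
  assumes \<beta>: "integrable torus \<beta>"
    and C: "\<And>S. finite S \<Longrightarrow> (\<Sum>\<xi>\<in>S. cmod (fourier_coeff \<beta> \<xi>)) \<le> C"
    and g: "trig g"
  shows "cmod (\<integral>x. complex_of_real (\<beta> x) * g x \<partial>torus) \<le> C * (\<integral>x. cmod (g x) \<partial>torus)"
proof -
  interpret prob_space "torus :: (real^'d) measure" by (rule prob_space_torus)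
  obtain S c where S: "finite S" and g_eq: "g = (\<lambda>x. \<Sum>\<xi>\<in>S. c \<xi> * tchar \<xi> x)"
    using trig_representation[OF g] by blast
  have int_tchar: "integrable torus (\<lambda>x. f x * tchar \<xi> x)" if "integrable torus f" for f and \<xi> :: "int^'d"
    using that by (intro integrable_torus_bounded[where B=1]) auto
  have int_tchar1: "integrable torus (\<lambda>x. tchar \<xi> x)" for \<xi> :: "int^'d"
    using int_tchar[of "\<lambda>_. 1"] by simp
  have int_g: "integrable torus g" unfolding g_eq by (auto intro!: int_tchar1)
  have c_eq: "c \<xi> = (\<integral>x. g x * tchar (- \<xi>) x \<partial>torus)" if "\<xi> \<in> S" for \<xi>
  proof -
    have "(\<integral>x. g x * tchar (- \<xi>) x \<partial>torus) = (\<integral>x. (\<Sum>\<eta>\<in>S. c \<eta> * tchar (\<eta> - \<xi>) x) \<partial>torus)"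
      by (intro Bochner_Integration.integral_cong refl)
         (simp add: g_eq sum_distrib_right tchar_add[symmetric] mult.assoc)
    also have "\<dots> = (\<Sum>\<eta>\<in>S. c \<eta> * (\<integral>x. tchar (\<eta> - \<xi>) x \<partial>torus))"
      by (subst Bochner_Integration.integral_sum) (auto intro!: int_tchar1)
    also have "\<dots> = (\<Sum>\<eta>\<in>S. if \<eta> = \<xi> then c \<eta> else 0)"
      by (intro sum.cong refl) (simp add: integral_tchar)
    also have "\<dots> = c \<xi>" using S that by simp
    finally show ?thesis by simp
  qed
  have c_le: "cmod (c \<xi>) \<le> (\<integral>x. cmod (g x) \<partial>torus)" if "\<xi> \<in> S" for \<xi>
  proof -
    have "cmod (c \<xi>) \<le> (\<integral>x. cmod (g x * tchar (- \<xi>) x) \<partial>torus)"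
      unfolding c_eq[OF that] by (rule integral_norm_bound)
    then show ?thesis by (simp add: norm_mult)
  qed
  have "(\<integral>x. complex_of_real (\<beta> x) * g x \<partial>torus) = (\<integral>x. (\<Sum>\<xi>\<in>S. c \<xi> * (complex_of_real (\<beta> x) * tchar \<xi> x)) \<partial>torus)"
    by (intro Bochner_Integration.integral_cong refl) (simp add: g_eq sum_distrib_left mult_ac)
  also have "\<dots> = (\<Sum>\<xi>\<in>S. c \<xi> * (\<integral>x. complex_of_real (\<beta> x) * tchar \<xi> x \<partial>torus))"
    using \<beta> by (subst Bochner_Integration.integral_sum) (auto intro!: int_tchar)
  also have "\<dots> = (\<Sum>\<xi>\<in>S. c \<xi> * fourier_coeff \<beta> (- \<xi>))"
    by (simp add: fourier_coeff_tchar)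
  finally have "cmod (\<integral>x. complex_of_real (\<beta> x) * g x \<partial>torus) \<le> (\<Sum>\<xi>\<in>S. cmod (c \<xi>) * cmod (fourier_coeff \<beta> (- \<xi>)))"
    by (simp add: norm_mult[symmetric] norm_sum)
  also have "\<dots> \<le> (\<Sum>\<xi>\<in>S. (\<integral>x. cmod (g x) \<partial>torus) * cmod (fourier_coeff \<beta> (- \<xi>)))"
    by (intro sum_mono mult_right_mono c_le) auto
  also have "\<dots> = (\<integral>x. cmod (g x) \<partial>torus) * (\<Sum>\<xi>\<in>uminus ` S. cmod (fourier_coeff \<beta> \<xi>))"
    by (simp add: sum_distrib_left sum.reindex)
  also have "\<dots> \<le> (\<integral>x. cmod (g x) \<partial>torus) * C"
    using S by (intro mult_left_mono C) auto
  finally show ?thesis by (simp add: mult.commute)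
qed

section \<open>Absolute summability of the Fourier coefficients\<close>

text \<open>Comparison with the series of \<open>n powr (-(2 * s))\<close>, convergent since
  \<open>2 * s > 1\<close>; negative integers are folded onto positive ones at the cost of a factor
  two.\<close>

lemma int_sum_bounded:
  assumes s: "s > 1/2"
  shows "\<exists>B. \<forall>A::int set. finite A \<longrightarrow> (\<Sum>k\<in>A. (1 + (of_int k)\<^sup>2) powr (-s)) \<le> (B::real)"
proof -
  define h where "h k = (1 + (of_int k)\<^sup>2) powr (-s)" for k :: int
  have h0: "h k \<ge> 0" for k by (simp add: h_def)
  have le: "h (int n) \<le> real n powr (-(2 * s))" if "n > 0" for n
  proof -
    have "h (int n) \<le> ((real n)\<^sup>2) powr (-s)"
      unfolding h_def using that s by (intro powr_mono2') auto
    also have "(real n)\<^sup>2 powr (-s) = (real n powr 2) powr (-s)" using that by simp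
    also have "\<dots> = real n powr (-(2 * s))"
      by (simp only: powr_powr) simp
    finally show ?thesis .
  qed
  have sm: "summable (\<lambda>n. h (int n))"
  proof (rule summable_comparison_test_ev)
    show "summable (\<lambda>n. real n powr (-(2 * s)))"
      using s by (simp add: summable_real_powr_iff)
    show "\<forall>\<^sub>F n in sequentially. norm (h (int n)) \<le> real n powr (-(2 * s))"
      using eventually_gt_at_top[of 0] by eventually_elim (use le h0 in auto)
  qed
  define B where "B = (\<Sum>n. h (int n))"
  have "(\<Sum>k\<in>A. h k) \<le> 2 * B" if A: "finite A" for A
  proof -
    define N where "N = nat ` abs ` A"
    have fin: "finite N" using A by (simp add: N_def)
    have "A \<subseteq> int ` N \<union> (\<lambda>n. - int n) ` N"
    proof
      fix k assume "k \<in> A"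
      then have "nat \<bar>k\<bar> \<in> N" by (auto simp: N_def)
      moreover have "k = int (nat \<bar>k\<bar>) \<or> k = - int (nat \<bar>k\<bar>)" by auto
      ultimately show "k \<in> int ` N \<union> (\<lambda>n. - int n) ` N" by blast
    qed
    then have "(\<Sum>k\<in>A. h k) \<le> (\<Sum>k\<in>int ` N \<union> (\<lambda>n. - int n) ` N. h k)"
      using fin h0 by (intro sum_mono2) auto
    also have "\<dots> \<le> (\<Sum>k\<in>int ` N. h k) + (\<Sum>k\<in>(\<lambda>n. - int n) ` N. h k)"
      using sum.union_inter[of "int ` N" "(\<lambda>n. - int n) ` N" h] fin sum_nonneg[of "int ` N \<inter> (\<lambda>n. - int n) ` N" h] h0
      by simp
    also have "\<dots> = 2 * (\<Sum>n\<in>N. h (int n))"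
      by (simp add: sum.reindex inj_on_def h_def)
    also have "\<dots> \<le> 2 * B"
      unfolding B_def using sm fin h0 by (intro mult_left_mono sum_le_suminf) auto
    finally show ?thesis .
  qed
  then show ?thesis unfolding h_def by blast
qed

text \<open>The exponent is shared out equally among the coordinates: with \<open>s = q / d\<close>
  the summand is at most a product of one-dimensional terms
  \<open>(1 + k\<^sup>2) powr (-s)\<close>, because \<open>1 + k\<^sup>2\<close> for a single
  coordinate \<open>k\<close> is at most the full weight. The condition \<open>q > d/2\<close>
  becomes \<open>s > 1/2\<close>, the range in which the one-dimensional sum converges.\<close>

lemma lattice_sum_bounded:
  assumes q: "q > real CARD('d) / 2"
  shows "\<exists>B. \<forall>S::(int^'d) set. finite S \<longrightarrow>
     (\<Sum>\<xi>\<in>S. (1 + (\<Sum>i\<in>UNIV. (of_int (\<xi> $ i))\<^sup>2)) powr (-q)) \<le> (B::real)"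
proof -
  define s where "s = q / real CARD('d)"
  have s: "s > 1/2" using q by (simp add: s_def field_simps)
  obtain B where B: "\<And>A::int set. finite A \<Longrightarrow> (\<Sum>k\<in>A. (1 + (of_int k)\<^sup>2) powr (-s)) \<le> B"
    using int_sum_bounded[OF s] by blast
  have le: "(1 + (\<Sum>i\<in>UNIV. (of_int (\<xi> $ i))\<^sup>2)) powr (-q) \<le> (\<Prod>i\<in>UNIV. (1 + (of_int (\<xi> $ i))\<^sup>2) powr (-s))"
    for \<xi> :: "int^'d"
  proof -
    let ?N = "1 + (\<Sum>i\<in>UNIV. (of_int (\<xi> $ i))\<^sup>2) :: real"
    have N: "?N \<ge> 1" by (simp add: sum_nonneg)
    have "?N powr (-q) = (\<Prod>i\<in>(UNIV::'d set). ?N powr (-s))"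
      using N by (simp add: powr_realpow[symmetric] powr_powr s_def powr_power)
    also have "\<dots> \<le> (\<Prod>i\<in>UNIV. (1 + (of_int (\<xi> $ i))\<^sup>2) powr (-s))"
    proof (intro prod_mono conjI powr_mono2')
      fix i :: 'd
      show "1 + (of_int (\<xi> $ i))\<^sup>2 \<le> ?N"
        using member_le_sum[of i UNIV "\<lambda>i. (of_int (\<xi> $ i))\<^sup>2 :: real"] by simp
      show "(0::real) < 1 + (of_int (\<xi> $ i))\<^sup>2" by (simp add: add_pos_nonneg)
    qed (use s in auto)
    finally show ?thesis .
  qed
  have "(\<Sum>\<xi>\<in>S. (1 + (\<Sum>i\<in>UNIV. (of_int (\<xi> $ i))\<^sup>2)) powr (-q)) \<le> B ^ CARD('d)" if S: "finite S" for S :: "(int^'d) set"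
  proof -
    \<comment> \<open>All coordinates of all points of \<open>S\<close> lie in \<open>A\<close>, so
      \<open>S\<close> sits inside a full grid over \<open>A\<close>, on which the sum of products
      is a product of sums.\<close>
    define A where "A = (\<Union>i. (\<lambda>\<xi>. \<xi> $ i) ` S)"
    have A: "finite A" using S by (auto simp: A_def)
    let ?P = "PiE (UNIV::'d set) (\<lambda>_. A)"
    have inj: "inj_on vec_lambda ?P" by (auto simp: inj_on_def vec_lambda_inject)
    have sub: "S \<subseteq> vec_lambda ` ?P"
    proof
      fix \<xi> assume "\<xi> \<in> S"
      then have "vec_nth \<xi> \<in> ?P" by (auto simp: A_def)
      then show "\<xi> \<in> vec_lambda ` ?P" by (metis image_eqI vec_nth_inverse)
    qed
    have finP: "finite ?P" using A by (intro finite_PiE) auto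
    have "(\<Sum>\<xi>\<in>S. (1 + (\<Sum>i\<in>UNIV. (of_int (\<xi> $ i))\<^sup>2)) powr (-q)) \<le> (\<Sum>\<xi>\<in>S. \<Prod>i\<in>UNIV. (1 + (of_int (\<xi> $ i))\<^sup>2) powr (-s))"
      by (intro sum_mono le)
    also have "\<dots> \<le> (\<Sum>\<xi>\<in>vec_lambda ` ?P. \<Prod>i\<in>UNIV. (1 + (of_int (\<xi> $ i))\<^sup>2) powr (-s))"
      using sub finP by (intro sum_mono2) (auto intro!: prod_nonneg)
    also have "\<dots> = (\<Sum>g\<in>?P. \<Prod>i\<in>UNIV. (1 + (of_int (g i))\<^sup>2) powr (-s))"
      by (subst sum.reindex[OF inj]) simp
    also have "\<dots> = (\<Prod>i\<in>(UNIV::'d set). \<Sum>k\<in>A. (1 + (of_int k)\<^sup>2) powr (-s))"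
      using A by (subst prod_sum_PiE) auto
    also have "\<dots> \<le> B ^ CARD('d)"
      using B[OF A] by (auto intro!: power_mono sum_nonneg)
    finally show ?thesis .
  qed
  then show ?thesis by blast
qed

text \<open>Arithmetic-geometric inequality with weight \<open>N \<xi> powr (q/2)\<close>: the
  Sobolev sum controls one half and the lattice sum of \<open>N \<xi> powr (-q)\<close> the
  other.\<close>

lemma sobolev_fourier_sum_bounded:
  fixes \<beta> :: "real^'d \<Rightarrow> real"
  assumes q: "q > real CARD('d) / 2" and \<beta>: "\<beta> \<in> sobolev_torus q"
  shows "\<exists>C. \<forall>S. finite S \<longrightarrow> (\<Sum>\<xi>\<in>S. cmod (fourier_coeff \<beta> \<xi>)) \<le> C"
proof -
  define N :: "int^'d \<Rightarrow> real" where "N \<xi> = 1 + (\<Sum>i\<in>UNIV. (of_int (\<xi> $ i))\<^sup>2)" for \<xi>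
  have N: "N \<xi> > 0" for \<xi> by (simp add: N_def sum_nonneg add_pos_nonneg)
  obtain B where B: "\<And>S. finite S \<Longrightarrow> (\<Sum>\<xi>\<in>S. N \<xi> powr (-q)) \<le> B"
    using lattice_sum_bounded[OF q] unfolding N_def by blast
  let ?u = "\<lambda>\<xi>. N \<xi> powr q * (cmod (fourier_coeff \<beta> \<xi>))\<^sup>2"
  have sm: "?u summable_on UNIV"
    using \<beta> by (simp add: sobolev_torus_def N_def)
  have "(\<Sum>\<xi>\<in>S. cmod (fourier_coeff \<beta> \<xi>)) \<le> (infsum ?u UNIV + B) / 2" if S: "finite S" for S
  proof -
    have "cmod (fourier_coeff \<beta> \<xi>) \<le> (?u \<xi> + N \<xi> powr (-q)) / 2" for \<xi>
    proof -
      let ?a = "N \<xi> powr (q/2)" and ?c = "cmod (fourier_coeff \<beta> \<xi>)"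
      have a: "?a > 0" using N[of \<xi>] by simp
      have "2 * (?a * ?c) * (1 / ?a) \<le> (?a * ?c)\<^sup>2 + (1 / ?a)\<^sup>2" by (rule sum_squares_bound)
      moreover have "?a\<^sup>2 = N \<xi> powr q" by (simp add: power2_eq_square powr_add[symmetric])
      ultimately show ?thesis using a N[of \<xi>]
        by (simp add: power_mult_distrib power_divide powr_minus_divide)
    qed
    then have "(\<Sum>\<xi>\<in>S. cmod (fourier_coeff \<beta> \<xi>)) \<le> (\<Sum>\<xi>\<in>S. (?u \<xi> + N \<xi> powr (-q)) / 2)"
      by (intro sum_mono)
    also have "\<dots> = ((\<Sum>\<xi>\<in>S. ?u \<xi>) + (\<Sum>\<xi>\<in>S. N \<xi> powr (-q))) / 2"
      by (simp add: sum.distrib sum_divide_distrib[symmetric])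
    also have "\<dots> \<le> (infsum ?u UNIV + B) / 2"
      using finite_sum_le_infsum[OF sm S] B[OF S] by (intro divide_right_mono add_mono) auto
    finally show ?thesis .
  qed
  then show ?thesis by blast
qed

section \<open>From trigonometric polynomials to an essential bound\<close>

text \<open>The torus as a product of circles in Euclidean space. The coordinates are trigonometric
  polynomials, hence so is every real polynomial in them; Stone-Weierstrass on the compact image
  therefore produces trigonometric approximations of functions that factor through the
  embedding.\<close>

definition torus_embedding :: "real^'d \<Rightarrow> (real^'d) \<times> (real^'d)" where
  "torus_embedding x = (\<chi> i. cos (2 * pi * x $ i), \<chi> i. sin (2 * pi * x $ i))"

lemma continuous_torus_embedding: "continuous_on A torus_embedding"
  unfolding torus_embedding_def by (intro continuous_intros)

text \<open>Coordinates with equal sine and cosine differ by an integer, and two numbers in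
  \<open>[0,1)\<close> differ by an integer only if they agree.\<close>

lemma torus_embedding_inj: "inj_on torus_embedding cube"
proof (rule inj_onI)
  fix x y :: "real^'d"
  assume x: "x \<in> cube" and y: "y \<in> cube" and eq: "torus_embedding x = torus_embedding y"
  show "x = y"
  proof (rule vec_eq_iff[THEN iffD2], rule allI)
    fix i
    have "sin (2 * pi * x $ i) = sin (2 * pi * y $ i) \<and> cos (2 * pi * x $ i) = cos (2 * pi * y $ i)"
      using eq by (simp add: torus_embedding_def vec_eq_iff)
    then obtain n :: int where n: "2 * pi * x $ i = 2 * pi * y $ i + 2 * pi * of_int n"
      using sin_cos_eq_iff by blast
    then have "2 * pi * x $ i = 2 * pi * (y $ i + of_int n)" by (simp add: distrib_left)
    then have "x $ i = y $ i + of_int n" by simp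
    moreover have "0 \<le> x $ i" "x $ i < 1" "0 \<le> y $ i" "y $ i < 1" using x y by (auto simp: cube_def)
    ultimately have "of_int n < (1::real)" "of_int n > (-1::real)" by linarith+
    then have "n = 0" by linarith
    then show "x $ i = y $ i" using \<open>x $ i = y $ i + of_int n\<close> by simp
  qed
qed

lemma trig_cos_sin:
  fixes i :: "'d::finite"
  shows "trig (\<lambda>x::real^'d. of_real (cos (2 * pi * x $ i)))" (is ?c)
    and "trig (\<lambda>x::real^'d. of_real (sin (2 * pi * x $ i)))" (is ?s)
proof -
  define e :: "int^'d" where "e = axis i 1"
  have e: "tchar e x = cis (2 * pi * x $ i)" "tchar (- e) x = cis (- (2 * pi * x $ i))" for x
  proof -
    have *: "of_int (e $ j) * x $ j = (if j = i then x $ j else 0)" for j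
      by (simp add: e_def axis_def)
    show "tchar e x = cis (2 * pi * x $ i)" "tchar (- e) x = cis (- (2 * pi * x $ i))"
      by (simp_all add: tchar_def * sum_negf)
  qed
  have "(\<lambda>x::real^'d. of_real (cos (2 * pi * x $ i))) = (\<lambda>x. (1/2) * tchar e x + (1/2) * tchar (- e) x)"
    unfolding e by (auto simp: fun_eq_iff complex_eq_iff)
  then show ?c by (simp only:) (intro trig.intros)
  have "(\<lambda>x::real^'d. of_real (sin (2 * pi * x $ i))) = (\<lambda>x. (- \<i>/2) * tchar e x + (\<i>/2) * tchar (- e) x)"
    unfolding e by (auto simp: fun_eq_iff complex_eq_iff)
  then show ?s by (simp only:) (intro trig.intros)
qed

lemma trig_scale: "trig f \<Longrightarrow> trig (\<lambda>x. f x * c)"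
  by (intro trig_mult trig_const)

lemma trig_polynomial:
  fixes P :: "(real^'d) \<times> (real^'d) \<Rightarrow> real"
  assumes "real_polynomial_function P"
  shows "trig (\<lambda>x. of_real (P (torus_embedding x)))"
  using assms
proof (induction rule: real_polynomial_function.induct)
  case (linear f)
  define v where "v = (\<Sum>b\<in>Basis. f b *\<^sub>R b)"
  have "f z = z \<bullet> v" for z
  proof -
    have "f z = f (\<Sum>b\<in>Basis. (z \<bullet> b) *\<^sub>R b)" by (simp add: euclidean_representation)
    also have "\<dots> = (\<Sum>b\<in>Basis. (z \<bullet> b) * f b)"
      using linear by (simp add: bounded_linear.linear linear_sum linear_scale)
    finally show ?thesis by (simp add: v_def inner_sum_right mult.commute)
  qed
  then have "(\<lambda>x. complex_of_real (f (torus_embedding x))) = (\<lambda>x.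
     (\<Sum>i\<in>UNIV. of_real (cos (2 * pi * x $ i)) * of_real (fst v $ i)) +
     (\<Sum>i\<in>UNIV. of_real (sin (2 * pi * x $ i)) * of_real (snd v $ i)))"
    by (simp add: torus_embedding_def inner_prod_def inner_vec_def)
  then show ?case by (auto intro!: trig.add trig_sum trig_scale trig_cos_sin)
qed (auto intro: trig_const trig.add trig_mult)

lemma borel_measurable_torus: "f \<in> borel_measurable borel \<Longrightarrow> f \<in> borel_measurable torus"
  unfolding torus_eq by (intro measurable_restrict_space1) simp

text \<open>Stone-Weierstrass on the image of the closed cube replaces \<open>u\<close> uniformly by
  a polynomial \<open>P\<close>, to which \<open>trig_pairing_bound\<close> applies.\<close>

lemma continuous_pairing_bound:
  fixes \<beta> :: "real^'d \<Rightarrow> real" and u :: "(real^'d) \<times> (real^'d) \<Rightarrow> real"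
  assumes \<beta>: "integrable torus \<beta>"
    and C: "\<And>S. finite S \<Longrightarrow> (\<Sum>\<xi>\<in>S. cmod (fourier_coeff \<beta> \<xi>)) \<le> C"
    and u: "continuous_on UNIV u"
  shows "\<bar>\<integral>x. \<beta> x * u (torus_embedding x) \<partial>torus\<bar> \<le> C * (\<integral>x. \<bar>u (torus_embedding x)\<bar> \<partial>torus)"
proof (rule field_le_epsilon)
  interpret prob_space "torus :: (real^'d) measure" by (rule prob_space_torus)
  fix e :: real assume e: "e > 0"
  have C0: "C \<ge> 0" using C[of "{}"] by simp
  define K where "K = torus_embedding ` (cbox 0 (\<chi> i. 1) :: (real^'d) set)"
  have K: "compact K" unfolding K_def by (intro compact_continuous_image continuous_torus_embedding compact_cbox)
  have cubeK: "torus_embedding x \<in> K" if "x \<in> cube" for x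
    unfolding K_def using that by (auto simp: cube_def mem_box_cart intro!: imageI less_imp_le)
  define I where "I = (\<integral>x. \<bar>\<beta> x\<bar> \<partial>torus)"
  have I0: "I \<ge> 0" by (simp add: I_def)
  \<comment> \<open>Replacing \<open>u\<close> by \<open>P\<close> costs \<open>I * d\<close> in the
    pairing and \<open>C * d\<close> in the L1 norm; the summand \<open>1\<close> keeps the
    denominator positive.\<close>
  define d where "d = e / (1 + I + C)"
  have d: "d > 0" "d * (I + C) \<le> e"
    using e I0 C0 by (auto simp: d_def field_simps)
  obtain P where P: "real_polynomial_function P" "\<And>z. z \<in> K \<Longrightarrow> \<bar>u z - P z\<bar> < d"
    using Stone_Weierstrass_real_polynomial_function[OF K continuous_on_subset[OF u] d(1)] by blast
  let ?E = torus_embedding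
  have m: "(\<lambda>x. f (?E x)) \<in> borel_measurable torus" if "continuous_on UNIV f" for f :: "(real^'d) \<times> (real^'d) \<Rightarrow> real"
    by (intro borel_measurable_torus borel_measurable_continuous_onI continuous_on_compose2[OF that continuous_torus_embedding]) auto
  have P_cont: "continuous_on UNIV P"
    using P(1) continuous_on_polymonial_function real_polynomial_function_eq by blast
  note [measurable] = m[OF u] m[OF P_cont]
  have bdd: "\<exists>B. \<forall>z\<in>K. \<bar>f z\<bar> \<le> B" if "continuous_on UNIV f" for f :: "(real^'d) \<times> (real^'d) \<Rightarrow> real"
    using compact_imp_bounded[OF compact_continuous_image[OF continuous_on_subset[OF that] K]]
    by (auto simp: bounded_iff)
  have int1: "integrable torus (\<lambda>x. f (?E x))" if f: "continuous_on UNIV f" for f :: "(real^'d) \<times> (real^'d) \<Rightarrow> real"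
  proof -
    obtain B where "\<forall>z\<in>K. \<bar>f z\<bar> \<le> B" using bdd[OF f] by blast
    then show ?thesis
      using m[OF f] cubeK by (intro integrable_const_bound[where B=B]) (auto simp: space_torus)
  qed
  have int2: "integrable torus (\<lambda>x. \<beta> x * f (?E x))" if f: "continuous_on UNIV f" for f :: "(real^'d) \<times> (real^'d) \<Rightarrow> real"
  proof -
    obtain B where B: "\<forall>z\<in>K. \<bar>f z\<bar> \<le> B" using bdd[OF f] by blast
    show ?thesis
    proof (rule Bochner_Integration.integrable_bound)
      show "integrable torus (\<lambda>x. B * \<beta> x)" using \<beta> by auto
      show "(\<lambda>x. \<beta> x * f (?E x)) \<in> borel_measurable torus" using \<beta> m[OF f] by auto
      show "AE x in torus. norm (\<beta> x * f (?E x)) \<le> norm (B * \<beta> x)"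
      proof (rule AE_I2)
        fix x :: "real^'d" assume "x \<in> space torus"
        then have "\<bar>f (?E x)\<bar> \<le> \<bar>B\<bar>" using B cubeK by (force simp: space_torus)
        then show "norm (\<beta> x * f (?E x)) \<le> norm (B * \<beta> x)"
          by (simp add: abs_mult mult.commute[of "\<bar>\<beta> x\<bar>"] mult_right_mono)
      qed
    qed
  qed
  have "cmod (\<integral>x. complex_of_real (\<beta> x) * of_real (P (?E x)) \<partial>torus) \<le> C * (\<integral>x. cmod (of_real (P (?E x))) \<partial>torus)"
    by (rule trig_pairing_bound[OF \<beta> C trig_polynomial[OF P(1)]])
  then have bP: "\<bar>\<integral>x. \<beta> x * P (?E x) \<partial>torus\<bar> \<le> C * (\<integral>x. \<bar>P (?E x)\<bar> \<partial>torus)"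
    by (simp del: of_real_mult add: of_real_mult[symmetric])
  have uP: "\<bar>u (?E x) - P (?E x)\<bar> \<le> d" if "x \<in> cube" for x
    using P(2)[OF cubeK[OF that]] by simp
  have 1: "(\<integral>x. \<bar>P (?E x)\<bar> \<partial>torus) \<le> (\<integral>x. \<bar>u (?E x)\<bar> \<partial>torus) + d"
  proof -
    have "(\<integral>x. \<bar>P (?E x)\<bar> \<partial>torus) \<le> (\<integral>x. \<bar>u (?E x)\<bar> + d \<partial>torus)"
      using uP by (intro integral_mono Bochner_Integration.integrable_add integrable_abs int1 u P_cont) (force simp: space_torus)+
    also have "\<dots> = (\<integral>x. \<bar>u (?E x)\<bar> \<partial>torus) + d"
      using int1[OF u] prob_space by (subst Bochner_Integration.integral_add) auto
    finally show ?thesis .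
  qed
  have 2: "\<bar>(\<integral>x. \<beta> x * u (?E x) \<partial>torus) - (\<integral>x. \<beta> x * P (?E x) \<partial>torus)\<bar> \<le> I * d"
  proof -
    have "(\<integral>x. \<beta> x * u (?E x) \<partial>torus) - (\<integral>x. \<beta> x * P (?E x) \<partial>torus) = (\<integral>x. \<beta> x * (u (?E x) - P (?E x)) \<partial>torus)"
      using int2[OF u] int2[OF P_cont] by (simp add: right_diff_distrib)
    also have "\<bar>\<dots>\<bar> \<le> (\<integral>x. \<bar>\<beta> x * (u (?E x) - P (?E x))\<bar> \<partial>torus)"
      using integral_norm_bound[of torus "\<lambda>x. \<beta> x * (u (?E x) - P (?E x))"] by simp
    also have "\<dots> \<le> (\<integral>x. \<bar>\<beta> x\<bar> * d \<partial>torus)"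
    proof (intro integral_mono integrable_abs integrable_mult_left \<beta>)
      show "integrable torus (\<lambda>x. \<beta> x * (u (?E x) - P (?E x)))"
        using Bochner_Integration.integrable_diff[OF int2[OF u] int2[OF P_cont]] by (simp add: right_diff_distrib)
    qed (use uP in \<open>auto simp: space_torus abs_mult intro!: mult_left_mono\<close>)
    finally show ?thesis by (simp add: I_def)
  qed
  have "\<bar>\<integral>x. \<beta> x * u (?E x) \<partial>torus\<bar> \<le> C * ((\<integral>x. \<bar>u (?E x)\<bar> \<partial>torus) + d) + I * d"
    using 2 bP mult_left_mono[OF 1 C0] by linarith
  also have "\<dots> = C * (\<integral>x. \<bar>u (?E x)\<bar> \<partial>torus) + d * (I + C)" by (simp add: algebra_simps)
  finally show "\<bar>\<integral>x. \<beta> x * u (?E x) \<partial>torus\<bar> \<le> C * (\<integral>x. \<bar>u (?E x)\<bar> \<partial>torus) + e"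
    using d(2) by simp
qed

text \<open>On the cube the indicator of \<open>K\<close> is the pointwise limit of tents around the
  embedded set \<open>K'\<close>. Injectivity of the embedding on the half-open cube keeps points
  outside \<open>K\<close> at positive distance from \<open>K'\<close>; dominated convergence
  carries both sides of the bound.\<close>

lemma compact_pairing_bound:
  fixes \<beta> :: "real^'d \<Rightarrow> real"
  assumes \<beta>: "integrable torus \<beta>"
    and C: "\<And>S. finite S \<Longrightarrow> (\<Sum>\<xi>\<in>S. cmod (fourier_coeff \<beta> \<xi>)) \<le> C"
    and K: "compact K" "K \<subseteq> cube"
  shows "\<bar>\<integral>x. \<beta> x * indicator K x \<partial>torus\<bar> \<le> C * measure torus K"
proof (cases "K = {}")
  case True then show ?thesis by simp
next
  case False
  interpret prob_space "torus :: (real^'d) measure" by (rule prob_space_torus)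
  let ?E = torus_embedding
  define K' where "K' = ?E ` K"
  have K': "closed K'" "K' \<noteq> {}" unfolding K'_def
    using False K by (auto intro!: compact_imp_closed compact_continuous_image continuous_torus_embedding)
  define u where "u n z = max 0 (1 - real n * infdist z K')" for n z
  have u_cont: "continuous_on A (u n)" for n A
    unfolding u_def by (intro continuous_intros)
  have u_bd: "\<bar>u n z\<bar> \<le> 1" for n z by (auto simp: u_def infdist_nonneg)
  have [measurable]: "(\<lambda>x. u n (?E x)) \<in> borel_measurable torus" for n
    by (intro borel_measurable_torus borel_measurable_continuous_onI continuous_on_compose2[OF u_cont continuous_torus_embedding]) auto
  have lim: "(\<lambda>n. u n (?E x)) \<longlonglongrightarrow> indicator K x" if x: "x \<in> cube" for x
  proof (cases "x \<in> K")
    case True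
    then have "u n (?E x) = 1" for n by (simp add: u_def K'_def)
    then show ?thesis using True by simp
  next
    case False
    have "?E x \<notin> K'" unfolding K'_def using False x K torus_embedding_inj by (meson inj_on_image_mem_iff)
    then have pos: "infdist (?E x) K' > 0"
      using K' in_closed_iff_infdist_zero infdist_nonneg less_eq_real_def by metis
    obtain N :: nat where N: "1 < real N * infdist (?E x) K'" using reals_Archimedean3[OF pos] by blast
    have "u n (?E x) = 0" if "n \<ge> N" for n
    proof -
      have "real N * infdist (?E x) K' \<le> real n * infdist (?E x) K'" using that pos by (intro mult_right_mono) auto
      then show ?thesis using N by (simp add: u_def)
    qed
    then have "\<forall>\<^sub>F n in sequentially. u n (?E x) = 0" unfolding eventually_sequentially by blast
    then show ?thesis using False by (simp add: tendsto_eventually)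
  qed
  have [measurable]: "K \<in> sets torus"
    unfolding torus_eq using K by (simp add: sets_restrict_space_iff compact_imp_closed borel_closed)
  have "(\<lambda>n. \<integral>x. \<beta> x * u n (?E x) \<partial>torus) \<longlonglongrightarrow> (\<integral>x. \<beta> x * indicator K x \<partial>torus)"
  proof (rule integral_dominated_convergence[where w="\<lambda>x. \<bar>\<beta> x\<bar>"])
    show "AE x in torus. (\<lambda>n. \<beta> x * u n (?E x)) \<longlonglongrightarrow> \<beta> x * indicator K x"
      by (intro AE_I2 tendsto_intros lim) (simp add: space_torus)
    show "AE x in torus. norm (\<beta> x * u n (?E x)) \<le> \<bar>\<beta> x\<bar>" for n
      using u_bd by (intro AE_I2) (simp add: abs_mult mult_left_le)
  qed (use \<beta> in auto)
  moreover have "(\<lambda>n. C * (\<integral>x. \<bar>u n (?E x)\<bar> \<partial>torus)) \<longlonglongrightarrow> C * (\<integral>x. \<bar>indicator K x\<bar> \<partial>torus)"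
  proof (intro tendsto_mult tendsto_const integral_dominated_convergence[where w="\<lambda>x. 1"])
    show "AE x in torus. (\<lambda>n. \<bar>u n (?E x)\<bar>) \<longlonglongrightarrow> \<bar>indicator K x\<bar>"
      by (intro AE_I2 tendsto_intros lim) (simp add: space_torus)
  qed (use u_bd in auto)
  moreover have "\<bar>\<integral>x. \<beta> x * u n (?E x) \<partial>torus\<bar> \<le> C * (\<integral>x. \<bar>u n (?E x)\<bar> \<partial>torus)" for n
    by (rule continuous_pairing_bound[OF \<beta> C u_cont])
  ultimately have "\<bar>\<integral>x. \<beta> x * indicator K x \<partial>torus\<bar> \<le> C * (\<integral>x. \<bar>indicator K x\<bar> \<partial>torus)"
    using LIMSEQ_le[OF tendsto_rabs] by blast
  then show ?thesis by simp
qed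

text \<open>On a compact subset of the set where \<beta> exceeds \<open>C\<close>, the strictly
  positive function \<open>\<beta> - C\<close> has integral at most zero, so the subset is null. By
  inner regularity the whole set is null.\<close>

lemma AE_torus_le:
  fixes \<beta> :: "real^'d \<Rightarrow> real"
  assumes \<beta>: "integrable torus \<beta>"
    and le: "\<And>K. compact K \<Longrightarrow> K \<subseteq> cube \<Longrightarrow> (\<integral>x. \<beta> x * indicator K x \<partial>torus) \<le> C * measure torus K"
  shows "AE x in torus. \<beta> x \<le> C"
proof -
  interpret prob_space "torus :: (real^'d) measure" by (rule prob_space_torus)
  define B where "B = {x\<in>space torus. C < \<beta> x}"
  have B: "B \<in> sets torus" unfolding B_def using \<beta> by measurable
  then have B': "B \<in> sets borel" "B \<subseteq> cube"
    by (auto simp: torus_eq sets_restrict_space_iff)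
  \<comment> \<open>The torus measure carried to a finite Borel measure on all of Euclidean space,
    the setting in which \<open>inner_regular\<close> is applied.\<close>
  define N where "N = density (lborel::(real^'d) measure) (indicator cube)"
  have N_eq: "emeasure N A = emeasure torus A" if "A \<in> sets borel" "A \<subseteq> cube" for A
    unfolding N_def torus_eq using that
    by (simp add: emeasure_density emeasure_restrict_space Int_absorb2 flip: indicator_inter_arith)
       (metis inf.absorb_iff2 inf_commute)
  have "emeasure N B = (SUP K \<in> {K. K \<subseteq> B \<and> compact K}. emeasure N K)"
    by (rule inner_regular)
       (use B' in \<open>auto simp: N_def emeasure_density emeasure_cube\<close>)
  moreover have "emeasure N K = 0" if K: "K \<subseteq> B" "compact K" for K
  proof -
    have Kc: "K \<subseteq> cube" using K B' by auto
    have Km: "K \<in> sets torus" unfolding torus_eq using K Kc by (simp add: sets_restrict_space_iff compact_imp_closed borel_closed)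
    have int: "integrable torus (\<lambda>x. \<beta> x * indicator K x)"
      using integrable_mult_indicator[OF Km \<beta>] by (simp add: mult.commute)
    have intK: "integrable torus (indicator K :: _ \<Rightarrow> real)"
      using Km by (intro integrable_real_indicator) (auto simp: emeasure_finite less_top[symmetric])
    have int': "integrable torus (\<lambda>x. (\<beta> x - C) * indicator K x)"
      using int intK by (simp add: left_diff_distrib)
    have nn: "(\<beta> x - C) * indicator K x \<ge> 0" for x
      using K by (auto simp: B_def indicator_def less_imp_le)
    have "(\<integral>x. (\<beta> x - C) * indicator K x \<partial>torus) = (\<integral>x. \<beta> x * indicator K x \<partial>torus) - C * measure torus K"
      using int intK Km by (simp add: left_diff_distrib)
    then have "(\<integral>x. (\<beta> x - C) * indicator K x \<partial>torus) = 0"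
      using le[OF K(2) Kc] Bochner_Integration.integral_nonneg[of torus "\<lambda>x. (\<beta> x - C) * indicator K x"] nn
      by simp
    then have "AE x in torus. (\<beta> x - C) * indicator K x = 0"
      using integral_nonneg_eq_0_iff_AE[OF int'] nn by simp
    then have "AE x in torus. x \<notin> K"
      by eventually_elim (use K in \<open>auto simp: B_def\<close>)
    moreover have "{x \<in> space torus. \<not> x \<notin> K} = K" using Kc by (auto simp: space_torus)
    ultimately have "emeasure torus K = 0"
      using Km AE_iff_null[of torus "\<lambda>x. x \<notin> K"] by (simp add: null_sets_def)
    then show ?thesis using N_eq[of K] K Kc by (simp add: compact_imp_closed borel_closed)
  qed
  ultimately have "emeasure N B \<le> 0" by (simp only:) (rule SUP_least, simp)
  then have "emeasure N B = 0" by simp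
  then have "emeasure torus B = 0" using N_eq B' by simp
  then have "AE x in torus. x \<notin> B" using B by (intro AE_not_in) (auto simp: null_sets_def)
  then show ?thesis
    by (rule AE_mp) (auto simp: B_def intro!: AE_I2)
qed

lemma sobolev_integrable:
  assumes "\<beta> \<in> sobolev_torus q" shows "integrable torus \<beta>"
proof -
  interpret prob_space "torus :: (real^'a) measure" by (rule prob_space_torus)
  have "\<beta> \<in> borel_measurable torus" "integrable torus (\<lambda>x. (\<beta> x)\<^sup>2)"
    using assms by (auto simp: sobolev_torus_def Lp_def)
  then show ?thesis by (rule square_integrable_imp_integrable)
qed

lemma sobolev_essentially_bounded:
  fixes \<beta> :: "real^'d \<Rightarrow> real"
  assumes q: "q > real CARD('d) / 2" and \<beta>: "\<beta> \<in> sobolev_torus q"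
  shows "\<exists>C\<ge>0. AE x in torus. \<bar>\<beta> x\<bar> \<le> C"
proof -
  obtain C where C: "\<And>S. finite S \<Longrightarrow> (\<Sum>\<xi>\<in>S. cmod (fourier_coeff \<beta> \<xi>)) \<le> C"
    using sobolev_fourier_sum_bounded[OF q \<beta>] by blast
  have int: "integrable torus \<beta>" by (rule sobolev_integrable[OF \<beta>])
  have b: "\<bar>\<integral>x. \<beta> x * indicator K x \<partial>torus\<bar> \<le> C * measure torus K" if "compact K" "K \<subseteq> cube" for K
    by (rule compact_pairing_bound[OF int C that])
  have "AE x in torus. \<beta> x \<le> C"
    using b abs_le_D1 by (intro AE_torus_le[OF int]) blast
  moreover have "AE x in torus. - \<beta> x \<le> C"
  proof (rule AE_torus_le)
    show "integrable torus (\<lambda>x. - \<beta> x)" using int by simp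
    show "(\<integral>x. - \<beta> x * indicator K x \<partial>torus) \<le> C * measure torus K" if "compact K" "K \<subseteq> cube" for K
      using abs_le_D2[OF b[OF that]] by simp
  qed
  ultimately have "AE x in torus. \<bar>\<beta> x\<bar> \<le> C" by eventually_elim auto
  moreover have "C \<ge> 0" using C[of "{}"] by simp
  ultimately show ?thesis by blast
qed

section \<open>Integrals of step processes\<close>

text \<open>The norm of \<open>real^'k^'m\<close> is the Frobenius norm, so Cauchy-Schwarz is
  applied row by row. Using this bound in place of an exact expansion is what brings the factor
  \<open>CARD('k)\<close> into the later estimates.\<close>

lemma norm_matrix_vector_le: "norm (A *v x) \<le> norm A * norm x" for A :: "real^'k^'m"
proof -
  have "norm (A *v x) = L2_set (\<lambda>i. norm ((A *v x) $ i)) UNIV" by (simp add: norm_vec_def)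
  also have "\<dots> \<le> L2_set (\<lambda>i. norm (A $ i) * norm x) UNIV"
    by (intro L2_set_mono) (auto simp: matrix_vector_mul_component Cauchy_Schwarz_ineq2)
  also have "\<dots> = norm A * norm x"
    by (simp add: L2_set_left_distrib norm_vec_def)
  finally show ?thesis .
qed

lemma matrix_vector_measurable [measurable (raw)]:
  fixes A :: "'a \<Rightarrow> real^'k^'m" and x :: "'a \<Rightarrow> real^'k"
  assumes "A \<in> borel_measurable M" "x \<in> borel_measurable M"
  shows "(\<lambda>w. A w *v x w) \<in> borel_measurable M"
proof (rule borel_measurable_continuous_Pair[OF assms])
  have "bounded_bilinear (\<lambda>(A::real^'k^'m) x. A *v x)"
    by (rule bounded_bilinear.intro)
       (auto simp: matrix_vector_mult_add_rdistrib matrix_vector_right_distrib scaleR_matrix_vector_assoc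
          matrix_vector_mult_scaleR intro!: exI[of _ 1] norm_matrix_vector_le)
  then show "continuous_on UNIV (\<lambda>p. fst p *v (snd p :: real^'k) :: real^'m)"
    by (rule bounded_bilinear.continuous_on) (intro continuous_intros)+
qed

text \<open>Each squared coordinate in the expansion of the norm leaves a product over coordinates
  in which one factor carries \<open>t\<^sup>2\<close>; that factor integrates to the variance and
  the others to one.\<close>

lemma gauss_second_moment:
  assumes "\<sigma> > 0"
  shows "(\<integral>\<^sup>+x. ennreal (\<Prod>i\<in>UNIV. normal_density 0 \<sigma> (x $ i)) * ennreal ((norm x)\<^sup>2) \<partial>(lborel :: (real^'k) measure))
    = ennreal (real CARD('k) * \<sigma>\<^sup>2)"
proof -
  let ?D = "\<lambda>t. normal_density 0 \<sigma> t"
  have B: "(Basis :: (real^'k) set) = (\<lambda>i. axis i 1) ` UNIV" by (auto simp: Basis_vec_def)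
  have inj: "inj_on (\<lambda>i. axis i (1::real)) (UNIV :: 'k set)" by (auto simp: inj_on_def axis_eq_axis)
  have D: "(\<Prod>i\<in>UNIV. ?D (x $ i)) = (\<Prod>b\<in>Basis. ?D (x \<bullet> b))" for x :: "real^'k"
    unfolding B by (subst prod.reindex[OF inj]) (simp add: inner_axis)
  have "(\<integral>\<^sup>+x. ennreal (\<Prod>i\<in>UNIV. ?D (x $ i)) * ennreal ((norm x)\<^sup>2) \<partial>(lborel :: (real^'k) measure))
    = (\<integral>\<^sup>+x. (\<Sum>c\<in>Basis. (\<Prod>b\<in>Basis. ennreal (?D (x \<bullet> b) * (if b = c then (x \<bullet> b)\<^sup>2 else 1)))) \<partial>(lborel :: (real^'k) measure))"
  proof (rule nn_integral_cong)
    fix x :: "real^'k"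
    let ?p = "\<Prod>b\<in>Basis. ?D (x \<bullet> b)"
    have "(norm x)\<^sup>2 = (\<Sum>c\<in>Basis. (x \<bullet> c)\<^sup>2)"
      unfolding power2_norm_eq_inner euclidean_inner[of x x] by (simp only: power2_eq_square)
    then have "?p * (norm x)\<^sup>2 = (\<Sum>c\<in>Basis. ?p * (x \<bullet> c)\<^sup>2)"
      by (simp only: sum_distrib_left)
    also have "\<dots> = (\<Sum>c\<in>Basis. (\<Prod>b\<in>Basis. ?D (x \<bullet> b) * (if b = c then (x \<bullet> b)\<^sup>2 else 1)))"
      by (intro sum.cong refl) (simp add: prod.distrib prod.delta)
    finally have *: "?p * (norm x)\<^sup>2 = (\<Sum>c\<in>Basis. (\<Prod>b\<in>Basis. ?D (x \<bullet> b) * (if b = c then (x \<bullet> b)\<^sup>2 else 1)))" .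
    have "ennreal ?p * ennreal ((norm x)\<^sup>2) = ennreal (?p * (norm x)\<^sup>2)"
      by (rule ennreal_mult[symmetric]) (auto intro!: prod_nonneg)
    also have "\<dots> = (\<Sum>c\<in>Basis. ennreal (\<Prod>b\<in>Basis. ?D (x \<bullet> b) * (if b = c then (x \<bullet> b)\<^sup>2 else 1)))"
      unfolding * by (rule sum_ennreal[symmetric]) (auto intro!: prod_nonneg)
    also have "\<dots> = (\<Sum>c\<in>Basis. (\<Prod>b\<in>Basis. ennreal (?D (x \<bullet> b) * (if b = c then (x \<bullet> b)\<^sup>2 else 1))))"
      by (intro sum.cong refl prod_ennreal[symmetric]) auto
    finally show "ennreal (\<Prod>i\<in>UNIV. ?D (x $ i)) * ennreal ((norm x)\<^sup>2)
      = (\<Sum>c\<in>Basis. (\<Prod>b\<in>Basis. ennreal (?D (x \<bullet> b) * (if b = c then (x \<bullet> b)\<^sup>2 else 1))))"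
      by (simp only: D)
  qed
  also have "\<dots> = (\<Sum>c\<in>(Basis::(real^'k) set). (\<Prod>b\<in>(Basis::(real^'k) set). (\<integral>\<^sup>+t. ennreal (?D t * (if b = c then t\<^sup>2 else 1)) \<partial>lborel)))"
  proof (subst nn_integral_sum, simp, rule sum.cong[OF refl])
    fix c :: "real^'k"
    show "(\<integral>\<^sup>+x. (\<Prod>b\<in>Basis. ennreal (?D (x \<bullet> b) * (if b = c then (x \<bullet> b)\<^sup>2 else 1))) \<partial>(lborel :: (real^'k) measure))
      = (\<Prod>b\<in>(Basis::(real^'k) set). (\<integral>\<^sup>+t. ennreal (?D t * (if b = c then t\<^sup>2 else 1)) \<partial>lborel))"
      by (rule nn_integral_lborel_prod) auto
  qed
  also have "\<dots> = (\<Sum>c\<in>(Basis::(real^'k) set). (\<Prod>b\<in>(Basis::(real^'k) set). if b = c then ennreal (\<sigma>\<^sup>2) else 1))"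
  proof (intro sum.cong prod.cong refl)
    fix b c :: "real^'k"
    have "(\<integral>\<^sup>+t. ennreal (?D t * t\<^sup>2) \<partial>lborel) = ennreal (\<sigma>\<^sup>2)"
      using normal_moment_even[OF assms, of 0 1] by (subst nn_integral_eq_integral) (auto dest: has_bochner_integral_integral_eq simp: has_bochner_integral_iff)
    moreover have "(\<integral>\<^sup>+t. ennreal (?D t) \<partial>lborel) = 1"
      using assms by (subst nn_integral_eq_integral) auto
    ultimately show "(\<integral>\<^sup>+t. ennreal (?D t * (if b = c then t\<^sup>2 else 1)) \<partial>lborel) = (if b = c then ennreal (\<sigma>\<^sup>2) else 1)"
      by simp
  qed
  also have "\<dots> = ennreal (real CARD('k) * \<sigma>\<^sup>2)"
    by (simp add: prod.delta ennreal_mult ennreal_of_nat_eq_real_of_nat)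
  finally show ?thesis .
qed

section \<open>Increments of a Wiener process\<close>

text \<open>Instantiated for each \<open>Wn n\<close> with its own filtration and for the limit; no
  constant in the estimates proved here depends on the instance.\<close>

locale brownian = prob_space M for M :: "'w measure" +
  fixes T :: real and F :: "real \<Rightarrow> 'w measure" and W :: "real \<Rightarrow> 'w \<Rightarrow> real^'k"
  assumes filt: "filtration_upto M T F" and wiener: "wiener_process M T F W"
begin

lemma subalg: "t \<in> {0..T} \<Longrightarrow> subalgebra M (F t)"
  using filt by (simp add: filtration_upto_def)

lemma F_mono: "0 \<le> s \<Longrightarrow> s \<le> t \<Longrightarrow> t \<le> T \<Longrightarrow> f \<in> measurable (F s) N \<Longrightarrow> f \<in> measurable (F t) N"
  using filt unfolding filtration_upto_def subalgebra_def
  by (intro measurable_from_subalg[of "F t" "F s"]) (auto simp: subalgebra_def)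

lemma F_M: "0 \<le> t \<Longrightarrow> t \<le> T \<Longrightarrow> f \<in> measurable (F t) N \<Longrightarrow> f \<in> measurable M N"
  using measurable_from_subalg[OF subalg[of t]] by simp

lemma W_F: "0 \<le> t \<Longrightarrow> t \<le> T \<Longrightarrow> W t \<in> borel_measurable (F t)"
  using wiener by (auto simp: wiener_process_def)

lemma incr_msq:
  assumes "0 \<le> s" "s \<le> t" "t \<le> T"
  shows "msq M (\<lambda>w. W t w - W s w) = ennreal (real CARD('k) * (t - s))"
proof (cases "s = t")
  case True then show ?thesis by (simp add: msq_def)
next
  case False
  then have D: "distributed M lborel (\<lambda>\<omega>. W t \<omega> - W s \<omega>) (\<lambda>x. ennreal (\<Prod>i\<in>UNIV. normal_density 0 (sqrt (t - s)) (x $ i)))"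
    using wiener assms by (auto simp: wiener_process_def)
  show ?thesis
    unfolding msq_def using distributed_nn_integral[OF D, of "\<lambda>x. ennreal ((norm x)\<^sup>2)"]
      gauss_second_moment[of "sqrt (t - s)", where 'k='k] False assms by simp
qed

lemma incr_Lp2: "0 \<le> s \<Longrightarrow> s \<le> t \<Longrightarrow> t \<le> T \<Longrightarrow> (\<lambda>w. W t w - W s w) \<in> Lp M 2"
  unfolding Lp2_iff incr_msq using F_M[OF _ _ W_F] by auto

text \<open>The density is even, so reflecting the integration variable shows that the integral
  equals its own negative.\<close>

lemma incr_mean_zero:
  assumes "0 \<le> s" "s \<le> t" "t \<le> T"
  shows "expectation (\<lambda>w. (W t w - W s w) $ l) = 0"
proof (cases "s = t")
  case False
  let ?P = "\<lambda>x. \<Prod>i\<in>UNIV. normal_density 0 (sqrt (t - s)) (x $ i)"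
  have D: "distributed M lborel (\<lambda>\<omega>. W t \<omega> - W s \<omega>) (\<lambda>x. ennreal (?P x))"
    using wiener assms False by (auto simp: wiener_process_def)
  let ?I = "\<integral>x. ?P x * x $ l \<partial>(lborel :: (real^'k) measure)"
  have "?I = (\<integral>x. ?P x * x $ l \<partial>distr lborel borel (\<lambda>x::real^'k. 0 + (-1) *\<^sub>R x))"
    by (subst lborel_affine[of "-1" 0]) (simp_all add: density_1)
  also have "\<dots> = (\<integral>x. ?P (- x) * (- x) $ l \<partial>(lborel :: (real^'k) measure))"
    by (subst integral_distr) auto
  also have "\<dots> = - ?I" by (simp add: normal_density_def)
  finally have "?I = 0" by simp
  then show ?thesis
    using distributed_integral[OF D, of "\<lambda>x. x $ l"] by (simp add: prod_nonneg)
qed simp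

lemma indep_incr:
  fixes X :: "'w \<Rightarrow> real" and g :: "real^'k \<Rightarrow> real"
  assumes st: "0 \<le> s" "s < t" "t \<le> T" and X: "X \<in> borel_measurable (F s)" and g: "g \<in> borel_measurable borel"
  shows "indep_var borel X borel (\<lambda>w. g (W t w - W s w))"
proof -
  have ind: "indep_set (sets (F s)) {(\<lambda>\<omega>. W t \<omega> - W s \<omega>) -` B \<inter> space M | B. B \<in> sets borel}"
    using wiener st by (auto simp: wiener_process_def)
  have sp: "space (F s) = space M" using subalg[of s] st by (auto simp: subalgebra_def)
  have m: "(\<lambda>w. W t w - W s w) \<in> borel_measurable M"
    using incr_Lp2[of s t] st by (simp add: Lp2_iff)
  show ?thesis
    unfolding indep_var_def indep_vars_def2
  proof (intro conjI ballI)
    show "random_variable (case_bool borel borel i) (case_bool X (\<lambda>w. g (W t w - W s w)) i)" for i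
      using F_M[OF _ _ X] st measurable_compose[OF m g] by (auto split: bool.split)
    show "indep_sets (\<lambda>i. {case_bool X (\<lambda>w. g (W t w - W s w)) i -` A \<inter> space M |A. A \<in> sets (case_bool borel borel i)}) UNIV"
    proof (rule indep_sets_mono_sets[OF ind[unfolded indep_set_def]])
      fix i :: bool
      show "{case_bool X (\<lambda>w. g (W t w - W s w)) i -` A \<inter> space M |A. A \<in> sets (case_bool borel borel i)}
        \<subseteq> case_bool (sets (F s)) {(\<lambda>\<omega>. W t \<omega> - W s \<omega>) -` B \<inter> space M |B. B \<in> sets borel} i"
      proof (cases i)
        case True
        then show ?thesis using measurable_sets[OF X] by (auto simp: sp)
      next
        case False
        show ?thesis
        proof
          fix S assume "S \<in> {case_bool X (\<lambda>w. g (W t w - W s w)) i -` A \<inter> space M |A. A \<in> sets (case_bool borel borel i)}"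
          then obtain A where A: "A \<in> sets borel" "S = (\<lambda>w. g (W t w - W s w)) -` A \<inter> space M"
            using False by auto
          have "S = (\<lambda>w. W t w - W s w) -` (g -` A) \<inter> space M" using A(2) by auto
          moreover have "g -` A \<in> sets borel"
            using measurable_sets[OF g A(1)] by simp
          ultimately show "S \<in> case_bool (sets (F s)) {(\<lambda>\<omega>. W t \<omega> - W s \<omega>) -` B \<inter> space M |B. B \<in> sets borel} i"
            using False by (simp only: bool.case(2)) blast
        qed
      qed
    qed
  qed
qed

text \<open>The martingale property in the form used for cross terms: an integrable weight known at
  time \<open>s\<close> is uncorrelated with a later increment. The case \<open>s = t\<close> is
  separate because \<open>wiener_process\<close> speaks of independence for \<open>s < t\<close>
  only.\<close>

lemma indep_incr_zero:
  assumes st: "0 \<le> s" "s \<le> t" "t \<le> T" and X: "X \<in> borel_measurable (F s)" and int: "integrable M X"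
  shows "integrable M (\<lambda>w. X w * (W t w - W s w) $ l)" "expectation (\<lambda>w. X w * (W t w - W s w) $ l) = 0"
proof -
  have "integrable M (\<lambda>w. X w * (W t w - W s w) $ l) \<and> expectation (\<lambda>w. X w * (W t w - W s w) $ l) = 0"
  proof (cases "s = t")
    case False
    have ind: "indep_var borel X borel (\<lambda>w. (W t w - W s w) $ l)"
      using False st by (intro indep_incr[OF _ _ _ X]) auto
    have L2: "(\<lambda>w. W t w - W s w) \<in> Lp M 2" using st by (rule incr_Lp2)
    have m: "(\<lambda>w. (W t w - W s w) $ l) \<in> borel_measurable M"
      by (rule measurable_compose[OF Lp2_measurable[OF L2]])
         (intro borel_measurable_continuous_onI continuous_intros)
    have "integrable M (\<lambda>w. ((W t w - W s w) $ l)\<^sup>2)"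
    proof (rule Bochner_Integration.integrable_bound[OF Lp2_integrable_square[OF L2]])
      show "AE w in M. norm (((W t w - W s w) $ l)\<^sup>2) \<le> norm ((norm (W t w - W s w))\<^sup>2)"
        using power_mono[OF component_le_norm_cart abs_ge_zero, of "W t w - W s w" l 2 for w] by (intro AE_I2) simp
    qed (rule borel_measurable_power[OF m])
    then have int2: "integrable M (\<lambda>w. (W t w - W s w) $ l)"
      by (rule square_integrable_imp_integrable[OF m])
    show ?thesis
      using indep_var_integrable[OF ind int int2] indep_var_lebesgue_integral[OF ind int int2] incr_mean_zero[OF st, of l]
      by simp
  qed simp
  then show "integrable M (\<lambda>w. X w * (W t w - W s w) $ l)" "expectation (\<lambda>w. X w * (W t w - W s w) $ l) = 0" by auto
qed

text \<open>After the Frobenius bound, independence factors the expectation of the product of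
  squares; the remaining factor is the second moment \<open>CARD('k) * (t - s)\<close> of the
  increment.\<close>

lemma msq_increment_product:
  fixes \<xi> :: "'w \<Rightarrow> real^'k^'m"
  assumes st: "0 \<le> s" "s \<le> t" "t \<le> T" and X: "\<xi> \<in> borel_measurable (F s)" and L2: "\<xi> \<in> Lp M 2"
  shows "msq M (\<lambda>w. \<xi> w *v (W t w - W s w)) \<le> ennreal (real CARD('k) * (t - s)) * msq M \<xi>"
proof (cases "s = t")
  case True then show ?thesis by (simp add: msq_def)
next
  case False
  have L2W: "(\<lambda>w. W t w - W s w) \<in> Lp M 2" using st by (rule incr_Lp2)
  have ind: "indep_var borel (\<lambda>w. (norm (\<xi> w))\<^sup>2) borel (\<lambda>w. (norm (W t w - W s w))\<^sup>2)"
    using False st X by (intro indep_incr[where g="\<lambda>x. (norm x)\<^sup>2"]) auto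
  note i1 = Lp2_integrable_square[OF L2] and i2 = Lp2_integrable_square[OF L2W]
  have "msq M (\<lambda>w. \<xi> w *v (W t w - W s w)) \<le> (\<integral>\<^sup>+w. ennreal ((norm (\<xi> w))\<^sup>2 * (norm (W t w - W s w))\<^sup>2) \<partial>M)"
    unfolding msq_def
    by (intro nn_integral_mono ennreal_leI) (simp add: norm_matrix_vector_le flip: power_mult_distrib)
  also have "\<dots> = ennreal (expectation (\<lambda>w. (norm (\<xi> w))\<^sup>2 * (norm (W t w - W s w))\<^sup>2))"
    using indep_var_integrable[OF ind i1 i2] by (intro nn_integral_eq_integral) auto
  also have "\<dots> = ennreal (expectation (\<lambda>w. (norm (\<xi> w))\<^sup>2)) * ennreal (expectation (\<lambda>w. (norm (W t w - W s w))\<^sup>2))"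
    unfolding indep_var_lebesgue_integral[OF ind i1 i2] by (rule ennreal_mult) auto
  also have "\<dots> = msq M \<xi> * msq M (\<lambda>w. W t w - W s w)"
    by (simp add: msq_eq_integral L2 L2W)
  finally show ?thesis by (simp add: incr_msq st mult.commute)
qed

end

lemma Lp2_zero: "(\<lambda>x. 0) \<in> Lp M 2"
  by (simp add: Lp_def)

lemma Lp2_sum: "finite A \<Longrightarrow> (\<And>i. i \<in> A \<Longrightarrow> f i \<in> Lp M 2) \<Longrightarrow> (\<lambda>x. \<Sum>i\<in>A. f i x) \<in> Lp M 2"
  by (induction A rule: finite_induct) (auto intro: Lp2_add Lp2_zero)

lemma msq_add_orthogonal:
  assumes f: "f \<in> Lp M 2" and g: "g \<in> Lp M 2" and "(\<integral>x. f x \<bullet> g x \<partial>M) = 0"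
  shows "msq M (\<lambda>x. f x + g x) = msq M f + msq M g"
proof -
  have "(\<integral>x. (norm (f x + g x))\<^sup>2 \<partial>M) = (\<integral>x. (norm (f x))\<^sup>2 + 2 * (f x \<bullet> g x) + (norm (g x))\<^sup>2 \<partial>M)"
    by (intro Bochner_Integration.integral_cong refl)
       (simp only: power2_norm_eq_inner inner_add_left inner_add_right, simp add: inner_commute)
  also have "\<dots> = (\<integral>x. (norm (f x))\<^sup>2 \<partial>M) + (\<integral>x. (norm (g x))\<^sup>2 \<partial>M)"
    using Lp2_integrable_square[OF f] Lp2_integrable_square[OF g] Lp2_integrable_inner[OF f g] assms(3)
    by (simp add: Bochner_Integration.integral_add)
  finally show ?thesis
    by (simp add: msq_eq_integral f g Lp2_add)
qed

lemma component_measurable: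
  "(\<lambda>x. x $ i) \<in> borel_measurable (borel :: (('a::euclidean_space)^'n) measure)"
  by (intro borel_measurable_continuous_onI continuous_intros)

lemma Lp2_component:
  fixes f :: "'a \<Rightarrow> 'b::euclidean_space^'n"
  assumes "f \<in> Lp M 2" shows "(\<lambda>x. f x $ i) \<in> Lp M 2"
proof -
  have "msq M (\<lambda>x. f x $ i) \<le> msq M f" by (rule msq_mono) (rule Finite_Cartesian_Product.norm_nth_le)
  then show ?thesis
    using assms measurable_compose[OF _ component_measurable, of f M i] by (auto simp: Lp2_iff)
qed

section \<open>Integrals over finite families of intervals\<close>

text \<open>Arbitrary, possibly overlapping intervals over any finite index set. Families of this
  kind are closed under differences without the choice of a common partition, which elementary
  processes on their grids are not.\<close>

definition family_process ::
  "'i set \<Rightarrow> ('i \<Rightarrow> real) \<Rightarrow> ('i \<Rightarrow> real) \<Rightarrow> ('i \<Rightarrow> 'w \<Rightarrow> 'b::real_vector) \<Rightarrow> 'w \<times> real \<Rightarrow> 'b" where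
  "family_process I s u \<xi> = (\<lambda>(\<omega>, t). \<Sum>i\<in>I. indicator {s i<..u i} t *\<^sub>R \<xi> i \<omega>)"

definition family_integral ::
  "(real \<Rightarrow> 'w \<Rightarrow> real^'k) \<Rightarrow> 'i set \<Rightarrow> ('i \<Rightarrow> real) \<Rightarrow> ('i \<Rightarrow> real) \<Rightarrow> ('i \<Rightarrow> 'w \<Rightarrow> real^'k^'m) \<Rightarrow> real \<Rightarrow> 'w \<Rightarrow> real^'m" where
  "family_integral W I s u \<xi> t \<omega> = (\<Sum>i\<in>I. \<xi> i \<omega> *v (W (min t (u i)) \<omega> - W (min t (s i)) \<omega>))"

lemma elementary_process_family: "elementary_process N \<tau> \<xi> = family_process {..<N} \<tau> (\<lambda>j. \<tau> (Suc j)) \<xi>"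
  by (simp add: elementary_process_def family_process_def)

lemma elementary_integral_family:
  "elementary_integral W N \<tau> \<xi> t = family_integral W {..<N} \<tau> (\<lambda>j. \<tau> (Suc j)) \<xi> t"
  by (simp add: elementary_integral_def family_integral_def fun_eq_iff)

lemma family_process_measurable:
  fixes \<xi> :: "'i \<Rightarrow> 'w \<Rightarrow> 'b::euclidean_space"
  assumes "finite I" "\<And>i. i \<in> I \<Longrightarrow> \<xi> i \<in> borel_measurable M"
  shows "family_process I s u \<xi> \<in> borel_measurable (M \<Otimes>\<^sub>M (lborel :: real measure))"
  unfolding family_process_def split_beta'
  using assms measurable_compose[OF measurable_fst] by (intro borel_measurable_sum borel_measurable_scaleR) auto

context brownian
begin

text \<open>Upper half of the Ito isometry on one grid. The new increment is orthogonal to the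
  integral so far, which is known at \<open>\<rho> K\<close>, so second moments add; on the other
  side the new cell is disjoint from the support of \<open>P K\<close>, so squared norms add as
  well.\<close>

lemma grid_integral_bound:
  fixes \<eta> :: "nat \<Rightarrow> 'w \<Rightarrow> real^'k^'m" and \<rho> :: "nat \<Rightarrow> real"
  assumes t: "0 \<le> t" "t \<le> T"
    and \<rho>: "\<And>l. l < K \<Longrightarrow> \<rho> l \<le> \<rho> (Suc l)" "\<And>l. l \<le> K \<Longrightarrow> 0 \<le> \<rho> l \<and> \<rho> l \<le> T"
    and \<eta>: "\<And>l. l < K \<Longrightarrow> \<eta> l \<in> borel_measurable (F (\<rho> l))" "\<And>l. l < K \<Longrightarrow> \<eta> l \<in> Lp M 2"
  defines "G \<equiv> \<lambda>K w. \<Sum>l<K. \<eta> l w *v (W (min t (\<rho> (Suc l))) w - W (min t (\<rho> l)) w)"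
    and "P \<equiv> \<lambda>K (w, r). \<Sum>l<K. indicator {\<rho> l<..\<rho> (Suc l)} r *\<^sub>R \<eta> l w"
  shows "G K \<in> Lp M 2 \<and> msq M (G K) \<le> ennreal (real CARD('k)) * msq (M \<Otimes>\<^sub>M lborel) (P K)"
proof -
  have "G K \<in> Lp M 2 \<and> G K \<in> borel_measurable (F (\<rho> K)) \<and> (\<forall>w r. r > \<rho> K \<longrightarrow> P K (w, r) = 0) \<and>
    msq M (G K) \<le> ennreal (real CARD('k)) * msq (M \<Otimes>\<^sub>M lborel) (P K)"
    using \<rho> \<eta>
  proof (induction K)
    case 0
    have "(\<lambda>w. 0) \<in> Lp M 2" by (simp add: Lp_def)
    then show ?case by (simp add: G_def P_def msq_def)
  next
    case (Suc K)
    have IH: "G K \<in> Lp M 2" "G K \<in> borel_measurable (F (\<rho> K))" "\<And>w r. r > \<rho> K \<Longrightarrow> P K (w, r) = 0"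
      "msq M (G K) \<le> ennreal (real CARD('k)) * msq (M \<Otimes>\<^sub>M lborel) (P K)"
      using Suc by auto
    define a where "a = min t (\<rho> K)"
    define b where "b = min t (\<rho> (Suc K))"
    define X where "X w = \<eta> K w *v (W b w - W a w)" for w
    have \<rho>K: "0 \<le> \<rho> K" "\<rho> K \<le> \<rho> (Suc K)" "\<rho> (Suc K) \<le> T"
      using Suc.prems(1)[of K] Suc.prems(2)[of K] Suc.prems(2)[of "Suc K"] by auto
    have ab: "0 \<le> a" "a \<le> b" "b \<le> T" "a \<le> \<rho> K" "b \<le> \<rho> (Suc K)" "b - a \<le> \<rho> (Suc K) - \<rho> K"
      using \<rho>K t by (auto simp: a_def b_def)
    have \<eta>K: "\<eta> K \<in> borel_measurable (F (\<rho> K))" "\<eta> K \<in> Lp M 2" using Suc.prems by auto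
    \<comment> \<open>Either \<open>t\<close> does not reach beyond the left end of the cell and the
      increment vanishes, or the increment starts at the grid point where \<open>\<eta> K\<close>
      and \<open>G K\<close> are known.\<close>
    have a_cases: "a = b \<or> a = \<rho> K" using \<rho>K by (auto simp: a_def b_def)
    have WF: "W x \<in> borel_measurable (F (\<rho> (Suc K)))" if "0 \<le> x" "x \<le> \<rho> (Suc K)" for x
      using F_mono[OF that \<rho>K(3) W_F] that \<rho>K by auto
    have up: "f \<in> borel_measurable (F (\<rho> (Suc K)))" if "f \<in> borel_measurable (F (\<rho> K))" for f :: "'w \<Rightarrow> 'z::topological_space"
      by (rule F_mono[OF \<rho>K that])
    have X_F: "X \<in> borel_measurable (F (\<rho> (Suc K)))"
      unfolding X_def using ab by (intro matrix_vector_measurable borel_measurable_diff WF up \<eta>K) auto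
    then have X_M: "X \<in> borel_measurable M"
      using F_M \<rho>K by (metis order_trans)
    have X_msq: "msq M X \<le> ennreal (real CARD('k) * (b - a)) * msq M (\<eta> K)"
    proof (cases "a = b")
      case True then show ?thesis by (simp add: X_def msq_def)
    next
      case False
      with a_cases \<eta>K ab show ?thesis unfolding X_def by (intro msq_increment_product) auto
    qed
    have X_L2: "X \<in> Lp M 2"
      unfolding Lp2_iff using X_M le_less_trans[OF X_msq] \<eta>K(2) by (auto simp: Lp2_iff ennreal_mult_less_top)
    have cross: "expectation (\<lambda>w. G K w \<bullet> X w) = 0"
    proof (cases "a = b")
      case True then show ?thesis by (simp add: X_def)
    next
      case False
      then have a: "a = \<rho> K" using a_cases by simp
      have *: "G K w \<bullet> X w = (\<Sum>i\<in>UNIV. \<Sum>l\<in>UNIV. (G K w $ i * \<eta> K w $ i $ l) * (W b w - W a w) $ l)" for w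
        by (simp add: inner_vec_def X_def matrix_vector_mult_def sum_distrib_left mult.assoc del: vector_minus_component)
      have m: "(\<lambda>w. G K w $ i * \<eta> K w $ i $ l) \<in> borel_measurable (F a)" for i l
        unfolding a by (intro borel_measurable_times measurable_compose[OF IH(2) component_measurable]
           measurable_compose[OF measurable_compose[OF \<eta>K(1) component_measurable] component_measurable])
      have int: "integrable M (\<lambda>w. G K w $ i * \<eta> K w $ i $ l)" for i l
        using Lp2_integrable_inner[OF Lp2_component[OF IH(1)] Lp2_component[OF Lp2_component[OF \<eta>K(2)]]] by simp
      show ?thesis
        unfolding * by (simp add: Bochner_Integration.integral_sum Bochner_Integration.integrable_sum
            indep_incr_zero[OF ab(1-3) m int] del: vector_minus_component)
    qed
    have G_Suc: "G (Suc K) = (\<lambda>w. G K w + X w)"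
      by (simp add: G_def X_def a_def b_def)
    have P_Suc: "P (Suc K) (w, r) = P K (w, r) + indicator {\<rho> K<..\<rho> (Suc K)} r *\<^sub>R \<eta> K w" for w r
      by (simp only: P_def split_conv sum.lessThan_Suc)
    have P_norm: "ennreal ((norm (P (Suc K) z))\<^sup>2)
       = ennreal ((norm (P K z))\<^sup>2) + ennreal ((norm (\<eta> K (fst z)))\<^sup>2) * indicator {\<rho> K<..\<rho> (Suc K)} (snd z)" for z
      using IH(3)[of "snd z" "fst z"] P_Suc[of "fst z" "snd z"]
      by (cases "snd z \<in> {\<rho> K<..\<rho> (Suc K)}") (auto simp: indicator_def)
    have [measurable]: "\<eta> K \<in> borel_measurable M" using \<eta>K(2) by (rule Lp2_measurable)
    have [measurable]: "P K \<in> borel_measurable (M \<Otimes>\<^sub>M lborel)"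
    proof -
      have "P K = family_process {..<K} \<rho> (\<lambda>l. \<rho> (Suc l)) \<eta>" by (simp only: P_def family_process_def)
      moreover have "family_process {..<K} \<rho> (\<lambda>l. \<rho> (Suc l)) \<eta> \<in> borel_measurable (M \<Otimes>\<^sub>M lborel)"
        using Suc.prems(4) by (intro family_process_measurable Lp2_measurable) auto
      ultimately show ?thesis by simp
    qed
    have "msq (M \<Otimes>\<^sub>M lborel) (P (Suc K)) = msq (M \<Otimes>\<^sub>M lborel) (P K) +
       (\<integral>\<^sup>+z. ennreal ((norm (\<eta> K (fst z)))\<^sup>2) * indicator {\<rho> K<..\<rho> (Suc K)} (snd z) \<partial>(M \<Otimes>\<^sub>M lborel))"
      unfolding msq_def P_norm by (rule nn_integral_add) auto
    also have "(\<integral>\<^sup>+z. ennreal ((norm (\<eta> K (fst z)))\<^sup>2) * indicator {\<rho> K<..\<rho> (Suc K)} (snd z) \<partial>(M \<Otimes>\<^sub>M lborel))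
       = (\<integral>\<^sup>+w. \<integral>\<^sup>+r. ennreal ((norm (\<eta> K w))\<^sup>2) * indicator {\<rho> K<..\<rho> (Suc K)} r \<partial>lborel \<partial>M)"
      by (subst lborel.nn_integral_fst[symmetric]) auto
    also have "\<dots> = msq M (\<eta> K) * ennreal (\<rho> (Suc K) - \<rho> K)"
      using \<rho>K by (simp add: nn_integral_cmult_indicator nn_integral_multc msq_def)
    finally have P_msq: "msq (M \<Otimes>\<^sub>M lborel) (P (Suc K)) = msq (M \<Otimes>\<^sub>M lborel) (P K) + msq M (\<eta> K) * ennreal (\<rho> (Suc K) - \<rho> K)" .
    have "msq M (G (Suc K)) = msq M (G K) + msq M X"
      unfolding G_Suc by (rule msq_add_orthogonal[OF IH(1) X_L2 cross])
    also have "\<dots> \<le> ennreal (real CARD('k)) * msq (M \<Otimes>\<^sub>M lborel) (P K) + ennreal (real CARD('k) * (\<rho> (Suc K) - \<rho> K)) * msq M (\<eta> K)"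
      using ab by (intro add_mono IH(4) order_trans[OF X_msq] mult_right_mono ennreal_leI mult_left_mono) auto
    also have "\<dots> = ennreal (real CARD('k)) * msq (M \<Otimes>\<^sub>M lborel) (P (Suc K))"
      unfolding P_msq using \<rho>K by (simp add: distrib_left ennreal_mult mult_ac)
    finally have "msq M (G (Suc K)) \<le> ennreal (real CARD('k)) * msq (M \<Otimes>\<^sub>M lborel) (P (Suc K))" .
    moreover have "P (Suc K) (w, r) = 0" if "r > \<rho> (Suc K)" for w r
      using IH(3)[of r w] that \<rho>K by (simp add: P_Suc)
    moreover have "G (Suc K) \<in> Lp M 2" unfolding G_Suc by (intro Lp2_add IH X_L2)
    moreover have "G (Suc K) \<in> borel_measurable (F (\<rho> (Suc K)))"
      unfolding G_Suc by (intro borel_measurable_add X_F up IH)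
    ultimately show ?case by blast
  qed
  then show ?thesis by blast
qed

end

text \<open>Common refinement: all endpoints of a finite family are put on one increasing grid.\<close>

lemma grid_telescope:
  fixes g :: "real \<Rightarrow> 'b::ab_group_add" and rs :: "real list"
  assumes rs: "sorted_wrt (<) rs" and a: "a \<in> set rs" and b: "b \<in> set rs" and ab: "a \<le> b"
  shows "g b - g a = (\<Sum>l\<in>{l. l < length rs - 1 \<and> a \<le> rs ! l \<and> rs ! Suc l \<le> b}. g (rs ! Suc l) - g (rs ! l))"
proof -
  obtain p where p: "p < length rs" "a = rs ! p" using a by (metis in_set_conv_nth)
  obtain q where q: "q < length rs" "b = rs ! q" using b by (metis in_set_conv_nth)
  have less: "rs ! i < rs ! j" if "i < j" "j < length rs" for i j
    using rs that by (simp add: sorted_wrt_iff_nth_less)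
  have le: "rs ! i \<le> rs ! j \<longleftrightarrow> i \<le> j" if "i < length rs" "j < length rs" for i j
    using less[of i j] less[of j i] that by (cases i j rule: linorder_cases) auto
  have "p \<le> q" using ab p q le by simp
  have "{l. l < length rs - 1 \<and> a \<le> rs ! l \<and> rs ! Suc l \<le> b} = {p..<q}"
    using p q le by (auto simp: less_diff_conv)
  then show ?thesis using sum_Suc_diff'[OF \<open>p \<le> q\<close>, of "\<lambda>l. g (rs ! l)"] p q by simp
qed

context brownian
begin

text \<open>All endpoints are sorted into one grid; on each cell the coefficient is the sum of the
  \<open>\<xi> i\<close> whose interval covers the cell. It is adapted because such an interval has
  already started at the left end of the cell.\<close>

theorem family_integral_bound:
  fixes \<xi> :: "'i \<Rightarrow> 'w \<Rightarrow> real^'k^'m"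
  assumes t: "0 \<le> t" "t \<le> T" and I: "finite I"
    and su: "\<And>i. i \<in> I \<Longrightarrow> 0 \<le> s i \<and> s i \<le> u i \<and> u i \<le> T"
    and \<xi>: "\<And>i. i \<in> I \<Longrightarrow> \<xi> i \<in> borel_measurable (F (s i))" "\<And>i. i \<in> I \<Longrightarrow> \<xi> i \<in> Lp M 2"
  shows "family_integral W I s u \<xi> t \<in> Lp M 2"
    and "msq M (family_integral W I s u \<xi> t) \<le> ennreal (real CARD('k)) * msq (M \<Otimes>\<^sub>M lborel) (family_process I s u \<xi>)"
proof -
  define rs where "rs = sorted_list_of_set (s ` I \<union> u ` I)"
  have set_rs: "set rs = s ` I \<union> u ` I" using I by (simp add: rs_def)
  have srt: "sorted_wrt (<) rs" by (simp add: rs_def)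
  define K where "K = length rs - 1"
  define L where "L i = {l. l < K \<and> s i \<le> rs ! l \<and> rs ! Suc l \<le> u i}" for i
  define J where "J l = {i\<in>I. s i \<le> rs ! l \<and> rs ! Suc l \<le> u i}" for l
  define \<eta> where "\<eta> l w = (\<Sum>i\<in>J l. \<xi> i w)" for l w
  have finJ: "finite (J l)" for l using I by (simp add: J_def)
  \<comment> \<open>Used twice: with \<open>g\<close> a path of \<open>W\<close> stopped at
    \<open>t\<close> for the integral, and with \<open>g\<close> a step function of the endpoint for
    the indicators.\<close>
  have tel: "g (u i) - g (s i) = (\<Sum>l\<in>L i. g (rs ! Suc l) - g (rs ! l))" if "i \<in> I" for i and g :: "real \<Rightarrow> 'z::ab_group_add"
    unfolding L_def K_def using su[OF that] that by (intro grid_telescope[OF srt]) (auto simp: set_rs)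
  have swap: "(\<Sum>i\<in>I. \<Sum>l\<in>L i. h i l) = (\<Sum>l<K. \<Sum>i\<in>J l. h i l)" for h :: "'i \<Rightarrow> nat \<Rightarrow> 'z::comm_monoid_add"
  proof -
    have "(\<Sum>i\<in>I. \<Sum>l\<in>L i. h i l) = (\<Sum>i\<in>I. \<Sum>l | l \<in> {..<K} \<and> (s i \<le> rs ! l \<and> rs ! Suc l \<le> u i). h i l)"
      by (simp add: L_def)
    also have "\<dots> = (\<Sum>l<K. \<Sum>i | i \<in> I \<and> (s i \<le> rs ! l \<and> rs ! Suc l \<le> u i). h i l)"
      by (rule sum.swap_restrict) (use I in auto)
    finally show ?thesis by (simp add: J_def)
  qed
  have int_eq: "family_integral W I s u \<xi> t = (\<lambda>w. \<Sum>l<K. \<eta> l w *v (W (min t (rs ! Suc l)) w - W (min t (rs ! l)) w))"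
  proof
    fix w
    have "family_integral W I s u \<xi> t w = (\<Sum>i\<in>I. \<xi> i w *v (\<Sum>l\<in>L i. W (min t (rs ! Suc l)) w - W (min t (rs ! l)) w))"
      unfolding family_integral_def using tel[of _ "\<lambda>x. W (min t x) w"] by (intro sum.cong refl) simp
    also have "\<dots> = (\<Sum>i\<in>I. \<Sum>l\<in>L i. \<xi> i w *v (W (min t (rs ! Suc l)) w - W (min t (rs ! l)) w))"
      by (intro sum.cong refl linear_sum[OF matrix_vector_mul_linear])
    also have "\<dots> = (\<Sum>l<K. \<Sum>i\<in>J l. \<xi> i w *v (W (min t (rs ! Suc l)) w - W (min t (rs ! l)) w))" by (rule swap)
    also have "\<dots> = (\<Sum>l<K. \<eta> l w *v (W (min t (rs ! Suc l)) w - W (min t (rs ! l)) w))"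
    proof (rule sum.cong[OF refl])
      fix l
      have "(\<Sum>i\<in>A. \<xi> i w *v x) = (\<Sum>i\<in>A. \<xi> i w) *v x" if "finite A" for A and x :: "real^'k"
        using that by (induction A rule: finite_induct) (auto simp: matrix_vector_mult_add_rdistrib)
      then show "(\<Sum>i\<in>J l. \<xi> i w *v (W (min t (rs ! Suc l)) w - W (min t (rs ! l)) w)) = \<eta> l w *v (W (min t (rs ! Suc l)) w - W (min t (rs ! l)) w)"
        using finJ by (simp add: \<eta>_def)
    qed
    finally show "family_integral W I s u \<xi> t w = (\<Sum>l<K. \<eta> l w *v (W (min t (rs ! Suc l)) w - W (min t (rs ! l)) w))" .
  qed
  have less: "rs ! i < rs ! j" if "i < j" "j < length rs" for i j
    using srt that by (simp add: sorted_wrt_iff_nth_less)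
  have ind: "indicator {a<..b} x = (of_bool (x \<le> b) - of_bool (x \<le> a) :: real)" if "a \<le> b" for a b x :: real
    using that by (auto simp: indicator_def)
  have proc_eq: "family_process I s u \<xi> = (\<lambda>(w, r). \<Sum>l<K. indicator {rs ! l<..rs ! Suc l} r *\<^sub>R \<eta> l w)"
  proof (rule ext, clarify)
    fix w r
    have "family_process I s u \<xi> (w, r) = (\<Sum>i\<in>I. (\<Sum>l\<in>L i. of_bool (r \<le> rs ! Suc l) - of_bool (r \<le> rs ! l)) *\<^sub>R \<xi> i w)"
      unfolding family_process_def using tel[of _ "\<lambda>x. of_bool (r \<le> x) :: real"] su by (auto intro!: sum.cong simp: ind)
    also have "\<dots> = (\<Sum>i\<in>I. \<Sum>l\<in>L i. indicator {rs ! l<..rs ! Suc l} r *\<^sub>R \<xi> i w)"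
      unfolding scaleR_sum_left
      by (intro sum.cong refl, subst ind) (auto simp: L_def K_def intro!: less_imp_le less)
    also have "\<dots> = (\<Sum>l<K. \<Sum>i\<in>J l. indicator {rs ! l<..rs ! Suc l} r *\<^sub>R \<xi> i w)" by (rule swap)
    finally show "family_process I s u \<xi> (w, r) = (\<Sum>l<K. indicator {rs ! l<..rs ! Suc l} r *\<^sub>R \<eta> l w)"
      by (simp add: \<eta>_def scaleR_sum_right)
  qed
  have "family_integral W I s u \<xi> t \<in> Lp M 2 \<and> msq M (family_integral W I s u \<xi> t) \<le> ennreal (real CARD('k)) * msq (M \<Otimes>\<^sub>M lborel) (family_process I s u \<xi>)"
  proof (cases "I = {}")
    case True
    then have "family_integral W I s u \<xi> t = (\<lambda>w. 0)" by (simp add: fun_eq_iff family_integral_def)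
    then show ?thesis by (simp add: Lp2_zero) (simp add: msq_def)
  next
    case False
    then have len: "length rs > 0" using set_rs by force
    have rng: "0 \<le> rs ! l \<and> rs ! l \<le> T" if "l \<le> K" for l
    proof -
      have "rs ! l \<in> set rs" using that len unfolding K_def by (intro nth_mem) linarith
      then show ?thesis using su unfolding set_rs by force
    qed
    show ?thesis
      unfolding int_eq proc_eq
    proof (rule grid_integral_bound[OF t])
      fix l assume l: "l < K"
      show "rs ! l \<le> rs ! Suc l" using l by (intro less_imp_le less) (auto simp: K_def)
      show "\<eta> l \<in> borel_measurable (F (rs ! l))"
        unfolding \<eta>_def
      proof (rule borel_measurable_sum)
        fix i assume "i \<in> J l"
        then show "\<xi> i \<in> borel_measurable (F (rs ! l))"
          using su[of i] rng[of l] l \<xi>(1)[of i] by (auto simp: J_def intro: F_mono[of "s i"])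
      qed
      show "\<eta> l \<in> Lp M 2"
        unfolding \<eta>_def by (intro Lp2_sum finJ) (auto simp: J_def \<xi>)
    qed (use rng in auto)
  qed
  then show "family_integral W I s u \<xi> t \<in> Lp M 2"
    and "msq M (family_integral W I s u \<xi> t) \<le> ennreal (real CARD('k)) * msq (M \<Otimes>\<^sub>M lborel) (family_process I s u \<xi>)"
    by auto
qed

text \<open>Over the disjoint sum of the index sets the difference is a single family, the second
  part with its sign reversed. In this way approximations on unrelated grids become
  comparable.\<close>

theorem family_integral_diff_bound:
  fixes \<xi> :: "'i \<Rightarrow> 'w \<Rightarrow> real^'k^'m" and \<xi>' :: "'j \<Rightarrow> 'w \<Rightarrow> real^'k^'m"
  assumes t: "0 \<le> t" "t \<le> T"
    and I: "finite I" "\<And>i. i \<in> I \<Longrightarrow> 0 \<le> s i \<and> s i \<le> u i \<and> u i \<le> T"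
      "\<And>i. i \<in> I \<Longrightarrow> \<xi> i \<in> borel_measurable (F (s i))" "\<And>i. i \<in> I \<Longrightarrow> \<xi> i \<in> Lp M 2"
    and J: "finite J" "\<And>i. i \<in> J \<Longrightarrow> 0 \<le> s' i \<and> s' i \<le> u' i \<and> u' i \<le> T"
      "\<And>i. i \<in> J \<Longrightarrow> \<xi>' i \<in> borel_measurable (F (s' i))" "\<And>i. i \<in> J \<Longrightarrow> \<xi>' i \<in> Lp M 2"
  shows "msq M (\<lambda>w. family_integral W I s u \<xi> t w - family_integral W J s' u' \<xi>' t w)
     \<le> ennreal (real CARD('k)) * msq (M \<Otimes>\<^sub>M lborel) (\<lambda>z. family_process I s u \<xi> z - family_process J s' u' \<xi>' z)"
proof -
  let ?\<xi> = "case_sum \<xi> (\<lambda>j w. - \<xi>' j w)"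
  have *: "(- A) *v x = - (A *v x)" for A :: "real^'k^'m" and x
    using scaleR_matrix_vector_assoc[of "-1" A x] by simp
  have "(\<lambda>w. family_integral W I s u \<xi> t w - family_integral W J s' u' \<xi>' t w)
     = family_integral W (I <+> J) (case_sum s s') (case_sum u u') ?\<xi> t"
    using I J by (simp add: fun_eq_iff family_integral_def sum.Plus sum_negf *)
  moreover have "(\<lambda>z. family_process I s u \<xi> z - family_process J s' u' \<xi>' z)
     = family_process (I <+> J) (case_sum s s') (case_sum u u') ?\<xi>"
    by (rule ext) (simp only: family_process_def split_beta sum.Plus[OF I(1) J(1)] sum.case
        scaleR_minus_right sum_negf diff_conv_add_uminus o_def)
  moreover have "(\<lambda>w. - \<xi>' j w) \<in> Lp M 2" if "j \<in> J" for j
    using Lp2_scaleR[OF J(4)[OF that], of "-1"] by simp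
  ultimately show ?thesis
    using I J by (simp only:) (intro family_integral_bound(2)[OF t]; auto)
qed

end

section \<open>Averaging over blocks\<close>

text \<open>Jensen's inequality for the average over \<open>I\<close>, obtained from Cauchy-Schwarz
  against the indicator of \<open>I\<close>.\<close>

lemma lborel_average_deviation:
  fixes f :: "real \<Rightarrow> 'b::euclidean_space"
  assumes [measurable]: "f \<in> borel_measurable borel" "I \<in> sets borel"
    and I: "emeasure lborel I = ennreal \<delta>" and \<delta>: "\<delta> > 0" and int: "integrable lborel (\<lambda>s. indicator I s *\<^sub>R f s)"
  shows "ennreal ((norm (x - (1/\<delta>) *\<^sub>R (\<integral>s. indicator I s *\<^sub>R f s \<partial>lborel)))\<^sup>2)
    \<le> ennreal (1/\<delta>) * (\<integral>\<^sup>+s. ennreal ((norm (x - f s))\<^sup>2) * indicator I s \<partial>lborel)"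
proof -
  have I': "measure lborel I = \<delta>" "emeasure lborel I < \<infinity>" using I \<delta> by (auto simp: measure_def)
  have intI: "integrable lborel (\<lambda>s. indicator I s *\<^sub>R x)" using I' by (intro integrable_scaleR_left integrable_real_indicator) auto
  have "(\<integral>s. indicator I s *\<^sub>R (x - f s) \<partial>lborel) = \<delta> *\<^sub>R x - (\<integral>s. indicator I s *\<^sub>R f s \<partial>lborel)"
    using int intI I' by (simp add: scaleR_diff_right)
  then have eq: "x - (1/\<delta>) *\<^sub>R (\<integral>s. indicator I s *\<^sub>R f s \<partial>lborel) = (1/\<delta>) *\<^sub>R (\<integral>s. indicator I s *\<^sub>R (x - f s) \<partial>lborel)"
    using \<delta> by (simp add: scaleR_diff_right)
  have int': "integrable lborel (\<lambda>s. indicator I s *\<^sub>R (x - f s))"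
    using int intI by (simp add: scaleR_diff_right)
  have "(ennreal (norm (\<integral>s. indicator I s *\<^sub>R (x - f s) \<partial>lborel)))\<^sup>2
    \<le> (\<integral>\<^sup>+s. ennreal (norm (x - f s)) * indicator I s \<partial>lborel)\<^sup>2"
  proof (rule power_mono)
    have "ennreal (norm (\<integral>s. indicator I s *\<^sub>R (x - f s) \<partial>lborel)) \<le> (\<integral>\<^sup>+s. ennreal (norm (indicator I s *\<^sub>R (x - f s))) \<partial>lborel)"
      by (rule integral_norm_bound_ennreal[OF int'])
    also have "\<dots> = (\<integral>\<^sup>+s. ennreal (norm (x - f s)) * indicator I s \<partial>lborel)"
      by (intro nn_integral_cong) (auto simp: indicator_def)
    finally show "ennreal (norm (\<integral>s. indicator I s *\<^sub>R (x - f s) \<partial>lborel)) \<le> (\<integral>\<^sup>+s. ennreal (norm (x - f s)) * indicator I s \<partial>lborel)" .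
  qed simp
  also have "\<dots> = (\<integral>\<^sup>+s. (ennreal (norm (x - f s)) * indicator I s) * indicator I s \<partial>lborel)\<^sup>2"
    by (intro arg_cong[where f="\<lambda>x. x\<^sup>2"] nn_integral_cong) (auto simp: indicator_def)
  also have "\<dots> \<le> (\<integral>\<^sup>+s. (ennreal (norm (x - f s)) * indicator I s)\<^sup>2 \<partial>lborel) * (\<integral>\<^sup>+s. (indicator I s)\<^sup>2 \<partial>lborel)"
    by (rule Cauchy_Schwarz_nn_integral) auto
  also have "(\<integral>\<^sup>+s. (indicator I s)\<^sup>2 \<partial>lborel) = ennreal \<delta>"
    using I by (subst nn_integral_cong[where v="indicator I"]) (auto simp: indicator_def)
  also have "(\<integral>\<^sup>+s. (ennreal (norm (x - f s)) * indicator I s)\<^sup>2 \<partial>lborel) = (\<integral>\<^sup>+s. ennreal ((norm (x - f s))\<^sup>2) * indicator I s \<partial>lborel)"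
    by (intro nn_integral_cong) (auto simp: indicator_def ennreal_power)
  finally have *: "ennreal ((norm (\<integral>s. indicator I s *\<^sub>R (x - f s) \<partial>lborel))\<^sup>2) \<le> (\<integral>\<^sup>+s. ennreal ((norm (x - f s))\<^sup>2) * indicator I s \<partial>lborel) * ennreal \<delta>"
    by (simp add: ennreal_power)
  have "ennreal ((norm (x - (1/\<delta>) *\<^sub>R (\<integral>s. indicator I s *\<^sub>R f s \<partial>lborel)))\<^sup>2)
      = ennreal ((1/\<delta>)\<^sup>2) * ennreal ((norm (\<integral>s. indicator I s *\<^sub>R (x - f s) \<partial>lborel))\<^sup>2)"
    unfolding eq using \<delta> by (simp add: power_mult_distrib power_divide ennreal_mult[symmetric])
  also have "\<dots> \<le> ennreal ((1/\<delta>)\<^sup>2) * ((\<integral>\<^sup>+s. ennreal ((norm (x - f s))\<^sup>2) * indicator I s \<partial>lborel) * ennreal \<delta>)"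
    by (intro mult_left_mono *) auto
  also have "\<dots> = (ennreal ((1/\<delta>)\<^sup>2) * ennreal \<delta>) * (\<integral>\<^sup>+s. ennreal ((norm (x - f s))\<^sup>2) * indicator I s \<partial>lborel)"
    by (simp only: mult_ac)
  also have "ennreal ((1/\<delta>)\<^sup>2) * ennreal \<delta> = ennreal (1/\<delta>)"
    using \<delta> by (simp add: ennreal_mult[symmetric] power2_eq_square)
  finally show ?thesis .
qed

text \<open>The cell that precedes the one from \<open>j * \<delta>\<close> to
  \<open>(j + 1) * \<delta>\<close>. The subtraction is real, so \<open>block \<delta> 0\<close>
  lies in nonpositive time, where zero-extended integrands vanish.\<close>

definition block :: "real \<Rightarrow> nat \<Rightarrow> real set" where
  "block \<delta> j = {(real j - 1) * \<delta><..real j * \<delta>}"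

definition block_average :: "real \<Rightarrow> ('w \<times> real \<Rightarrow> 'b::euclidean_space) \<Rightarrow> nat \<Rightarrow> 'w \<Rightarrow> 'b" where
  "block_average \<delta> \<Psi> j w = (1/\<delta>) *\<^sub>R (\<integral>s. indicator (block \<delta> j) s *\<^sub>R \<Psi> (w, s) \<partial>lborel)"

text \<open>Progressive measurability with the time variable on the whole line: cutting off after
  \<open>b\<close> replaces restriction to \<open>[0,b]\<close>. It makes time integrals up to
  \<open>b\<close> measurable with respect to \<open>F b\<close>.\<close>

definition progressive :: "real \<Rightarrow> (real \<Rightarrow> 'w measure) \<Rightarrow> ('w \<times> real \<Rightarrow> 'b::euclidean_space) \<Rightarrow> bool" where
  "progressive T F \<Psi> \<longleftrightarrow> (\<forall>b\<in>{0..T}. (\<lambda>z. indicator {..b} (snd z) *\<^sub>R \<Psi> z) \<in> borel_measurable (F b \<Otimes>\<^sub>M lborel))"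

lemma block_measurable [measurable]: "block \<delta> j \<in> sets borel"
  by (simp add: block_def)

lemma emeasure_block: "\<delta> > 0 \<Longrightarrow> emeasure lborel (block \<delta> j) = ennreal \<delta>"
  unfolding block_def by (subst emeasure_lborel_Ioc) (auto simp: algebra_simps)

text \<open>The block ends at \<open>real j * \<delta>\<close>, so the average does not see the
  cut-off of \<open>\<Psi>\<close> at that time and is known as soon as the next cell
  begins.\<close>

lemma block_average_measurable:
  assumes "progressive T F \<Psi>" "0 \<le> real j * \<delta>" "real j * \<delta> \<le> T"
  shows "block_average \<delta> \<Psi> j \<in> borel_measurable (F (real j * \<delta>))"
proof -
  let ?b = "real j * \<delta>"
  have m: "(\<lambda>z. indicator {..?b} (snd z) *\<^sub>R \<Psi> z) \<in> borel_measurable (F ?b \<Otimes>\<^sub>M lborel)"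
    using assms by (auto simp: progressive_def)
  have "(\<lambda>z. indicator (block \<delta> j) (snd z) *\<^sub>R (indicator {..?b} (snd z) *\<^sub>R \<Psi> z)) \<in> borel_measurable (F ?b \<Otimes>\<^sub>M lborel)"
    by (intro borel_measurable_scaleR m) measurable
  then have "(\<lambda>w. \<integral>s. indicator (block \<delta> j) s *\<^sub>R (indicator {..?b} s *\<^sub>R \<Psi> (w, s)) \<partial>lborel) \<in> borel_measurable (F ?b)"
    by (intro lborel.borel_measurable_lebesgue_integral) (simp add: split_beta')
  moreover have "indicator (block \<delta> j) s *\<^sub>R (indicator {..?b} s *\<^sub>R x) = indicator (block \<delta> j) s *\<^sub>R x" for s and x :: 'b
    by (auto simp: indicator_def block_def)
  ultimately have "(\<lambda>w. \<integral>s. indicator (block \<delta> j) s *\<^sub>R \<Psi> (w, s) \<partial>lborel) \<in> borel_measurable (F ?b)"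
    by (simp only:)
  then show ?thesis unfolding block_average_def by (intro borel_measurable_scaleR borel_measurable_const)
qed

context prob_space
begin

text \<open>\<open>x \<le> 1 + x\<^sup>2\<close> and the finite length of a block bring L2 down to
  L1. On the exceptional null set the average may be a default value of the Bochner integral, so
  averages are estimated almost everywhere.\<close>

lemma AE_sections_integrable:
  assumes \<Psi>: "\<Psi> \<in> Lp (M \<Otimes>\<^sub>M lborel) 2" and \<delta>: "\<delta> > 0"
  shows "AE w in M. \<forall>j. integrable lborel (\<lambda>s. indicator (block \<delta> j) s *\<^sub>R \<Psi> (w, s))"
proof -
  have [measurable]: "\<Psi> \<in> borel_measurable (M \<Otimes>\<^sub>M borel)"
    using Lp2_measurable[OF \<Psi>] by (simp cong: measurable_cong_sets)
  have "(\<integral>\<^sup>+w. \<integral>\<^sup>+s. ennreal ((norm (\<Psi> (w, s)))\<^sup>2) \<partial>lborel \<partial>M) = msq (M \<Otimes>\<^sub>M lborel) \<Psi>"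
    unfolding msq_def by (subst lborel.nn_integral_fst[symmetric]) auto
  also have "\<dots> < \<infinity>" using \<Psi> by (simp add: Lp2_iff)
  finally have "AE w in M. (\<integral>\<^sup>+s. ennreal ((norm (\<Psi> (w, s)))\<^sup>2) \<partial>lborel) \<noteq> \<infinity>"
    by (intro nn_integral_PInf_AE) auto
  then show ?thesis
  proof (rule AE_mp, intro AE_I2 impI allI)
    fix w j assume w: "w \<in> space M" and fin: "(\<integral>\<^sup>+s. ennreal ((norm (\<Psi> (w, s)))\<^sup>2) \<partial>lborel) \<noteq> \<infinity>"
    have [measurable]: "(\<lambda>s. \<Psi> (w, s)) \<in> borel_measurable borel"
      using w by measurable
    have "(\<integral>\<^sup>+s. ennreal (norm (indicator (block \<delta> j) s *\<^sub>R \<Psi> (w, s))) \<partial>lborel) \<le> (\<integral>\<^sup>+s. indicator (block \<delta> j) s + ennreal ((norm (\<Psi> (w, s)))\<^sup>2) \<partial>lborel)"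
    proof (rule nn_integral_mono)
      fix s
      have "norm (\<Psi> (w, s)) \<le> 1 + (norm (\<Psi> (w, s)))\<^sup>2"
        using sum_squares_bound[of 1 "norm (\<Psi> (w, s))"] norm_ge_zero[of "\<Psi> (w, s)"] by (simp, linarith)
      then have "ennreal (norm (\<Psi> (w, s))) \<le> 1 + ennreal ((norm (\<Psi> (w, s)))\<^sup>2)"
        by (metis ennreal_1 ennreal_leI ennreal_plus zero_le_one zero_le_power2)
      then show "ennreal (norm (indicator (block \<delta> j) s *\<^sub>R \<Psi> (w, s))) \<le> indicator (block \<delta> j) s + ennreal ((norm (\<Psi> (w, s)))\<^sup>2)"
        by (auto simp: indicator_def)
    qed
    also have "\<dots> = ennreal \<delta> + (\<integral>\<^sup>+s. ennreal ((norm (\<Psi> (w, s)))\<^sup>2) \<partial>lborel)"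
      using emeasure_block[OF \<delta>] by (subst nn_integral_add) auto
    also have "\<dots> < \<infinity>" using fin by (simp add: top.not_eq_extremum)
    finally show "integrable lborel (\<lambda>s. indicator (block \<delta> j) s *\<^sub>R \<Psi> (w, s))"
      by (intro integrableI_bounded) auto
  qed
qed

lemma block_average_msq:
  assumes \<Psi>: "\<Psi> \<in> Lp (M \<Otimes>\<^sub>M lborel) 2" and \<delta>: "\<delta> > 0"
  shows "msq M (block_average \<delta> \<Psi> j) \<le> ennreal (1/\<delta>) * msq (M \<Otimes>\<^sub>M lborel) \<Psi>"
proof -
  have m [measurable]: "\<Psi> \<in> borel_measurable (M \<Otimes>\<^sub>M borel)"
    using Lp2_measurable[OF \<Psi>] by (simp cong: measurable_cong_sets)
  have "msq M (block_average \<delta> \<Psi> j) \<le> (\<integral>\<^sup>+w. ennreal (1/\<delta>) * (\<integral>\<^sup>+s. ennreal ((norm (\<Psi> (w, s)))\<^sup>2) \<partial>lborel) \<partial>M)"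
    unfolding msq_def
  proof (rule nn_integral_mono_AE, use AE_sections_integrable[OF \<Psi> \<delta>] in \<open>rule AE_mp\<close>, intro AE_I2 impI)
    fix w assume w: "w \<in> space M" and "\<forall>j. integrable lborel (\<lambda>s. indicator (block \<delta> j) s *\<^sub>R \<Psi> (w, s))"
    then have int: "integrable lborel (\<lambda>s. indicator (block \<delta> j) s *\<^sub>R \<Psi> (w, s))" by blast
    have [measurable]: "(\<lambda>s. \<Psi> (w, s)) \<in> borel_measurable borel" using w by measurable
    have "ennreal ((norm (block_average \<delta> \<Psi> j w))\<^sup>2) \<le> ennreal (1/\<delta>) * (\<integral>\<^sup>+s. ennreal ((norm (\<Psi> (w, s)))\<^sup>2) * indicator (block \<delta> j) s \<partial>lborel)"
      using lborel_average_deviation[OF _ _ emeasure_block[OF \<delta>] \<delta> int, of 0] by (simp add: block_average_def)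
    also have "\<dots> \<le> ennreal (1/\<delta>) * (\<integral>\<^sup>+s. ennreal ((norm (\<Psi> (w, s)))\<^sup>2) \<partial>lborel)"
      by (intro mult_left_mono nn_integral_mono) (auto simp: indicator_def)
    finally show "ennreal ((norm (block_average \<delta> \<Psi> j w))\<^sup>2) \<le> ennreal (1/\<delta>) * (\<integral>\<^sup>+s. ennreal ((norm (\<Psi> (w, s)))\<^sup>2) \<partial>lborel)" .
  qed
  also have "\<dots> = ennreal (1/\<delta>) * (\<integral>\<^sup>+w. \<integral>\<^sup>+s. ennreal ((norm (\<Psi> (w, s)))\<^sup>2) \<partial>lborel \<partial>M)"
    by (rule nn_integral_cmult) measurable
  also have "(\<integral>\<^sup>+w. \<integral>\<^sup>+s. ennreal ((norm (\<Psi> (w, s)))\<^sup>2) \<partial>lborel \<partial>M) = msq (M \<Otimes>\<^sub>M lborel) \<Psi>"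
    unfolding msq_def by (subst lborel.nn_integral_fst[symmetric]) auto
  finally show ?thesis .
qed

lemma block_average_Lp2:
  assumes \<Psi>: "\<Psi> \<in> Lp (M \<Otimes>\<^sub>M lborel) 2" and \<delta>: "\<delta> > 0"
  shows "block_average \<delta> \<Psi> j \<in> Lp M 2"
proof -
  have m [measurable]: "\<Psi> \<in> borel_measurable (M \<Otimes>\<^sub>M borel)"
    using Lp2_measurable[OF \<Psi>] by (simp cong: measurable_cong_sets)
  have "block_average \<delta> \<Psi> j \<in> borel_measurable M"
    unfolding block_average_def by measurable
  then show ?thesis
    unfolding Lp2_iff using le_less_trans[OF block_average_msq[OF assms]] \<Psi> by (auto simp: Lp2_iff ennreal_mult_less_top)
qed

end

text \<open>The step process takes on each grid interval the average of \<open>\<Psi>\<close> over the preceding one, which makes it adapted.\<close>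

definition step_process :: "real \<Rightarrow> nat \<Rightarrow> ('w \<times> real \<Rightarrow> 'b::euclidean_space) \<Rightarrow> 'w \<times> real \<Rightarrow> 'b" where
  "step_process \<delta> N \<Psi> = family_process {..<N} (\<lambda>j. real j * \<delta>) (\<lambda>j. real (Suc j) * \<delta>) (block_average \<delta> \<Psi>)"

lemma cell_family_eq:
  fixes \<xi> :: "nat \<Rightarrow> 'w \<Rightarrow> 'b::real_vector"
  assumes \<delta>: "\<delta> > 0" and j: "j < N" and t: "real j * \<delta> < t" "t \<le> real (Suc j) * \<delta>"
  shows "family_process {..<N} (\<lambda>j. real j * \<delta>) (\<lambda>j. real (Suc j) * \<delta>) \<xi> (w, t) = \<xi> j w"
proof -
  have "indicator {real i * \<delta><..real (Suc i) * \<delta>} t = (if i = j then 1 else (0::real))" for i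
  proof (cases i j rule: linorder_cases)
    case less
    then have "real (Suc i) * \<delta> \<le> real j * \<delta>" using \<delta> by (intro mult_right_mono) auto
    then show ?thesis using t less by (auto simp: indicator_def)
  next
    case greater
    then have "real (Suc j) * \<delta> \<le> real i * \<delta>" using \<delta> by (intro mult_right_mono) auto
    then show ?thesis using t greater by (auto simp: indicator_def)
  qed (use t in auto)
  then have "family_process {..<N} (\<lambda>j. real j * \<delta>) (\<lambda>j. real (Suc j) * \<delta>) \<xi> (w, t)
      = (\<Sum>i<N. (if i = j then 1 else (0::real)) *\<^sub>R \<xi> i w)"
    unfolding family_process_def by (simp only: split_conv)
  also have "\<dots> = (\<Sum>i<N. if i = j then \<xi> i w else 0)"
    by (intro sum.cong) auto
  finally show ?thesis using j by simp
qed

lemma family_process_outside: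
  assumes "\<And>i. i \<in> I \<Longrightarrow> t \<notin> {s i<..u i}"
  shows "family_process I s u \<xi> (w, t) = 0"
  unfolding family_process_def using assms
  by (simp only: split_conv) (rule sum.neutral, auto)

lemma cell_family_outside:
  assumes \<delta>: "\<delta> > 0" and t: "t \<notin> {0<..real N * \<delta>}"
  shows "family_process {..<N} (\<lambda>j. real j * \<delta>) (\<lambda>j. real (Suc j) * \<delta>) \<xi> (w, t) = 0"
proof (rule family_process_outside)
  fix i assume "i \<in> {..<N}"
  then have "0 \<le> real i * \<delta>" "real (Suc i) * \<delta> \<le> real N * \<delta>"
    using \<delta> by (auto intro!: mult_right_mono)
  then show "t \<notin> {real i * \<delta><..real (Suc i) * \<delta>}" using t by auto
qed

lemma grid_cell: "0 < t \<Longrightarrow> t \<le> real N * \<delta> \<Longrightarrow> \<exists>j<N. real j * \<delta> < t \<and> t \<le> real (Suc j) * \<delta>"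
proof (induction N)
  case (Suc N)
  show ?case
  proof (cases "t \<le> real N * \<delta>")
    case True
    with Suc show ?thesis using less_SucI by blast
  next
    case False
    with Suc.prems show ?thesis by (intro exI[of _ N]) auto
  qed
qed simp

context prob_space
begin

text \<open>At every time at most one cell is active, so the squared norm of the sum is dominated by
  the sum of the squared norms, without cross terms.\<close>

lemma cell_family_msq:
  fixes \<xi> :: "nat \<Rightarrow> 'a \<Rightarrow> 'b::euclidean_space"
  assumes \<delta>: "\<delta> > 0" and \<xi>: "\<And>j. j < N \<Longrightarrow> \<xi> j \<in> borel_measurable M"
  shows "msq (M \<Otimes>\<^sub>M lborel) (family_process {..<N} (\<lambda>j. real j * \<delta>) (\<lambda>j. real (Suc j) * \<delta>) \<xi>)
    \<le> (\<Sum>j<N. ennreal \<delta> * msq M (\<xi> j))"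
proof -
  let ?P = "family_process {..<N} (\<lambda>j. real j * \<delta>) (\<lambda>j. real (Suc j) * \<delta>) \<xi>"
  have "msq (M \<Otimes>\<^sub>M lborel) ?P
    \<le> (\<integral>\<^sup>+z. (\<Sum>j<N. ennreal ((norm (\<xi> j (fst z)))\<^sup>2) * indicator {real j * \<delta><..real (Suc j) * \<delta>} (snd z)) \<partial>(M \<Otimes>\<^sub>M lborel))"
    unfolding msq_def
  proof (rule nn_integral_mono)
    fix z :: "'a \<times> real"
    show "ennreal ((norm (?P z))\<^sup>2) \<le> (\<Sum>j<N. ennreal ((norm (\<xi> j (fst z)))\<^sup>2) * indicator {real j * \<delta><..real (Suc j) * \<delta>} (snd z))"
    proof (cases "snd z \<in> {0<..real N * \<delta>}")
      case False
      then show ?thesis using cell_family_outside[OF \<delta> False, of \<xi> "fst z"] by simp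
    next
      case True
      then obtain j where j: "j < N" "real j * \<delta> < snd z" "snd z \<le> real (Suc j) * \<delta>"
        using grid_cell[of "snd z" N \<delta>] by auto
      have "ennreal ((norm (?P z))\<^sup>2) = ennreal ((norm (\<xi> j (fst z)))\<^sup>2) * indicator {real j * \<delta><..real (Suc j) * \<delta>} (snd z)"
        using cell_family_eq[OF \<delta> j, of \<xi> "fst z"] j by simp
      also have "\<dots> \<le> (\<Sum>j<N. ennreal ((norm (\<xi> j (fst z)))\<^sup>2) * indicator {real j * \<delta><..real (Suc j) * \<delta>} (snd z))"
        using j(1) by (intro member_le_sum) auto
      finally show ?thesis .
    qed
  qed
  also have "\<dots> = (\<Sum>j<N. \<integral>\<^sup>+z. ennreal ((norm (\<xi> j (fst z)))\<^sup>2) * indicator {real j * \<delta><..real (Suc j) * \<delta>} (snd z) \<partial>(M \<Otimes>\<^sub>M lborel))"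
    using \<xi> by (intro nn_integral_sum) (auto intro!: borel_measurable_times_ennreal measurable_compose[OF measurable_fst])
  also have "\<dots> = (\<Sum>j<N. ennreal \<delta> * msq M (\<xi> j))"
  proof (rule sum.cong[OF refl])
    fix j assume "j \<in> {..<N}"
    then have [measurable]: "\<xi> j \<in> borel_measurable M" using \<xi> by simp
    have "(\<integral>\<^sup>+z. ennreal ((norm (\<xi> j (fst z)))\<^sup>2) * indicator {real j * \<delta><..real (Suc j) * \<delta>} (snd z) \<partial>(M \<Otimes>\<^sub>M lborel))
       = (\<integral>\<^sup>+w. \<integral>\<^sup>+r. ennreal ((norm (\<xi> j w))\<^sup>2) * indicator {real j * \<delta><..real (Suc j) * \<delta>} r \<partial>lborel \<partial>M)"
      by (subst lborel.nn_integral_fst[symmetric]) auto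
    also have "\<dots> = (\<integral>\<^sup>+w. ennreal \<delta> * ennreal ((norm (\<xi> j w))\<^sup>2) \<partial>M)"
      using \<delta> by (intro nn_integral_cong) (simp add: nn_integral_cmult_indicator algebra_simps)
    finally show "(\<integral>\<^sup>+z. ennreal ((norm (\<xi> j (fst z)))\<^sup>2) * indicator {real j * \<delta><..real (Suc j) * \<delta>} (snd z) \<partial>(M \<Otimes>\<^sub>M lborel))
       = ennreal \<delta> * msq M (\<xi> j)"
      by (simp add: nn_integral_cmult msq_def)
  qed
  finally show ?thesis .
qed

text \<open>For \<open>t\<close> in a cell and \<open>s\<close> in the preceding one,
  \<open>h = t - s\<close> lies between \<open>0\<close> and \<open>2 * \<delta>\<close>. Averaging
  over \<open>s\<close> with density \<open>1/\<delta>\<close> is thus dominated by integrating over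
  all those \<open>h\<close>. After Fubini each fixed \<open>h\<close> contributes at most
  \<open>c\<close>, and the length \<open>2 * \<delta>\<close> of the range of \<open>h\<close>
  yields the factor \<open>2\<close>.\<close>

theorem step_process_error:
  assumes \<Psi>: "\<Psi> \<in> Lp (M \<Otimes>\<^sub>M lborel) 2" and \<delta>: "\<delta> > 0"
    and supp: "\<And>w t. t \<notin> {0<..real N * \<delta>} \<Longrightarrow> \<Psi> (w, t) = 0"
    and mod: "\<And>h. 0 < h \<Longrightarrow> h < 2 * \<delta> \<Longrightarrow> msq (M \<Otimes>\<^sub>M lborel) (\<lambda>(w, t). \<Psi> (w, t) - \<Psi> (w, t - h)) \<le> c"
  shows "msq (M \<Otimes>\<^sub>M lborel) (\<lambda>z. \<Psi> z - step_process \<delta> N \<Psi> z) \<le> 2 * c"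
proof -
  have m [measurable]: "\<Psi> \<in> borel_measurable (M \<Otimes>\<^sub>M borel)"
    using Lp2_measurable[OF \<Psi>] by (simp cong: measurable_cong_sets)
  have [measurable]: "step_process \<delta> N \<Psi> \<in> borel_measurable (M \<Otimes>\<^sub>M borel)"
    using family_process_measurable[of "{..<N}" "block_average \<delta> \<Psi>" M] Lp2_measurable[OF block_average_Lp2[OF \<Psi> \<delta>]]
    by (simp add: step_process_def cong: measurable_cong_sets)
  let ?D = "\<lambda>w t h. ennreal ((norm (\<Psi> (w, t) - \<Psi> (w, t - h)))\<^sup>2)"
  have "msq (M \<Otimes>\<^sub>M lborel) (\<lambda>z. \<Psi> z - step_process \<delta> N \<Psi> z) = (\<integral>\<^sup>+w. \<integral>\<^sup>+t. ennreal ((norm (\<Psi> (w, t) - step_process \<delta> N \<Psi> (w, t)))\<^sup>2) \<partial>lborel \<partial>M)"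
    unfolding msq_def by (subst lborel.nn_integral_fst[symmetric]) auto
  also have "\<dots> \<le> (\<integral>\<^sup>+w. \<integral>\<^sup>+t. ennreal (1/\<delta>) * (\<integral>\<^sup>+h. ?D w t h * indicator {0<..<2*\<delta>} h \<partial>lborel) \<partial>lborel \<partial>M)"
  proof (rule nn_integral_mono_AE, use AE_sections_integrable[OF \<Psi> \<delta>] in \<open>rule AE_mp\<close>, intro AE_I2 impI nn_integral_mono)
    fix w t assume w: "w \<in> space M" and int: "\<forall>j. integrable lborel (\<lambda>s. indicator (block \<delta> j) s *\<^sub>R \<Psi> (w, s))"
    have [measurable]: "(\<lambda>s. \<Psi> (w, s)) \<in> borel_measurable borel" using w by measurable
    show "ennreal ((norm (\<Psi> (w, t) - step_process \<delta> N \<Psi> (w, t)))\<^sup>2) \<le> ennreal (1/\<delta>) * (\<integral>\<^sup>+h. ?D w t h * indicator {0<..<2*\<delta>} h \<partial>lborel)"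
    proof (cases "t \<in> {0<..real N * \<delta>}")
      case False
      then show ?thesis by (simp add: supp step_process_def cell_family_outside[OF \<delta>] del: of_nat_Suc)
    next
      case True
      then obtain j where j: "j < N" "real j * \<delta> < t" "t \<le> real (Suc j) * \<delta>"
        using grid_cell[of t N \<delta>] by auto
      have "ennreal ((norm (\<Psi> (w, t) - step_process \<delta> N \<Psi> (w, t)))\<^sup>2)
         \<le> ennreal (1/\<delta>) * (\<integral>\<^sup>+s. ennreal ((norm (\<Psi> (w, t) - \<Psi> (w, s)))\<^sup>2) * indicator (block \<delta> j) s \<partial>lborel)"
        unfolding step_process_def cell_family_eq[OF \<delta> j] block_average_def
        using int by (intro lborel_average_deviation emeasure_block \<delta>) auto
      also have "(\<integral>\<^sup>+s. ennreal ((norm (\<Psi> (w, t) - \<Psi> (w, s)))\<^sup>2) * indicator (block \<delta> j) s \<partial>lborel)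
         = (\<integral>\<^sup>+h. ?D w t h * indicator (block \<delta> j) (t - h) \<partial>lborel)"
        by (subst nn_integral_real_affine[where c="-1" and t=t]) auto
      also have "\<dots> \<le> (\<integral>\<^sup>+h. ?D w t h * indicator {0<..<2*\<delta>} h \<partial>lborel)"
      proof (intro nn_integral_mono mult_left_mono)
        fix h
        show "indicator (block \<delta> j) (t - h) \<le> (indicator {0<..<2*\<delta>} h :: ennreal)"
          using j by (auto simp: indicator_def block_def algebra_simps)
      qed auto
      finally show ?thesis by (simp add: mult_left_mono)
    qed
  qed
  also have "\<dots> = (\<integral>\<^sup>+w. ennreal (1/\<delta>) * (\<integral>\<^sup>+t. (\<integral>\<^sup>+h. ?D w t h * indicator {0<..<2*\<delta>} h \<partial>lborel) \<partial>lborel) \<partial>M)"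
    by (intro nn_integral_cong nn_integral_cmult) measurable
  also have "\<dots> = ennreal (1/\<delta>) * (\<integral>\<^sup>+w. (\<integral>\<^sup>+t. (\<integral>\<^sup>+h. ?D w t h * indicator {0<..<2*\<delta>} h \<partial>lborel) \<partial>lborel) \<partial>M)"
    by (rule nn_integral_cmult) measurable
  also have "(\<integral>\<^sup>+w. (\<integral>\<^sup>+t. (\<integral>\<^sup>+h. ?D w t h * indicator {0<..<2*\<delta>} h \<partial>lborel) \<partial>lborel) \<partial>M)
    = (\<integral>\<^sup>+z. (\<integral>\<^sup>+h. ?D (fst z) (snd z) h * indicator {0<..<2*\<delta>} h \<partial>lborel) \<partial>(M \<Otimes>\<^sub>M lborel))"
    by (subst lborel.nn_integral_fst[symmetric]) auto
  also have "\<dots> = (\<integral>\<^sup>+h. (\<integral>\<^sup>+z. ?D (fst z) (snd z) h * indicator {0<..<2*\<delta>} h \<partial>(M \<Otimes>\<^sub>M lborel)) \<partial>lborel)"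
  proof (rule pair_sigma_finite.Fubini')
    show "pair_sigma_finite (lborel :: real measure) (M \<Otimes>\<^sub>M (lborel :: real measure))"
      by (intro pair_sigma_finite.intro sigma_finite_pair_measure sigma_finite_measure_axioms lborel.sigma_finite_measure_axioms)
  qed (simp add: split_beta')
  also have "\<dots> \<le> (\<integral>\<^sup>+h. c * indicator {0<..<2*\<delta>} h \<partial>lborel)"
  proof (rule nn_integral_mono)
    fix h :: real
    show "(\<integral>\<^sup>+z. ?D (fst z) (snd z) h * indicator {0<..<2*\<delta>} h \<partial>(M \<Otimes>\<^sub>M lborel)) \<le> c * indicator {0<..<2*\<delta>} h"
      using mod[of h] by (cases "h \<in> {0<..<2*\<delta>}") (auto simp: msq_def split_beta')
  qed
  also have "\<dots> = c * ennreal (2 * \<delta>)"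
    using \<delta> by (simp add: nn_integral_cmult_indicator)
  finally have "msq (M \<Otimes>\<^sub>M lborel) (\<lambda>z. \<Psi> z - step_process \<delta> N \<Psi> z) \<le> ennreal (1/\<delta>) * (c * ennreal (2 * \<delta>))"
    by (simp add: mult_left_mono)
  also have "\<dots> = (ennreal (1/\<delta>) * ennreal (2 * \<delta>)) * c" by (simp only: mult_ac)
  also have "ennreal (1/\<delta>) * ennreal (2 * \<delta>) = 2" using \<delta> by (simp add: ennreal_mult[symmetric])
  finally show ?thesis .
qed

end

section \<open>Existence of the Ito integral\<close>

text \<open>On the whole time line translations preserve the measure. Time \<open>0\<close> is left
  out because elementary processes, with their left-open intervals, vanish there too; only a null
  set is lost.\<close>

definition zero_extension :: "real \<Rightarrow> (real \<Rightarrow> 'w \<Rightarrow> 'b::real_vector) \<Rightarrow> 'w \<times> real \<Rightarrow> 'b" where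
  "zero_extension T \<Phi> = (\<lambda>(w, t). indicator {0<..T} t *\<^sub>R \<Phi> t w)"

lemma sigma_finite_time_measure: "sigma_finite_measure (time_measure T)"
proof -
  have "finite_measure (time_measure T)"
    by (rule finite_measureI) (simp add: time_measure_def space_restrict_space emeasure_restrict_space emeasure_lborel_Icc_eq)
  then show ?thesis by (rule finite_measure.axioms)
qed

lemma space_time_measure: "space (time_measure T) = {0..T}"
  by (simp add: time_measure_def space_restrict_space)

lemma measurable_lborel_time:
  assumes "f \<in> measurable (N \<Otimes>\<^sub>M lborel) K"
  shows "f \<in> measurable (N \<Otimes>\<^sub>M time_measure T) K"
proof -
  have "(\<lambda>z. (fst z, snd z)) \<in> measurable (N \<Otimes>\<^sub>M time_measure T) (N \<Otimes>\<^sub>M lborel)"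
    unfolding time_measure_def
    by (intro measurable_Pair measurable_fst measurable_compose[OF measurable_snd] measurable_restrict_space1) auto
  from measurable_compose[OF this assms] show ?thesis by simp
qed

lemma time_extension_measurable:
  fixes f :: "'w \<times> real \<Rightarrow> 'b::euclidean_space"
  assumes "T \<ge> 0" and f: "f \<in> borel_measurable (N \<Otimes>\<^sub>M time_measure T)"
  shows "(\<lambda>z. indicator {0<..T} (snd z) *\<^sub>R f z) \<in> borel_measurable (N \<Otimes>\<^sub>M lborel)"
proof -
  \<comment> \<open>Clamping maps the line measurably into \<open>[0,T]\<close> and is the identity
    where the indicator is nonzero.\<close>
  let ?c = "\<lambda>t::real. max 0 (min T t)"
  have "?c \<in> measurable lborel (time_measure T)"
    unfolding time_measure_def using assms(1) by (intro measurable_restrict_space2) auto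
  then have "(\<lambda>z. (fst z, ?c (snd z))) \<in> measurable (N \<Otimes>\<^sub>M lborel) (N \<Otimes>\<^sub>M time_measure T)"
    by (intro measurable_Pair measurable_fst measurable_compose[OF measurable_snd])
  from measurable_compose[OF this f] have "(\<lambda>z. indicator {0<..T} (snd z) *\<^sub>R f (fst z, ?c (snd z))) \<in> borel_measurable (N \<Otimes>\<^sub>M lborel)"
    by (intro borel_measurable_scaleR) auto
  moreover have "indicator {0<..T} (snd z) *\<^sub>R f (fst z, ?c (snd z)) = indicator {0<..T} (snd z) *\<^sub>R f z" for z
    by (cases "snd z \<in> {0<..T}") auto
  ultimately show ?thesis by simp
qed

lemma msq_time_measure:
  fixes f :: "'w \<times> real \<Rightarrow> 'b::euclidean_space"
  assumes "T \<ge> 0" and f: "f \<in> borel_measurable (M \<Otimes>\<^sub>M time_measure T)"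
  shows "msq (M \<Otimes>\<^sub>M time_measure T) f = msq (M \<Otimes>\<^sub>M lborel) (\<lambda>z. indicator {0<..T} (snd z) *\<^sub>R f z)"
proof -
  interpret sigma_finite_measure "time_measure T" by (rule sigma_finite_time_measure)
  let ?g = "\<lambda>z. indicator {0<..T} (snd z) *\<^sub>R f z"
  have gm: "(\<lambda>z. ennreal ((norm (?g z))\<^sup>2)) \<in> borel_measurable (M \<Otimes>\<^sub>M lborel)"
    by (rule measurable_compose[OF time_extension_measurable[OF assms]]) measurable
  have "msq (M \<Otimes>\<^sub>M time_measure T) f = (\<integral>\<^sup>+w. \<integral>\<^sup>+t. ennreal ((norm (f (w, t)))\<^sup>2) \<partial>time_measure T \<partial>M)"
    unfolding msq_def using f by (subst nn_integral_fst[symmetric]) auto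
  also have "\<dots> = (\<integral>\<^sup>+w. \<integral>\<^sup>+t. ennreal ((norm (f (w, t)))\<^sup>2) * indicator {0..T} t \<partial>lborel \<partial>M)"
    unfolding time_measure_def by (subst nn_integral_restrict_space) auto
  also have "\<dots> = (\<integral>\<^sup>+w. \<integral>\<^sup>+t. ennreal ((norm (?g (w, t)))\<^sup>2) \<partial>lborel \<partial>M)"
  proof (rule nn_integral_cong, rule nn_integral_cong_AE)
    fix w
    show "AE t in lborel. ennreal ((norm (f (w, t)))\<^sup>2) * indicator {0..T} t = ennreal ((norm (?g (w, t)))\<^sup>2)"
      using AE_lborel_singleton[of "0::real"] by eventually_elim (auto simp: indicator_def)
  qed
  also have "\<dots> = msq (M \<Otimes>\<^sub>M lborel) ?g"
    unfolding msq_def by (rule lborel.nn_integral_fst[OF gm])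
  finally show ?thesis .
qed

text \<open>The last condition, continuity of translations in \<open>L\<^sup>2(\<Omega> \<times> \<real>)\<close>, holds for every square-integrable
  function; assuming it avoids that theorem, since it is also inherited by the weak limit.\<close>

definition regular_integrand ::
  "'w measure \<Rightarrow> real \<Rightarrow> (real \<Rightarrow> 'w measure) \<Rightarrow> (real \<Rightarrow> 'w \<Rightarrow> 'b::euclidean_space) \<Rightarrow> bool" where
  "regular_integrand M T F \<Phi> \<longleftrightarrow>
     (\<lambda>(w, s). \<Phi> s w) \<in> borel_measurable (M \<Otimes>\<^sub>M time_measure T) \<and>
     progressive T F (zero_extension T \<Phi>) \<and> zero_extension T \<Phi> \<in> Lp (M \<Otimes>\<^sub>M lborel) 2 \<and>
     (\<forall>e>0. \<exists>d>0. \<forall>h. 0 < h \<and> h < d \<longrightarrow>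
        msq (M \<Otimes>\<^sub>M lborel) (\<lambda>(w, t). zero_extension T \<Phi> (w, t) - zero_extension T \<Phi> (w, t - h)) \<le> ennreal e)"

context brownian
begin

lemma elementary_family:
  assumes "elementary M T F N \<tau> \<xi>"
  shows "\<And>j. j \<in> {..<N} \<Longrightarrow> 0 \<le> \<tau> j \<and> \<tau> j \<le> \<tau> (Suc j) \<and> \<tau> (Suc j) \<le> T"
    and "\<And>j. j \<in> {..<N} \<Longrightarrow> \<xi> j \<in> borel_measurable (F (\<tau> j))"
    and "\<And>j. j \<in> {..<N} \<Longrightarrow> \<xi> j \<in> Lp M 2"
proof -
  show 1: "0 \<le> \<tau> j \<and> \<tau> j \<le> \<tau> (Suc j) \<and> \<tau> (Suc j) \<le> T" and 2: "\<xi> j \<in> borel_measurable (F (\<tau> j))"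
    if "j \<in> {..<N}" for j using assms that by (auto simp: elementary_def)
  show "\<xi> j \<in> Lp M 2" if j: "j \<in> {..<N}" for j
  proof -
    have "bounded (\<xi> j ` space M)" using assms j by (auto simp: elementary_def)
    then obtain B where "\<And>x. x \<in> space M \<Longrightarrow> norm (\<xi> j x) \<le> B" by (auto simp: bounded_iff)
    moreover have "\<xi> j \<in> borel_measurable M" by (rule F_M[OF _ _ 2[OF j]]) (use 1[OF j] in auto)
    ultimately show ?thesis by (intro Lp2_bounded) (auto intro: finite_measure_axioms)
  qed
qed

text \<open>Holds for every version \<open>J\<close>, so it applies to whichever one
  \<open>ito_integral\<close> selects. The elementary approximants of \<open>J\<close> are compared
  with the given family and then sent to the limit; two uses of \<open>msq_triangle\<close> give the
  factor \<open>4\<close>.\<close>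

lemma ito_integral_approx:
  fixes \<Phi> :: "real \<Rightarrow> 'w \<Rightarrow> real^'k^'m" and \<xi> :: "'i \<Rightarrow> 'w \<Rightarrow> real^'k^'m"
  assumes t: "0 \<le> t" "t \<le> T" and ito: "is_ito_integral M T F W \<Phi> t J"
    and I: "finite I" "\<And>i. i \<in> I \<Longrightarrow> 0 \<le> s i \<and> s i \<le> u i \<and> u i \<le> T"
      "\<And>i. i \<in> I \<Longrightarrow> \<xi> i \<in> borel_measurable (F (s i))" "\<And>i. i \<in> I \<Longrightarrow> \<xi> i \<in> Lp M 2"
  shows "msq M (\<lambda>w. J w - family_integral W I s u \<xi> t w)
    \<le> ennreal (4 * real CARD('k)) * msq (M \<Otimes>\<^sub>M lborel) (\<lambda>z. zero_extension T \<Phi> z - family_process I s u \<xi> z)"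
proof -
  have T0: "T \<ge> 0" using t by simp
  let ?k = "ennreal (real CARD('k))"
  obtain N \<tau> \<zeta> where el: "\<And>i. elementary M T F (N i) (\<tau> i) (\<zeta> i)"
    and c1: "Lp_converges (M \<Otimes>\<^sub>M time_measure T) 2 (\<lambda>i. elementary_process (N i) (\<tau> i) (\<zeta> i)) (\<lambda>(w, s). \<Phi> s w)"
    and c2: "Lp_converges M 2 (\<lambda>i. elementary_integral W (N i) (\<tau> i) (\<zeta> i) t) J"
    using ito unfolding is_ito_integral_def by blast
  let ?E = "\<lambda>i. elementary_process (N i) (\<tau> i) (\<zeta> i)" and ?Y = "\<lambda>i. elementary_integral W (N i) (\<tau> i) (\<zeta> i) t"
  let ?P = "family_process I s u \<xi>" and ?S = "family_integral W I s u \<xi> t" and ?Z = "zero_extension T \<Phi>"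
  have Em: "?E i \<in> borel_measurable (M \<Otimes>\<^sub>M lborel)" for i
    unfolding elementary_process_family
    by (intro family_process_measurable Lp2_measurable elementary_family(3)[OF el]) auto
  have Pm: "?P \<in> borel_measurable (M \<Otimes>\<^sub>M lborel)"
    by (intro family_process_measurable Lp2_measurable I) auto
  have \<Phi>m: "(\<lambda>(w, s). \<Phi> s w) \<in> borel_measurable (M \<Otimes>\<^sub>M time_measure T)"
    using c1 by (auto simp: Lp_converges_def Lp_def)
  have Zm: "?Z \<in> borel_measurable (M \<Otimes>\<^sub>M lborel)"
    using time_extension_measurable[OF T0 \<Phi>m] by (simp add: zero_extension_def split_beta')
  have E_out: "?E i (w, r) = 0" if "r \<notin> {0<..T}" for i w r
    unfolding elementary_process_family
  proof (rule family_process_outside)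
    fix j assume "j \<in> {..<N i}"
    from elementary_family(1)[OF el this] that show "r \<notin> {\<tau> i j<..\<tau> i (Suc j)}" by auto
  qed
  have EZ: "msq (M \<Otimes>\<^sub>M time_measure T) (\<lambda>z. ?E i z - (\<lambda>(w, s). \<Phi> s w) z) = msq (M \<Otimes>\<^sub>M lborel) (\<lambda>z. ?E i z - ?Z z)" for i
  proof -
    have "msq (M \<Otimes>\<^sub>M time_measure T) (\<lambda>z. ?E i z - (\<lambda>(w, s). \<Phi> s w) z)
       = msq (M \<Otimes>\<^sub>M lborel) (\<lambda>z. indicator {0<..T} (snd z) *\<^sub>R (?E i z - (\<lambda>(w, s). \<Phi> s w) z))"
      by (intro msq_time_measure T0 borel_measurable_diff \<Phi>m measurable_lborel_time Em)
    also have "(\<lambda>z. indicator {0<..T} (snd z) *\<^sub>R (?E i z - (\<lambda>(w, s). \<Phi> s w) z)) = (\<lambda>z. ?E i z - ?Z z)"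
    proof (rule ext, clarify)
      fix w r show "indicator {0<..T} (snd (w, r)) *\<^sub>R (?E i (w, r) - \<Phi> r w) = ?E i (w, r) - ?Z (w, r)"
        using E_out[of r i w] by (cases "r \<in> {0<..T}") (auto simp: zero_extension_def)
    qed
    finally show ?thesis .
  qed
  have l1: "(\<lambda>i. msq (M \<Otimes>\<^sub>M lborel) (\<lambda>z. ?E i z - ?Z z)) \<longlonglongrightarrow> 0"
    using c1 unfolding Lp_converges2 EZ by blast
  have l2: "(\<lambda>i. msq M (\<lambda>w. J w - ?Y i w)) \<longlonglongrightarrow> 0"
    using c2 unfolding Lp_converges2 by (subst msq_minus_commute) blast
  have Ym: "?Y i \<in> borel_measurable M" "J \<in> borel_measurable M" for i
    using c2 by (auto simp: Lp_converges_def dest: Lp2_measurable)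
  have Sm: "?S \<in> borel_measurable M"
    by (intro Lp2_measurable family_integral_bound(1)[OF t I(1)] I)
  have "msq M (\<lambda>w. J w - ?S w) \<le> 2 * msq M (\<lambda>w. J w - ?Y i w) +
      2 * (?k * (2 * msq (M \<Otimes>\<^sub>M lborel) (\<lambda>z. ?E i z - ?Z z) + 2 * msq (M \<Otimes>\<^sub>M lborel) (\<lambda>z. ?Z z - ?P z)))" for i
  proof -
    have "msq M (\<lambda>w. J w - ?S w) \<le> 2 * msq M (\<lambda>w. J w - ?Y i w) + 2 * msq M (\<lambda>w. ?Y i w - ?S w)"
      by (rule msq_triangle[OF Ym(2) Ym(1) Sm])
    also have "msq M (\<lambda>w. ?Y i w - ?S w) \<le> ?k * msq (M \<Otimes>\<^sub>M lborel) (\<lambda>z. ?E i z - ?P z)"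
      unfolding elementary_integral_family elementary_process_family
      by (intro family_integral_diff_bound[OF t] I elementary_family[OF el]) auto
    also have "msq (M \<Otimes>\<^sub>M lborel) (\<lambda>z. ?E i z - ?P z) \<le> 2 * msq (M \<Otimes>\<^sub>M lborel) (\<lambda>z. ?E i z - ?Z z) + 2 * msq (M \<Otimes>\<^sub>M lborel) (\<lambda>z. ?Z z - ?P z)"
      by (rule msq_triangle[OF Em Zm Pm])
    finally show ?thesis by (simp add: add_left_mono mult_left_mono)
  qed
  moreover have "(\<lambda>i. 2 * msq M (\<lambda>w. J w - ?Y i w) +
      2 * (?k * (2 * msq (M \<Otimes>\<^sub>M lborel) (\<lambda>z. ?E i z - ?Z z) + 2 * msq (M \<Otimes>\<^sub>M lborel) (\<lambda>z. ?Z z - ?P z))))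
     \<longlonglongrightarrow> 2 * 0 + 2 * (?k * (2 * 0 + 2 * msq (M \<Otimes>\<^sub>M lborel) (\<lambda>z. ?Z z - ?P z)))"
    by (intro tendsto_add ennreal_tendsto_cmult l1 l2 tendsto_const) auto
  ultimately have "msq M (\<lambda>w. J w - ?S w) \<le> 2 * 0 + 2 * (?k * (2 * 0 + 2 * msq (M \<Otimes>\<^sub>M lborel) (\<lambda>z. ?Z z - ?P z)))"
    by (intro tendsto_lowerbound[where f="\<lambda>i. 2 * msq M (\<lambda>w. J w - ?Y i w) +
      2 * (?k * (2 * msq (M \<Otimes>\<^sub>M lborel) (\<lambda>z. ?E i z - ?Z z) + 2 * msq (M \<Otimes>\<^sub>M lborel) (\<lambda>z. ?Z z - ?P z)))" and F=sequentially]) auto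
  also have "\<dots> = (2 * 2 * ?k) * msq (M \<Otimes>\<^sub>M lborel) (\<lambda>z. ?Z z - ?P z)" by (simp add: mult_ac)
  also have "2 * 2 * ?k = ennreal (4 * real CARD('k))" by (simp add: ennreal_mult)
  finally show ?thesis .
qed

text \<open>Comparison with the empty family, whose process and integral are zero.\<close>

lemma ito_integral_msq:
  fixes \<Phi> :: "real \<Rightarrow> 'w \<Rightarrow> real^'k^'m"
  assumes "0 \<le> t" "t \<le> T" "is_ito_integral M T F W \<Phi> t J"
  shows "msq M J \<le> ennreal (4 * real CARD('k)) * msq (M \<Otimes>\<^sub>M lborel) (zero_extension T \<Phi>)"
  using ito_integral_approx[OF assms, of "{}::nat set" "\<lambda>_. 0" "\<lambda>_. 0" "\<lambda>_ _. 0"]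
  by (simp add: family_process_def family_integral_def split_beta')

lemma step_process_family:
  assumes \<Psi>: "progressive T F \<Psi>" "\<Psi> \<in> Lp (M \<Otimes>\<^sub>M lborel) 2" and \<delta>: "\<delta> > 0" "real N * \<delta> = T" and j: "j \<in> {..<N}"
  shows "0 \<le> real j * \<delta> \<and> real j * \<delta> \<le> real (Suc j) * \<delta> \<and> real (Suc j) * \<delta> \<le> T"
    and "block_average \<delta> \<Psi> j \<in> borel_measurable (F (real j * \<delta>))"
    and "block_average \<delta> \<Psi> j \<in> Lp M 2"
proof -
  have "real (Suc j) * \<delta> \<le> real N * \<delta>" using j \<delta>(1) by (intro mult_right_mono) auto
  then show 1: "0 \<le> real j * \<delta> \<and> real j * \<delta> \<le> real (Suc j) * \<delta> \<and> real (Suc j) * \<delta> \<le> T"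
    using \<delta> by (simp add: distrib_right)
  then show "block_average \<delta> \<Psi> j \<in> borel_measurable (F (real j * \<delta>))"
    by (intro block_average_measurable[OF \<Psi>(1)]) linarith+
  show "block_average \<delta> \<Psi> j \<in> Lp M 2" by (rule block_average_Lp2[OF \<Psi>(2) \<delta>(1)])
qed

text \<open>The mesh is chosen with \<open>2 * \<delta> < d\<close>, since
  \<open>step_process_error\<close> looks at translations up to \<open>2 * \<delta>\<close>; it also
  doubles the modulus, hence \<open>e/2\<close>.\<close>

lemma regular_step_error:
  fixes \<Phi> :: "real \<Rightarrow> 'w \<Rightarrow> 'b::euclidean_space"
  assumes T: "T > 0" and \<Phi>: "regular_integrand M T F \<Phi>" and e: "e > 0"
  obtains N \<delta> where "\<delta> > 0" "real N * \<delta> = T"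
    "msq (M \<Otimes>\<^sub>M lborel) (\<lambda>z. zero_extension T \<Phi> z - step_process \<delta> N (zero_extension T \<Phi>) z) \<le> ennreal e"
proof -
  let ?\<Psi> = "zero_extension T \<Phi>"
  obtain d where d: "d > 0" "\<And>h. 0 < h \<Longrightarrow> h < d \<Longrightarrow> msq (M \<Otimes>\<^sub>M lborel) (\<lambda>(w, t). ?\<Psi> (w, t) - ?\<Psi> (w, t - h)) \<le> ennreal (e/2)"
    using \<Phi> e unfolding regular_integrand_def by (meson half_gt_zero)
  obtain N :: nat where N: "2 * T / d < real N" using reals_Archimedean2 by blast
  have N0: "real N > 0" using N d T by (meson divide_pos_pos less_trans mult_pos_pos zero_less_numeral)
  define \<delta> where "\<delta> = T / real N"
  have \<delta>: "\<delta> > 0" "real N * \<delta> = T" "2 * \<delta> < d" using N N0 T d by (auto simp: \<delta>_def field_simps)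
  have "msq (M \<Otimes>\<^sub>M lborel) (\<lambda>z. ?\<Psi> z - step_process \<delta> N ?\<Psi> z) \<le> 2 * ennreal (e/2)"
    using \<Phi> d \<delta> by (intro step_process_error) (auto simp: regular_integrand_def zero_extension_def indicator_def)
  also have "\<dots> = ennreal e" using e by (simp add: ennreal_mult[symmetric] flip: ennreal_numeral)
  finally show ?thesis using \<delta> that by blast
qed

text \<open>The \<open>SOME\<close> in \<open>ito_integral\<close> means something only once a
  version exists. Step processes approximate the integrand, truncation of their averages makes them
  elementary, and the integrals converge by \<open>family_integral_diff_bound\<close> and
  completeness of L2.\<close>

theorem ito_integral_exists:
  fixes \<Phi> :: "real \<Rightarrow> 'w \<Rightarrow> real^'k^'m"
  assumes T: "T > 0" and t: "0 \<le> t" "t \<le> T" and \<Phi>: "regular_integrand M T F \<Phi>"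
  shows "\<exists>J. is_ito_integral M T F W \<Phi> t J"
proof -
  let ?\<Psi> = "zero_extension T \<Phi>"
  have T0: "T \<ge> 0" using T by simp
  have \<Phi>m: "(\<lambda>(w, s). \<Phi> s w) \<in> borel_measurable (M \<Otimes>\<^sub>M time_measure T)"
    and prog: "progressive T F ?\<Psi>" and L2: "?\<Psi> \<in> Lp (M \<Otimes>\<^sub>M lborel) 2"
    using \<Phi> by (auto simp: regular_integrand_def)
  have "\<exists>N \<tau> \<xi>. elementary M T F N \<tau> \<xi> \<and> msq (M \<Otimes>\<^sub>M lborel) (\<lambda>z. elementary_process N \<tau> \<xi> z - ?\<Psi> z) \<le> ennreal e"
    if e: "e > 0" for e
  proof -
    obtain N \<delta> where \<delta>: "\<delta> > 0" "real N * \<delta> = T"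
      and err: "msq (M \<Otimes>\<^sub>M lborel) (\<lambda>z. ?\<Psi> z - step_process \<delta> N ?\<Psi> z) \<le> ennreal (e/4)"
      by (rule regular_step_error[OF T \<Phi>, of "e/4"]) (use e in auto)
    let ?A = "block_average \<delta> ?\<Psi>"
    note fam = step_process_family[OF prog L2 \<delta>]
    have Am: "?A j \<in> borel_measurable M" for j by (intro Lp2_measurable block_average_Lp2 L2 \<delta>)
    \<comment> \<open>\<open>elementary\<close> demands bounded coefficients, whereas the block
      averages are only square-integrable; they are cut off at a common level for the finitely many
      cells.\<close>
    have "(\<lambda>K. \<Sum>j<N. ennreal \<delta> * msq M (\<lambda>w. truncate K (?A j w) - ?A j w)) \<longlonglongrightarrow> (\<Sum>j<N. ennreal \<delta> * 0)"
      by (intro tendsto_sum ennreal_tendsto_cmult msq_truncate_tendsto block_average_Lp2 L2 \<delta>) auto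
    then have "\<forall>\<^sub>F K in sequentially. (\<Sum>j<N. ennreal \<delta> * msq M (\<lambda>w. truncate K (?A j w) - ?A j w)) < ennreal (e/4)"
      using e by (intro order_tendstoD(2)) auto
    then obtain K where K: "(\<Sum>j<N. ennreal \<delta> * msq M (\<lambda>w. truncate K (?A j w) - ?A j w)) < ennreal (e/4)"
      by (auto simp: eventually_sequentially)
    define \<tau> where "\<tau> j = real j * \<delta>" for j
    define \<xi> where "\<xi> j w = truncate K (?A j w)" for j w
    have el: "elementary M T F N \<tau> \<xi>"
      unfolding elementary_def
    proof (intro allI impI conjI)
      fix j assume j: "j < N"
      show "0 \<le> \<tau> j" "\<tau> j \<le> \<tau> (Suc j)" "\<tau> (Suc j) \<le> T" using fam(1)[of j] j by (auto simp: \<tau>_def)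
      show "\<xi> j \<in> borel_measurable (F (\<tau> j))"
        unfolding \<xi>_def \<tau>_def using fam(2)[of j] j by (intro measurable_compose[OF _ truncate_measurable]) auto
      show "bounded (\<xi> j ` space M)"
        unfolding \<xi>_def using norm_truncate_le by (intro boundedI[of _ "real K"]) blast
    qed
    have "(\<lambda>z. elementary_process N \<tau> \<xi> z - step_process \<delta> N ?\<Psi> z)
       = family_process {..<N} (\<lambda>j. real j * \<delta>) (\<lambda>j. real (Suc j) * \<delta>) (\<lambda>j w. truncate K (?A j w) - ?A j w)"
      by (rule ext) (simp only: elementary_process_family step_process_def family_process_def \<tau>_def \<xi>_def split_beta
          sum_subtractf scaleR_diff_right)
    then have "msq (M \<Otimes>\<^sub>M lborel) (\<lambda>z. elementary_process N \<tau> \<xi> z - step_process \<delta> N ?\<Psi> z)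
      \<le> (\<Sum>j<N. ennreal \<delta> * msq M (\<lambda>w. truncate K (?A j w) - ?A j w))"
      using cell_family_msq[OF \<delta>(1), of N "\<lambda>j w. truncate K (?A j w) - ?A j w"] Am by simp
    also note K
    finally have err2: "msq (M \<Otimes>\<^sub>M lborel) (\<lambda>z. elementary_process N \<tau> \<xi> z - step_process \<delta> N ?\<Psi> z) \<le> ennreal (e/4)" by simp
    have m1: "elementary_process N \<tau> \<xi> \<in> borel_measurable (M \<Otimes>\<^sub>M lborel)"
      unfolding elementary_process_family
      by (intro family_process_measurable Lp2_measurable elementary_family(3)[OF el]) auto
    have m2: "step_process \<delta> N ?\<Psi> \<in> borel_measurable (M \<Otimes>\<^sub>M lborel)"
      unfolding step_process_def by (intro family_process_measurable Am) auto
    have "msq (M \<Otimes>\<^sub>M lborel) (\<lambda>z. elementary_process N \<tau> \<xi> z - ?\<Psi> z) \<le> 2 * ennreal (e/4) + 2 * ennreal (e/4)"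
      using err unfolding msq_minus_commute[of _ ?\<Psi>]
      by (intro order_trans[OF msq_triangle[OF m1 m2 Lp2_measurable[OF L2]]] add_mono mult_left_mono err2) auto
    also have "\<dots> = ennreal e" using e by (simp add: ennreal_mult[symmetric] ennreal_plus[symmetric] flip: ennreal_numeral del: ennreal_plus)
    finally show ?thesis using el by blast
  qed
  then have "\<forall>n. \<exists>N \<tau> \<xi>. elementary M T F N \<tau> \<xi> \<and>
      msq (M \<Otimes>\<^sub>M lborel) (\<lambda>z. elementary_process N \<tau> \<xi> z - ?\<Psi> z) \<le> ennreal (inverse (real (Suc n)))"
    by simp
  then have "\<exists>N \<tau> \<xi>. \<forall>n. elementary M T F (N n) (\<tau> n) (\<xi> n) \<and>
      msq (M \<Otimes>\<^sub>M lborel) (\<lambda>z. elementary_process (N n) (\<tau> n) (\<xi> n) z - ?\<Psi> z) \<le> ennreal (inverse (real (Suc n)))"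
    by (simp only: choice_iff)
  then obtain N \<tau> \<xi> where el: "\<And>n. elementary M T F (N n) (\<tau> n) (\<xi> n)"
    and err: "\<And>n. msq (M \<Otimes>\<^sub>M lborel) (\<lambda>z. elementary_process (N n) (\<tau> n) (\<xi> n) z - ?\<Psi> z) \<le> ennreal (inverse (real (Suc n)))"
    by blast
  let ?E = "\<lambda>i. elementary_process (N i) (\<tau> i) (\<xi> i)" and ?Y = "\<lambda>i. elementary_integral W (N i) (\<tau> i) (\<xi> i) t"
  have lim0: "(\<lambda>n. ennreal (inverse (real (Suc n)))) \<longlonglongrightarrow> 0"
    using tendsto_ennrealI[OF LIMSEQ_inverse_real_of_nat] by simp
  have Em: "?E i \<in> borel_measurable (M \<Otimes>\<^sub>M lborel)" for i
    unfolding elementary_process_family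
    by (intro family_process_measurable Lp2_measurable elementary_family(3)[OF el]) auto
  have Zm: "?\<Psi> \<in> borel_measurable (M \<Otimes>\<^sub>M lborel)" by (rule Lp2_measurable[OF L2])
  have E_out: "?E i (w, r) = 0" if "r \<notin> {0<..T}" for i w r
    unfolding elementary_process_family
  proof (rule family_process_outside)
    fix j assume "j \<in> {..<N i}"
    from elementary_family(1)[OF el this] that show "r \<notin> {\<tau> i j<..\<tau> i (Suc j)}" by auto
  qed
  have ext: "msq (M \<Otimes>\<^sub>M time_measure T) f = msq (M \<Otimes>\<^sub>M lborel) g"
    if "f \<in> borel_measurable (M \<Otimes>\<^sub>M time_measure T)" "\<And>w r. g (w, r) = indicator {0<..T} r *\<^sub>R f (w, r)"
    for f g :: "'w \<times> real \<Rightarrow> real^'k^'m"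
  proof -
    have "g = (\<lambda>z. indicator {0<..T} (snd z) *\<^sub>R f z)" using that(2) by auto
    then show ?thesis using msq_time_measure[OF T0 that(1)] by simp
  qed
  have Et: "?E i \<in> borel_measurable (M \<Otimes>\<^sub>M time_measure T)" for i by (rule measurable_lborel_time[OF Em])
  have EZ: "msq (M \<Otimes>\<^sub>M time_measure T) (\<lambda>z. ?E i z - (\<lambda>(w, s). \<Phi> s w) z) = msq (M \<Otimes>\<^sub>M lborel) (\<lambda>z. ?E i z - ?\<Psi> z)" for i
  proof (rule ext)
    show "(\<lambda>z. ?E i z - (\<lambda>(w, s). \<Phi> s w) z) \<in> borel_measurable (M \<Otimes>\<^sub>M time_measure T)" by (intro borel_measurable_diff Et \<Phi>m)
    fix w r show "?E i (w, r) - ?\<Psi> (w, r) = indicator {0<..T} r *\<^sub>R (?E i (w, r) - (\<lambda>(w, s). \<Phi> s w) (w, r))"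
      using E_out[of r i w] by (cases "r \<in> {0<..T}") (auto simp: zero_extension_def)
  qed
  have \<Phi>L2: "(\<lambda>(w, s). \<Phi> s w) \<in> Lp (M \<Otimes>\<^sub>M time_measure T) 2"
  proof -
    have "msq (M \<Otimes>\<^sub>M time_measure T) (\<lambda>(w, s). \<Phi> s w) = msq (M \<Otimes>\<^sub>M lborel) ?\<Psi>"
      by (rule ext[OF \<Phi>m]) (simp add: zero_extension_def)
    then show ?thesis using \<Phi>m L2 by (simp add: Lp2_iff)
  qed
  have "msq (M \<Otimes>\<^sub>M time_measure T) (\<lambda>z. ?E i z - (\<lambda>(w, s). \<Phi> s w) z) < \<infinity>" for i
    unfolding EZ by (rule le_less_trans[OF err]) simp
  then have "(\<lambda>z. ?E i z - (\<lambda>(w, s). \<Phi> s w) z) \<in> Lp (M \<Otimes>\<^sub>M time_measure T) 2" for i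
    using borel_measurable_diff[OF Et \<Phi>m] by (simp add: Lp2_iff)
  from Lp2_add[OF this \<Phi>L2] have EL2: "?E i \<in> Lp (M \<Otimes>\<^sub>M time_measure T) 2" for i by simp
  have conv1: "Lp_converges (M \<Otimes>\<^sub>M time_measure T) 2 ?E (\<lambda>(w, s). \<Phi> s w)"
    unfolding Lp_converges2 EZ
  proof (intro conjI allI EL2 \<Phi>L2)
    show "(\<lambda>i. msq (M \<Otimes>\<^sub>M lborel) (\<lambda>z. ?E i z - ?\<Psi> z)) \<longlonglongrightarrow> 0"
      by (rule tendsto_sandwich[OF _ _ tendsto_const lim0]) (use err in auto)
  qed
  obtain J where "Lp_converges M 2 ?Y J"
  proof (rule Lp2_complete)
    show "?Y n \<in> Lp M 2" for n
      unfolding elementary_integral_family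
      by (intro family_integral_bound(1)[OF t] elementary_family[OF el]) auto
    fix e :: real assume e: "e > 0"
    \<comment> \<open>Two errors of size \<open>c\<close>, each doubled by
      \<open>msq_triangle\<close> and multiplied by \<open>CARD('k)\<close>, add up to
      \<open>e\<close>.\<close>
    define c where "c = e / (4 * real CARD('k))"
    have c: "c > 0" using e by (simp add: c_def)
    obtain n0 where n0: "\<And>n. n \<ge> n0 \<Longrightarrow> inverse (real (Suc n)) < c"
      using order_tendstoD(2)[OF LIMSEQ_inverse_real_of_nat c] by (auto simp: eventually_sequentially)
    have "msq M (\<lambda>w. ?Y m w - ?Y n w) \<le> ennreal e" if "m \<ge> n0" "n \<ge> n0" for m n
    proof -
      have "msq M (\<lambda>w. ?Y m w - ?Y n w) \<le> ennreal (real CARD('k)) * msq (M \<Otimes>\<^sub>M lborel) (\<lambda>z. ?E m z - ?E n z)"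
        unfolding elementary_integral_family elementary_process_family
        by (intro family_integral_diff_bound[OF t] elementary_family[OF el]) auto
      also have "\<dots> \<le> ennreal (real CARD('k)) * (2 * msq (M \<Otimes>\<^sub>M lborel) (\<lambda>z. ?E m z - ?\<Psi> z) + 2 * msq (M \<Otimes>\<^sub>M lborel) (\<lambda>z. ?\<Psi> z - ?E n z))"
        by (intro mult_left_mono msq_triangle Em Zm) auto
      also have "\<dots> \<le> ennreal (real CARD('k)) * (2 * ennreal c + 2 * ennreal c)"
        unfolding msq_minus_commute[of _ ?\<Psi>]
        using n0[OF that(1)] n0[OF that(2)]
        by (intro mult_left_mono add_mono order_trans[OF err] ennreal_leI) auto
      also have "\<dots> = ennreal (real CARD('k) * (4 * c))"
        using c by (simp add: ennreal_mult[symmetric] ennreal_plus[symmetric] flip: ennreal_numeral del: ennreal_plus)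
      also have "real CARD('k) * (4 * c) = e" by (simp add: c_def)
      finally show ?thesis .
    qed
    then show "\<exists>N. \<forall>m\<ge>N. \<forall>n\<ge>N. msq M (\<lambda>w. ?Y m w - ?Y n w) \<le> ennreal e" by blast
  qed
  with el conv1 show ?thesis unfolding is_ito_integral_def by blast
qed

end

section \<open>Stability under weak convergence of the integrands\<close>

lemma shift_distr:
  assumes "prob_space M"
  shows "distr (M \<Otimes>\<^sub>M lborel) (M \<Otimes>\<^sub>M lborel) (\<lambda>(w, t). (w, t - h)) = M \<Otimes>\<^sub>M (lborel :: real measure)"
proof -
  interpret prob_space M by fact
  have d: "distr lborel lborel (\<lambda>t::real. t - h) = lborel"
    using lborel_distr_plus[of "- h"] by (simp cong: distr_cong)
  have "distr M M (\<lambda>w. w) \<Otimes>\<^sub>M distr lborel lborel (\<lambda>t::real. t - h) = distr (M \<Otimes>\<^sub>M lborel) (M \<Otimes>\<^sub>M lborel) (\<lambda>(w, t). (w, t - h))"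
    by (rule pair_measure_distr) (simp_all add: d lborel.sigma_finite_measure_axioms)
  then show ?thesis by (simp add: d)
qed

lemma shift_measurable: "(\<lambda>(w, t). (w, t - h)) \<in> measurable (M \<Otimes>\<^sub>M lborel) (M \<Otimes>\<^sub>M (lborel :: real measure))"
  by measurable

lemma shift_nn_integral:
  assumes "prob_space M" "g \<in> borel_measurable (M \<Otimes>\<^sub>M (lborel :: real measure))"
  shows "(\<integral>\<^sup>+z. g (fst z, snd z - h) \<partial>(M \<Otimes>\<^sub>M lborel)) = (\<integral>\<^sup>+z. g z \<partial>(M \<Otimes>\<^sub>M lborel))"
proof -
  have "(\<integral>\<^sup>+z. g z \<partial>(M \<Otimes>\<^sub>M lborel)) = (\<integral>\<^sup>+z. g z \<partial>distr (M \<Otimes>\<^sub>M lborel) (M \<Otimes>\<^sub>M lborel) (\<lambda>(w, t). (w, t - h)))"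
    by (simp only: shift_distr[OF assms(1)])
  also have "\<dots> = (\<integral>\<^sup>+z. g (fst z, snd z - h) \<partial>(M \<Otimes>\<^sub>M lborel))"
  proof -
    have g: "g \<in> borel_measurable (distr (M \<Otimes>\<^sub>M lborel) (M \<Otimes>\<^sub>M lborel) (\<lambda>(w, t). (w, t - h)))"
      using assms(2) by (simp only: measurable_distr_eq1)
    show ?thesis
      using nn_integral_distr[OF shift_measurable g] by (simp only: split_beta')
  qed
  finally show ?thesis by simp
qed

lemma shift_integral:
  fixes g :: "'w \<times> real \<Rightarrow> real"
  assumes "prob_space M" "g \<in> borel_measurable (M \<Otimes>\<^sub>M lborel)"
  shows "(\<integral>z. g (fst z, snd z - h) \<partial>(M \<Otimes>\<^sub>M lborel)) = (\<integral>z. g z \<partial>(M \<Otimes>\<^sub>M lborel))"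
proof -
  have "(\<integral>z. g z \<partial>(M \<Otimes>\<^sub>M lborel)) = (\<integral>z. g z \<partial>distr (M \<Otimes>\<^sub>M lborel) (M \<Otimes>\<^sub>M lborel) (\<lambda>(w, t). (w, t - h)))"
    by (simp only: shift_distr[OF assms(1)])
  also have "\<dots> = (\<integral>z. g (fst z, snd z - h) \<partial>(M \<Otimes>\<^sub>M lborel))"
    using integral_distr[OF shift_measurable assms(2), of h] by (simp only: split_beta')
  finally show ?thesis by simp
qed

lemma shift_compose_measurable:
  assumes "g \<in> measurable (M \<Otimes>\<^sub>M (lborel :: real measure)) N"
  shows "(\<lambda>z. g (fst z, snd z - h)) \<in> measurable (M \<Otimes>\<^sub>M lborel) N"
  using measurable_compose[OF shift_measurable assms, of h] by (simp only: split_beta)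

text \<open>Split at \<open>x = K\<close>: above it \<open>x powr (2 - p)\<close> is at most
  \<open>K powr (2 - p)\<close> because \<open>p > 2\<close>; below it one or both factors
  \<open>x\<close> are replaced by \<open>K\<close>. This is the interpolation inequality, with
  \<open>K\<close> still free.\<close>

lemma square_le_linear_powr:
  fixes x K p :: real
  assumes "x \<ge> 0" "K > 0" "p > 2"
  shows "x\<^sup>2 \<le> K * x + K powr (2 - p) * x powr p" and "x\<^sup>2 \<le> K\<^sup>2 + K powr (2 - p) * x powr p"
proof -
  have "x\<^sup>2 \<le> K powr (2 - p) * x powr p" if "x > K"
  proof -
    have x: "x > 0" using that assms by simp
    have "x\<^sup>2 = x powr (2 - p) * x powr p" using x by (simp flip: powr_add)
    also have "\<dots> \<le> K powr (2 - p) * x powr p"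
      using that assms by (intro mult_right_mono powr_mono2') auto
    finally show ?thesis .
  qed
  moreover have "x\<^sup>2 \<le> K * x \<and> x\<^sup>2 \<le> K\<^sup>2" if "x \<le> K"
    using that assms by (auto simp: power2_eq_square intro!: mult_mono mult_right_mono)
  moreover have "0 \<le> K * x" "0 \<le> K\<^sup>2" "0 \<le> K powr (2 - p) * x powr p" using assms by auto
  ultimately have "x\<^sup>2 \<le> K * x + K powr (2 - p) * x powr p \<and> x\<^sup>2 \<le> K\<^sup>2 + K powr (2 - p) * x powr p"
    by linarith
  then show "x\<^sup>2 \<le> K * x + K powr (2 - p) * x powr p" "x\<^sup>2 \<le> K\<^sup>2 + K powr (2 - p) * x powr p"
    by blast+
qed

lemma norm_diff_powr_le:
  fixes a b :: "'b::real_normed_vector"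
  assumes "p > 0"
  shows "norm (a - b) powr p \<le> 2 powr p * norm a powr p + 2 powr p * norm b powr p"
proof -
  have "norm (a - b) \<le> 2 * max (norm a) (norm b)"
    using norm_triangle_ineq4[of a b] by auto
  then have "norm (a - b) powr p \<le> (2 * max (norm a) (norm b)) powr p"
    using assms by (intro powr_mono2) auto
  also have "\<dots> = 2 powr p * max (norm a) (norm b) powr p" by (intro powr_mult)
  also have "\<dots> \<le> 2 powr p * (norm a powr p + norm b powr p)"
    by (intro mult_left_mono) (auto simp: max_def)
  finally show ?thesis by (simp add: distrib_left)
qed

lemma nn_integral_linear3:
  assumes [measurable]: "f \<in> borel_measurable N" "g \<in> borel_measurable N" "u \<in> borel_measurable N"
  shows "(\<integral>\<^sup>+z. a * f z + b * g z + c * u z \<partial>N)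
    = a * (\<integral>\<^sup>+z. f z \<partial>N) + b * (\<integral>\<^sup>+z. g z \<partial>N) + c * (\<integral>\<^sup>+z. u z \<partial>N)"
proof -
  have "(\<integral>\<^sup>+z. a * f z + b * g z + c * u z \<partial>N) = (\<integral>\<^sup>+z. a * f z + b * g z \<partial>N) + (\<integral>\<^sup>+z. c * u z \<partial>N)"
    by (rule nn_integral_add; measurable)
  also have "(\<integral>\<^sup>+z. a * f z + b * g z \<partial>N) = (\<integral>\<^sup>+z. a * f z \<partial>N) + (\<integral>\<^sup>+z. b * g z \<partial>N)"
    by (rule nn_integral_add; measurable)
  finally show ?thesis by (simp only: nn_integral_cmult assms)
qed

text \<open>An \<open>L\<^sup>p\<close> bound upgrades smallness of the \<open>L\<^sup>1\<close> modulus of continuity to \<open>L\<^sup>2\<close>. The strips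
  of width \<open>h\<close> at the ends of the interval, where the zero extension jumps, are small by the same bound.\<close>

lemma translation_msq_bound:
  fixes \<Phi> :: "real \<Rightarrow> 'w \<Rightarrow> 'b::euclidean_space"
  assumes M: "prob_space M" and p: "p > 2" and K: "K > 0" and B: "B \<ge> 0" and h: "0 < h" "h < T"
    and \<Psi>m: "zero_extension T \<Phi> \<in> borel_measurable (M \<Otimes>\<^sub>M lborel)"
    and Lp: "(\<integral>\<^sup>+z. ennreal (norm (zero_extension T \<Phi> z) powr p) \<partial>(M \<Otimes>\<^sub>M lborel)) \<le> ennreal B"
    and L1: "(\<integral>\<^sup>+w. (\<integral>\<^sup>+t\<in>{h..T}. ennreal (norm (\<Phi> t w - \<Phi> (t - h) w)) \<partial>lborel) \<partial>M) \<le> ennreal \<epsilon>" and \<epsilon>: "\<epsilon> \<ge> 0"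
  shows "msq (M \<Otimes>\<^sub>M lborel) (\<lambda>(w, t). zero_extension T \<Phi> (w, t) - zero_extension T \<Phi> (w, t - h))
     \<le> ennreal (K * \<epsilon> + K\<^sup>2 * (2 * h) + K powr (2 - p) * (2 * 2 powr p * B))"
proof -
  interpret prob_space M by fact
  let ?\<Psi> = "zero_extension T \<Phi>"
  define D where "D z = ?\<Psi> z - ?\<Psi> (fst z, snd z - h)" for z
  have sh: "(\<lambda>z. ?\<Psi> (fst z, snd z - h)) \<in> borel_measurable (M \<Otimes>\<^sub>M lborel)"
    by (rule shift_compose_measurable[OF \<Psi>m])
  have Dm [measurable]: "D \<in> borel_measurable (M \<Otimes>\<^sub>M lborel)"
    unfolding D_def by (intro borel_measurable_diff \<Psi>m sh)
  let ?mid = "\<lambda>z. ennreal (norm (D z)) * indicator {h<..T} (snd z)"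
  let ?edge = "\<lambda>z. indicator ({0<..h} \<union> {T<..T + h}) (snd z) :: ennreal"
  let ?pw = "\<lambda>z. ennreal (norm (D z) powr p)"
  have "msq (M \<Otimes>\<^sub>M lborel) D \<le> (\<integral>\<^sup>+z. ennreal K * ?mid z + ennreal (K\<^sup>2) * ?edge z + ennreal (K powr (2 - p)) * ?pw z \<partial>(M \<Otimes>\<^sub>M lborel))"
    unfolding msq_def
  proof (rule nn_integral_mono)
    fix z :: "'w \<times> real"
    \<comment> \<open>Both times lie in \<open>(0,T]\<close>, exactly one does, or the difference
      vanishes. Only the first case is covered by the L1 modulus.\<close>
    consider "snd z \<in> {h<..T}" | "snd z \<in> {0<..h} \<union> {T<..T + h}" | "D z = 0"
      using h by (fastforce simp: D_def zero_extension_def split_beta' indicator_def)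
    then show "ennreal ((norm (D z))\<^sup>2) \<le> ennreal K * ?mid z + ennreal (K\<^sup>2) * ?edge z + ennreal (K powr (2 - p)) * ?pw z"
    proof cases
      case 1
      have "ennreal ((norm (D z))\<^sup>2) \<le> ennreal (K * norm (D z) + K powr (2 - p) * norm (D z) powr p)"
        using K p by (intro ennreal_leI square_le_linear_powr) auto
      also have "\<dots> = ennreal K * ennreal (norm (D z)) + ennreal (K powr (2 - p)) * ?pw z"
        using K by (simp add: ennreal_mult)
      finally show ?thesis using 1 by (auto simp: indicator_def intro: order_trans)
    next
      case 2
      have "ennreal ((norm (D z))\<^sup>2) \<le> ennreal (K\<^sup>2 + K powr (2 - p) * norm (D z) powr p)"
        using K p by (intro ennreal_leI square_le_linear_powr) auto
      also have "\<dots> = ennreal (K\<^sup>2) * 1 + ennreal (K powr (2 - p)) * ?pw z"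
        using K by (simp add: ennreal_mult)
      also have "\<dots> = ennreal (K\<^sup>2) * ?edge z + ennreal (K powr (2 - p)) * ?pw z" using 2 by simp
      also have "\<dots> \<le> ennreal K * ?mid z + (ennreal (K\<^sup>2) * ?edge z + ennreal (K powr (2 - p)) * ?pw z)" by simp
      finally show ?thesis by (simp only: add.assoc)
    qed simp
  qed
  also have "\<dots> = ennreal K * (\<integral>\<^sup>+z. ?mid z \<partial>(M \<Otimes>\<^sub>M lborel)) + ennreal (K\<^sup>2) * (\<integral>\<^sup>+z. ?edge z \<partial>(M \<Otimes>\<^sub>M lborel))
      + ennreal (K powr (2 - p)) * (\<integral>\<^sup>+z. ?pw z \<partial>(M \<Otimes>\<^sub>M lborel))"
    by (rule nn_integral_linear3; measurable)
  also have "\<dots> \<le> ennreal K * ennreal \<epsilon> + ennreal (K\<^sup>2) * ennreal (2 * h) + ennreal (K powr (2 - p)) * ennreal (2 * 2 powr p * B)"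
  proof (intro add_mono mult_left_mono)
    have "(\<integral>\<^sup>+z. ?mid z \<partial>(M \<Otimes>\<^sub>M lborel)) = (\<integral>\<^sup>+w. \<integral>\<^sup>+t. ennreal (norm (D (w, t))) * indicator {h<..T} t \<partial>lborel \<partial>M)"
      by (subst lborel.nn_integral_fst[symmetric]) auto
    also have "\<dots> \<le> (\<integral>\<^sup>+w. (\<integral>\<^sup>+t\<in>{h..T}. ennreal (norm (\<Phi> t w - \<Phi> (t - h) w)) \<partial>lborel) \<partial>M)"
      using h by (intro nn_integral_mono) (auto simp: D_def zero_extension_def indicator_def)
    finally show "(\<integral>\<^sup>+z. ?mid z \<partial>(M \<Otimes>\<^sub>M lborel)) \<le> ennreal \<epsilon>" using L1 by (rule order_trans)
    have "(\<integral>\<^sup>+z. ?edge z \<partial>(M \<Otimes>\<^sub>M lborel)) = (\<integral>\<^sup>+w. \<integral>\<^sup>+t. indicator ({0<..h} \<union> {T<..T + h}) t \<partial>lborel \<partial>M)"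
      by (subst lborel.nn_integral_fst[symmetric]) auto
    also have "\<dots> = emeasure lborel ({0<..h} \<union> {T<..T + h})" by (simp add: emeasure_space_1)
    also have "\<dots> \<le> emeasure lborel {0<..h} + emeasure lborel {T<..T + h}" by (rule emeasure_subadditive) auto
    also have "\<dots> = ennreal (2 * h)" using h by (simp flip: ennreal_plus)
    finally show "(\<integral>\<^sup>+z. ?edge z \<partial>(M \<Otimes>\<^sub>M lborel)) \<le> ennreal (2 * h)" .
    \<comment> \<open>The difference is split by \<open>norm_diff_powr_le\<close>; the translated
      copy has the same integral, so each copy contributes at most
      \<open>2 powr p * B\<close>.\<close>
    let ?q = "\<lambda>z. ennreal (norm (?\<Psi> z) powr p)"
    have qm: "?q \<in> borel_measurable (M \<Otimes>\<^sub>M lborel)"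
      by (rule measurable_compose[OF \<Psi>m]) measurable
    have "(\<integral>\<^sup>+z. ?pw z \<partial>(M \<Otimes>\<^sub>M lborel)) \<le> (\<integral>\<^sup>+z. ennreal (2 powr p) * ?q z + ennreal (2 powr p) * ?q (fst z, snd z - h) \<partial>(M \<Otimes>\<^sub>M lborel))"
    proof (rule nn_integral_mono)
      fix z
      show "?pw z \<le> ennreal (2 powr p) * ?q z + ennreal (2 powr p) * ?q (fst z, snd z - h)"
        using ennreal_leI[OF norm_diff_powr_le[of p "?\<Psi> z" "?\<Psi> (fst z, snd z - h)"]] p
        by (simp add: D_def ennreal_mult)
    qed
    also have "\<dots> = ennreal (2 powr p) * (\<integral>\<^sup>+z. ?q z \<partial>(M \<Otimes>\<^sub>M lborel)) + ennreal (2 powr p) * (\<integral>\<^sup>+z. ?q (fst z, snd z - h) \<partial>(M \<Otimes>\<^sub>M lborel))"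
      using qm shift_compose_measurable[OF qm, of h] by (simp add: nn_integral_add nn_integral_cmult)
    also have "\<dots> \<le> ennreal (2 powr p) * ennreal B + ennreal (2 powr p) * ennreal B"
      unfolding shift_nn_integral[OF M qm] by (intro add_mono mult_left_mono Lp) auto
    also have "\<dots> = ennreal (2 * 2 powr p * B)" using B by (simp add: ennreal_mult[symmetric] ennreal_plus[symmetric] del: ennreal_plus)
    finally show "(\<integral>\<^sup>+z. ?pw z \<partial>(M \<Otimes>\<^sub>M lborel)) \<le> ennreal (2 * 2 powr p * B)" .
  qed auto
  also have "\<dots> = ennreal (K * \<epsilon> + K\<^sup>2 * (2 * h) + K powr (2 - p) * (2 * 2 powr p * B))"
    using K \<epsilon> h B by (simp add: ennreal_mult[symmetric] ennreal_plus[symmetric] del: ennreal_plus)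
  finally have *: "msq (M \<Otimes>\<^sub>M lborel) D \<le> ennreal (K * \<epsilon> + K\<^sup>2 * (2 * h) + K powr (2 - p) * (2 * 2 powr p * B))" .
  have "(\<lambda>(w, t). ?\<Psi> (w, t) - ?\<Psi> (w, t - h)) = D" by (auto simp: D_def fun_eq_iff)
  with * show ?thesis by (simp only:)
qed

text \<open>The split of \<open>square_le_linear_powr\<close> at \<open>K = 1\<close>; the constant
  \<open>1\<close> is integrated only over \<open>(0,T]\<close>, where the extension lives.\<close>

lemma zero_extension_msq_le:
  fixes \<Phi> :: "real \<Rightarrow> 'w \<Rightarrow> 'b::euclidean_space"
  assumes M: "prob_space M" and p: "p > 2" and T: "T \<ge> 0" and B: "B \<ge> 0"
    and \<Psi>m: "zero_extension T \<Phi> \<in> borel_measurable (M \<Otimes>\<^sub>M lborel)"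
    and Lp: "(\<integral>\<^sup>+z. ennreal (norm (zero_extension T \<Phi> z) powr p) \<partial>(M \<Otimes>\<^sub>M lborel)) \<le> ennreal B"
  shows "msq (M \<Otimes>\<^sub>M lborel) (zero_extension T \<Phi>) \<le> ennreal (T + B)"
proof -
  interpret prob_space M by fact
  let ?\<Psi> = "zero_extension T \<Phi>"
  have "msq (M \<Otimes>\<^sub>M lborel) ?\<Psi> \<le> (\<integral>\<^sup>+z. indicator {0<..T} (snd z) + ennreal (norm (?\<Psi> z) powr p) \<partial>(M \<Otimes>\<^sub>M lborel))"
    unfolding msq_def
  proof (rule nn_integral_mono)
    fix z :: "'w \<times> real"
    have "ennreal ((norm (?\<Psi> z))\<^sup>2) \<le> ennreal (1 + norm (?\<Psi> z) powr p)"
      using p square_le_linear_powr(2)[of "norm (?\<Psi> z)" 1 p] by (intro ennreal_leI) auto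
    then show "ennreal ((norm (?\<Psi> z))\<^sup>2) \<le> indicator {0<..T} (snd z) + ennreal (norm (?\<Psi> z) powr p)"
      by (cases "snd z \<in> {0<..T}") (auto simp: zero_extension_def split_beta')
  qed
  also have "\<dots> = (\<integral>\<^sup>+z. indicator {0<..T} (snd z) \<partial>(M \<Otimes>\<^sub>M lborel)) + (\<integral>\<^sup>+z. ennreal (norm (?\<Psi> z) powr p) \<partial>(M \<Otimes>\<^sub>M lborel))"
    using measurable_compose[OF \<Psi>m, of "\<lambda>x. ennreal (norm x powr p)" borel] by (intro nn_integral_add) auto
  also have "(\<integral>\<^sup>+z. indicator {0<..T} (snd z) \<partial>(M \<Otimes>\<^sub>M lborel)) = (\<integral>\<^sup>+w. \<integral>\<^sup>+t. indicator {0<..T} t \<partial>lborel \<partial>M)"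
    by (subst lborel.nn_integral_fst[symmetric]) auto
  also have "\<dots> = ennreal T" using T by (simp add: emeasure_space_1)
  also have "ennreal T + (\<integral>\<^sup>+z. ennreal (norm (?\<Psi> z) powr p) \<partial>(M \<Otimes>\<^sub>M lborel)) \<le> ennreal T + ennreal B"
    by (intro add_left_mono Lp)
  finally show ?thesis using T B by simp
qed

section \<open>Tools for products of weakly and strongly convergent factors\<close>

text \<open>By the parallelogram law the squared norms of \<open>f n + g\<close> and
  \<open>f n - g\<close> have the constant total \<open>4 * msq M g\<close>. Fatou bounds the sum
  part from below by that total, which squeezes the difference part to zero. Wiener increments
  satisfy \<open>eq\<close> because their second moment depends on the two times alone.\<close>

lemma msq_tendsto_of_norm_eq:
  fixes f :: "nat \<Rightarrow> 'a \<Rightarrow> 'b::euclidean_space"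
  assumes f: "\<And>n. f n \<in> Lp M 2" and g: "g \<in> Lp M 2" and eq: "\<And>n. msq M (f n) = msq M g"
    and lim: "AE x in M. (\<lambda>n. f n x) \<longlonglongrightarrow> g x"
  shows "(\<lambda>n. msq M (\<lambda>x. f n x - g x)) \<longlonglongrightarrow> 0"
proof -
  have fm [measurable]: "f n \<in> borel_measurable M" for n by (rule Lp2_measurable[OF f])
  have gm [measurable]: "g \<in> borel_measurable M" by (rule Lp2_measurable[OF g])
  let ?s = "\<lambda>n. msq M (\<lambda>x. f n x + g x)" and ?d = "\<lambda>n. msq M (\<lambda>x. f n x - g x)"
  let ?c = "4 * msq M g"
  have par: "?s n + ?d n = ?c" for n
  proof -
    have "?s n + ?d n = (\<integral>\<^sup>+x. ennreal ((norm (f n x + g x))\<^sup>2) + ennreal ((norm (f n x - g x))\<^sup>2) \<partial>M)"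
      unfolding msq_def by (rule nn_integral_add[symmetric]) auto
    also have "\<dots> = (\<integral>\<^sup>+x. 2 * ennreal ((norm (f n x))\<^sup>2) + 2 * ennreal ((norm (g x))\<^sup>2) \<partial>M)"
    proof (rule nn_integral_cong)
      fix x
      have "(norm (f n x + g x))\<^sup>2 + (norm (f n x - g x))\<^sup>2 = 2 * (norm (f n x))\<^sup>2 + 2 * (norm (g x))\<^sup>2"
        by (simp only: power2_norm_eq_inner, simp add: inner_add_left inner_add_right inner_diff_left inner_diff_right)
      then have "ennreal ((norm (f n x + g x))\<^sup>2 + (norm (f n x - g x))\<^sup>2) = ennreal (2 * (norm (f n x))\<^sup>2 + 2 * (norm (g x))\<^sup>2)"
        by simp
      then show "ennreal ((norm (f n x + g x))\<^sup>2) + ennreal ((norm (f n x - g x))\<^sup>2) = 2 * ennreal ((norm (f n x))\<^sup>2) + 2 * ennreal ((norm (g x))\<^sup>2)"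
        by (simp add: ennreal_mult)
    qed
    also have "\<dots> = 2 * msq M (f n) + 2 * msq M g"
      unfolding msq_def by (simp add: nn_integral_add nn_integral_cmult)
    also have "\<dots> = ?c" by (simp add: eq flip: distrib_right)
    finally show ?thesis .
  qed
  have c_fin: "?c < \<infinity>" using g by (simp add: Lp2_iff ennreal_mult_less_top)
  have "?c = msq M (\<lambda>x. 2 *\<^sub>R g x)" by (simp add: msq_scaleR)
  also have "\<dots> = (\<integral>\<^sup>+x. liminf (\<lambda>n. ennreal ((norm (f n x + g x))\<^sup>2)) \<partial>M)"
    unfolding msq_def
  proof (rule nn_integral_cong_AE, use lim in eventually_elim)
    case (elim x)
    have "(\<lambda>n. ennreal ((norm (f n x + g x))\<^sup>2)) \<longlonglongrightarrow> ennreal ((norm (g x + g x))\<^sup>2)"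
      by (intro tendsto_ennrealI tendsto_power tendsto_norm tendsto_add elim tendsto_const)
    then show ?case by (simp add: tendsto_iff_Liminf_eq_Limsup scaleR_2)
  qed
  also have "\<dots> \<le> liminf ?s" unfolding msq_def by (rule nn_integral_liminf) auto
  finally have lo: "?c \<le> liminf ?s" .
  have "?s n \<le> ?c" for n using par[of n] by (metis le_iff_add)
  then have hi: "limsup ?s \<le> ?c" by (intro Limsup_bounded) auto
  have mid: "liminf ?s \<le> limsup ?s" by (rule Liminf_le_Limsup) simp
  have "liminf ?s = ?c" using lo mid hi by (intro antisym) (rule order_trans)
  moreover have "limsup ?s = ?c" by (rule antisym[OF hi order_trans[OF lo mid]])
  ultimately have "?s \<longlonglongrightarrow> ?c" by (simp add: tendsto_iff_Liminf_eq_Limsup)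
  then have "(\<lambda>n. ?c - ?s n) \<longlonglongrightarrow> ?c - ?c"
    using c_fin by (intro tendsto_diff_ennreal_general tendsto_const) auto
  moreover have "?c - ?s n = ?d n" for n
  proof -
    have "?s n \<le> ?c" using par[of n] by (metis le_iff_add)
    then have "?s n \<noteq> top" using c_fin by auto
    then show ?thesis unfolding par[of n, symmetric] by (rule ennreal_add_diff_cancel_left)
  qed
  moreover have "?c - ?c = 0" using c_fin ennreal_add_diff_cancel_left[of ?c 0] by simp
  ultimately show ?thesis by simp
qed

text \<open>The rank-one matrix \<open>y x\<^sup>T\<close>. By \<open>inner_outer\<close> it puts
  increment and test vector on one side of the inner product and leaves the matrix coefficient, the
  weakly convergent factor, alone on the other.\<close>

definition outer :: "real^'m \<Rightarrow> real^'k \<Rightarrow> real^'k^'m" where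
  "outer y x = (\<chi> i j. y $ i * x $ j)"

lemma inner_outer: "A \<bullet> outer y x = (A *v x) \<bullet> y"
  by (simp add: inner_vec_def outer_def matrix_vector_mult_def sum_distrib_left sum_distrib_right mult_ac)

lemma norm_outer: "norm (outer y x) = norm y * norm x"
proof -
  have "outer y x \<bullet> outer y x = (\<Sum>i\<in>UNIV. \<Sum>j\<in>UNIV. (y $ i * y $ i) * (x $ j * x $ j))"
    by (simp add: inner_vec_def outer_def mult_ac)
  also have "\<dots> = (y \<bullet> y) * (x \<bullet> x)" by (simp add: sum_product inner_vec_def)
  finally have "(norm (outer y x))\<^sup>2 = (norm y * norm x)\<^sup>2"
    by (simp only: power2_norm_eq_inner power_mult_distrib)
  then show ?thesis by simp
qed

lemma outer_measurable:
  assumes "f \<in> borel_measurable M" "g \<in> borel_measurable M"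
  shows "(\<lambda>w. outer (f w) (g w)) \<in> borel_measurable M"
proof (rule borel_measurable_continuous_Pair[OF assms])
  show "continuous_on UNIV (\<lambda>p. outer (fst p) (snd p))"
    unfolding outer_def by (intro continuous_intros)
qed

lemma outer_diff: "outer y (a - b) = outer y a - outer y b"
  by (simp add: outer_def vec_eq_iff right_diff_distrib)

lemma outer_Lp2:
  assumes Y: "Y \<in> borel_measurable M" "\<And>w. norm (Y w) \<le> c" and X: "X \<in> Lp M 2"
  shows "(\<lambda>w. outer (Y w) (X w)) \<in> Lp M 2" "msq M (\<lambda>w. outer (Y w) (X w)) \<le> ennreal (c\<^sup>2) * msq M X"
proof -
  have c: "c \<ge> 0" using order_trans[OF norm_ge_zero Y(2)] by blast
  have "msq M (\<lambda>w. outer (Y w) (X w)) \<le> msq M (\<lambda>w. c *\<^sub>R X w)"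
    using Y(2) c by (intro msq_mono) (simp add: norm_outer mult_right_mono)
  also have "\<dots> = ennreal (c\<^sup>2) * msq M X"
    using X by (intro msq_scaleR Lp2_measurable)
  finally show *: "msq M (\<lambda>w. outer (Y w) (X w)) \<le> ennreal (c\<^sup>2) * msq M X" .
  show "(\<lambda>w. outer (Y w) (X w)) \<in> Lp M 2"
    unfolding Lp2_iff using outer_measurable[OF Y(1) Lp2_measurable[OF X]] le_less_trans[OF *] X
    by (auto simp: Lp2_iff ennreal_mult_less_top)
qed

lemma Lp_norm2_tendsto_0:
  assumes "\<And>n. f n \<in> Lp M 2" "(\<lambda>n. msq M (f n)) \<longlonglongrightarrow> 0"
  shows "(\<lambda>n. Lp_norm M 2 (f n)) \<longlonglongrightarrow> 0"
proof -
  have "Lp_converges M 2 f (\<lambda>x. 0)" unfolding Lp_converges2 using assms by (simp add: Lp2_zero)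
  then show ?thesis by (simp add: Lp_converges_def)
qed

section \<open>Weak limits of stochastic integrals after the space variable is integrated
  out\<close>

text \<open>Weak convergence enters through bounded tests in sample and time, which weak convergence
  in \<open>L\<^sup>r\<close> supplies for every \<open>r \<ge> 1\<close>. The moment bound and the
  modulus concern the sequence; the limit acquires its L2 bounds by weak lower
  semicontinuity.\<close>

locale ito_convergence = prob_space M for M :: "'w measure" +
  fixes T p B :: real
    and Fn :: "nat \<Rightarrow> real \<Rightarrow> 'w measure" and F :: "real \<Rightarrow> 'w measure"
    and Wn :: "nat \<Rightarrow> real \<Rightarrow> 'w \<Rightarrow> real^'k" and W :: "real \<Rightarrow> 'w \<Rightarrow> real^'k"
    and \<Phi>n :: "nat \<Rightarrow> real \<Rightarrow> 'w \<Rightarrow> real^'k^'m" and \<Phi> :: "real \<Rightarrow> 'w \<Rightarrow> real^'k^'m"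
  assumes T: "T > 0" and p: "p > 2" and B: "B \<ge> 0"
    and bn: "\<And>n. brownian M T (Fn n) (Wn n)" and b: "brownian M T F W"
    and \<Phi>n_meas: "\<And>n. (\<lambda>(w, s). \<Phi>n n s w) \<in> borel_measurable (M \<Otimes>\<^sub>M time_measure T)"
    and \<Phi>_meas: "(\<lambda>(w, s). \<Phi> s w) \<in> borel_measurable (M \<Otimes>\<^sub>M time_measure T)"
    and \<Phi>n_prog: "\<And>n. progressive T (Fn n) (zero_extension T (\<Phi>n n))"
    and \<Phi>_prog: "progressive T F (zero_extension T \<Phi>)"
    and Lp_bound: "\<And>n. (\<integral>\<^sup>+z. ennreal (norm (zero_extension T (\<Phi>n n) z) powr p) \<partial>(M \<Otimes>\<^sub>M lborel)) \<le> ennreal B"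
    and L1_modulus: "\<And>\<epsilon>. \<epsilon> > 0 \<Longrightarrow> \<forall>\<^sub>F h in at_right 0. \<forall>n.
        (\<integral>\<^sup>+w. (\<integral>\<^sup>+t\<in>{h..T}. ennreal (norm (\<Phi>n n t w - \<Phi>n n (t - h) w)) \<partial>lborel) \<partial>M) \<le> ennreal \<epsilon>"
    and weak: "\<And>Y c. Y \<in> borel_measurable (M \<Otimes>\<^sub>M lborel) \<Longrightarrow> (\<And>z. norm (Y z) \<le> c) \<Longrightarrow>
        (\<lambda>n. \<integral>z. zero_extension T (\<Phi>n n) z \<bullet> Y z \<partial>(M \<Otimes>\<^sub>M lborel)) \<longlonglongrightarrow> (\<integral>z. zero_extension T \<Phi> z \<bullet> Y z \<partial>(M \<Otimes>\<^sub>M lborel))"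
    and noise: "AE w in M. uniform_limit {0..T} (\<lambda>n t. Wn n t w) (\<lambda>t. W t w) sequentially"
begin

abbreviation \<Psi>n where "\<Psi>n n \<equiv> zero_extension T (\<Phi>n n)"
abbreviation \<Psi> where "\<Psi> \<equiv> zero_extension T \<Phi>"

definition shift_diff :: "real \<Rightarrow> ('w \<times> real \<Rightarrow> real^'k^'m) \<Rightarrow> 'w \<times> real \<Rightarrow> real^'k^'m" where
  "shift_diff h f = (\<lambda>(w, t). f (w, t) - f (w, t - h))"

lemma \<Psi>n_meas: "\<Psi>n n \<in> borel_measurable (M \<Otimes>\<^sub>M lborel)"
  using time_extension_measurable[OF less_imp_le[OF T] \<Phi>n_meas[of n]] by (simp add: zero_extension_def split_beta')

lemma \<Psi>_meas: "\<Psi> \<in> borel_measurable (M \<Otimes>\<^sub>M lborel)"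
  using time_extension_measurable[OF less_imp_le[OF T] \<Phi>_meas] by (simp add: zero_extension_def split_beta')

lemma \<Psi>n_msq: "msq (M \<Otimes>\<^sub>M lborel) (\<Psi>n n) \<le> ennreal (T + B)"
  by (intro zero_extension_msq_le[OF prob_space_axioms p less_imp_le[OF T] B \<Psi>n_meas Lp_bound])

lemma \<Psi>n_L2: "\<Psi>n n \<in> Lp (M \<Otimes>\<^sub>M lborel) 2"
  unfolding Lp2_iff using \<Psi>n_meas le_less_trans[OF \<Psi>n_msq] by auto

text \<open>The order of choices matters: \<open>K\<close> is fixed by the Lp bound, the L1
  tolerance \<open>\<epsilon>\<close> by \<open>K\<close>, and the range of \<open>h\<close> by
  both. None of them involves \<open>n\<close>.\<close>

lemma uniform_modulus:
  assumes e: "e > 0"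
  obtains d where "d > 0" "\<And>h n. 0 < h \<Longrightarrow> h < d \<Longrightarrow> msq (M \<Otimes>\<^sub>M lborel) (shift_diff h (\<Psi>n n)) \<le> ennreal e"
proof -
  define c where "c = 2 * 2 powr p * B"
  have c: "c \<ge> 0" using B by (simp add: c_def)
  have "((\<lambda>K. K powr (2 - p) * c) \<longlongrightarrow> 0 * c) at_top"
    using p by (intro tendsto_mult tendsto_const tendsto_neg_powr filterlim_ident) auto
  then have "\<forall>\<^sub>F K in at_top. K powr (2 - p) * c < e / 3"
    using e by (intro order_tendstoD(2)) auto
  with eventually_gt_at_top[of "0::real"] have "\<forall>\<^sub>F K in at_top. K > 0 \<and> K powr (2 - p) * c < e / 3"
    by eventually_elim auto
  then obtain K where "\<And>L. L \<ge> K \<Longrightarrow> L > 0 \<and> L powr (2 - p) * c < e / 3"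
    by (auto simp: eventually_at_top_linorder)
  from this[of K] have K: "K > 0" "K powr (2 - p) * c < e / 3" by auto
  define \<epsilon> where "\<epsilon> = e / (3 * K)"
  have \<epsilon>: "\<epsilon> > 0" "K * \<epsilon> = e / 3" using e K by (auto simp: \<epsilon>_def)
  obtain d0 where d0: "d0 > 0" "\<And>h n. 0 < h \<Longrightarrow> h < d0 \<Longrightarrow>
      (\<integral>\<^sup>+w. (\<integral>\<^sup>+t\<in>{h..T}. ennreal (norm (\<Phi>n n t w - \<Phi>n n (t - h) w)) \<partial>lborel) \<partial>M) \<le> ennreal \<epsilon>"
    using L1_modulus[OF \<epsilon>(1)] unfolding eventually_at_right_field by auto
  \<comment> \<open>\<open>T\<close> enters because \<open>translation_msq_bound\<close> asks for
    \<open>h < T\<close>; the last entry makes the edge term \<open>K\<^sup>2 * (2 * h)\<close> at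
    most \<open>e/3\<close>.\<close>
  define d where "d = min (min d0 T) (e / (6 * K\<^sup>2))"
  show ?thesis
  proof (rule that)
    show "d > 0" using d0 T e K by (auto simp: d_def)
    fix h n assume h: "0 < h" "h < d"
    have "h \<le> e / (6 * K\<^sup>2)" using h by (simp add: d_def)
    then have "K\<^sup>2 * (2 * h) \<le> e / 3" using K by (simp add: field_simps)
    then have le: "K * \<epsilon> + K\<^sup>2 * (2 * h) + K powr (2 - p) * c \<le> e" using K \<epsilon> by linarith
    have "msq (M \<Otimes>\<^sub>M lborel) (shift_diff h (\<Psi>n n)) \<le> ennreal (K * \<epsilon> + K\<^sup>2 * (2 * h) + K powr (2 - p) * c)"
      unfolding shift_diff_def c_def
      using h by (intro translation_msq_bound[OF prob_space_axioms p K(1) B _ _ \<Psi>n_meas Lp_bound d0(2)] less_imp_le[OF \<epsilon>(1)])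
         (auto simp: d_def)
    also have "\<dots> \<le> ennreal e" by (intro ennreal_leI le)
    finally show "msq (M \<Otimes>\<^sub>M lborel) (shift_diff h (\<Psi>n n)) \<le> ennreal e" .
  qed
qed

lemma regular_n: "regular_integrand M T (Fn n) (\<Phi>n n)"
  unfolding regular_integrand_def
proof (intro conjI allI impI \<Phi>n_meas \<Phi>n_prog \<Psi>n_L2)
  fix e :: real assume e: "e > 0"
  obtain d where "d > 0" "\<And>h n. 0 < h \<Longrightarrow> h < d \<Longrightarrow> msq (M \<Otimes>\<^sub>M lborel) (shift_diff h (\<Psi>n n)) \<le> ennreal e"
    by (rule uniform_modulus[OF e]) blast
  then show "\<exists>d>0. \<forall>h. 0 < h \<and> h < d \<longrightarrow> msq (M \<Otimes>\<^sub>M lborel) (\<lambda>(w, t). \<Psi>n n (w, t) - \<Psi>n n (w, t - h)) \<le> ennreal e"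
    unfolding shift_diff_def by blast
qed

lemma strip_measurable: "space M \<times> {0<..S} \<in> sets (M \<Otimes>\<^sub>M (lborel :: real measure))"
  by (intro pair_measureI) auto

lemma strip_finite: "emeasure (M \<Otimes>\<^sub>M lborel) (space M \<times> {0<..S}) < \<infinity>" if "S \<ge> 0" for S :: real
  using that by (subst lborel.emeasure_pair_measure_Times) (auto simp: emeasure_space_1)

lemma \<Psi>_msq: "msq (M \<Otimes>\<^sub>M lborel) \<Psi> \<le> ennreal (T + B)"
proof (rule msq_weak_lower_bound[OF \<Psi>_meas strip_measurable strip_finite _ \<Psi>n_L2])
  show "\<Psi> x = 0" if "x \<in> space (M \<Otimes>\<^sub>M lborel)" "x \<notin> space M \<times> {0<..T}" for x
    using that by (auto simp: zero_extension_def space_pair_measure indicator_def split_beta')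
  show "(\<lambda>n. \<integral>x. \<Psi>n n x \<bullet> Y x \<partial>(M \<Otimes>\<^sub>M lborel)) \<longlonglongrightarrow> (\<integral>x. \<Psi> x \<bullet> Y x \<partial>(M \<Otimes>\<^sub>M lborel))"
    if "Y \<in> borel_measurable (M \<Otimes>\<^sub>M lborel)" "\<And>x. norm (Y x) \<le> c" for Y c
    using that by (rule weak)
qed (use \<Psi>n_msq T B in auto)

lemma \<Psi>_L2: "\<Psi> \<in> Lp (M \<Otimes>\<^sub>M lborel) 2"
  unfolding Lp2_iff using \<Psi>_meas le_less_trans[OF \<Psi>_msq] by auto

lemma shift_diff_meas:
  assumes "f \<in> borel_measurable (M \<Otimes>\<^sub>M lborel)"
  shows "shift_diff h f \<in> borel_measurable (M \<Otimes>\<^sub>M lborel)"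
proof -
  have "shift_diff h f = (\<lambda>z. f z - f (fst z, snd z - h))" by (auto simp: shift_diff_def fun_eq_iff)
  then show ?thesis using assms shift_compose_measurable[OF assms, of h] by simp
qed

text \<open>A bounded test need not be square-integrable over infinite time. Multiplied by the
  indicator of the strip that carries \<open>f\<close> it is, and the inner product does not
  change.\<close>

lemma integrable_strip_inner:
  assumes f: "f \<in> Lp (M \<Otimes>\<^sub>M lborel) 2" and f0: "\<And>z. z \<notin> space M \<times> {0<..S} \<Longrightarrow> z \<in> space (M \<Otimes>\<^sub>M lborel) \<Longrightarrow> f z = 0"
    and S: "S \<ge> (0::real)" and Y: "Y \<in> borel_measurable (M \<Otimes>\<^sub>M lborel)" "\<And>z. norm (Y z) \<le> c"
  shows "integrable (M \<Otimes>\<^sub>M lborel) (\<lambda>z. f z \<bullet> Y z)"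
proof -
  let ?A = "space M \<times> {0<..S}"
  have "(\<lambda>z. indicator ?A z *\<^sub>R Y z) \<in> Lp (M \<Otimes>\<^sub>M lborel) 2"
  proof -
    have "msq (M \<Otimes>\<^sub>M lborel) (\<lambda>z. indicator ?A z *\<^sub>R Y z) \<le> (\<integral>\<^sup>+z. ennreal (c\<^sup>2) * indicator ?A z \<partial>(M \<Otimes>\<^sub>M lborel))"
      unfolding msq_def using Y(2) by (intro nn_integral_mono) (auto simp: indicator_def intro!: ennreal_leI power_mono)
    also have "\<dots> < \<infinity>"
      using strip_finite[OF S] strip_measurable by (simp add: nn_integral_cmult_indicator ennreal_mult_less_top)
    finally show ?thesis
      using Y(1) strip_measurable by (simp add: Lp2_iff)
  qed
  from Lp2_integrable_inner[OF f this]
  have "integrable (M \<Otimes>\<^sub>M lborel) (\<lambda>z. f z \<bullet> (indicator ?A z *\<^sub>R Y z))" .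
  also have "?this \<longleftrightarrow> integrable (M \<Otimes>\<^sub>M lborel) (\<lambda>z. f z \<bullet> Y z)"
  proof (rule Bochner_Integration.integrable_cong[OF refl])
    fix z assume "z \<in> space (M \<Otimes>\<^sub>M (lborel :: real measure))"
    then show "f z \<bullet> (indicator ?A z *\<^sub>R Y z) = f z \<bullet> Y z"
      using f0[of z] by (cases "z \<in> ?A") auto
  qed
  finally show ?thesis .
qed

lemma zero_extension_strip: "z \<notin> space M \<times> {0<..T} \<Longrightarrow> z \<in> space (M \<Otimes>\<^sub>M lborel) \<Longrightarrow> zero_extension T f z = 0"
  by (cases z) (auto simp: zero_extension_def space_pair_measure indicator_def)

text \<open>Discrete integration by parts: translation invariance moves the time difference, with
  opposite shift, onto the test function.\<close>

lemma shift_diff_inner: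
  assumes f: "f \<in> Lp (M \<Otimes>\<^sub>M lborel) 2" and f0: "\<And>z. z \<notin> space M \<times> {0<..T} \<Longrightarrow> z \<in> space (M \<Otimes>\<^sub>M lborel) \<Longrightarrow> f z = 0"
    and Y: "Y \<in> borel_measurable (M \<Otimes>\<^sub>M lborel)" "\<And>z. norm (Y z) \<le> c"
  shows "(\<integral>z. shift_diff h f z \<bullet> Y z \<partial>(M \<Otimes>\<^sub>M lborel)) = (\<integral>z. f z \<bullet> (Y z - Y (fst z, snd z + h)) \<partial>(M \<Otimes>\<^sub>M lborel))"
proof -
  have fm: "f \<in> borel_measurable (M \<Otimes>\<^sub>M lborel)" by (rule Lp2_measurable[OF f])
  have T0: "T \<ge> 0" using T by simp
  let ?Y' = "\<lambda>z. Y (fst z, snd z + h)"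
  have Y'm: "?Y' \<in> borel_measurable (M \<Otimes>\<^sub>M lborel)"
    using shift_compose_measurable[OF Y(1), of "- h"] by simp
  have i1: "integrable (M \<Otimes>\<^sub>M lborel) (\<lambda>z. f z \<bullet> Y z)"
    by (rule integrable_strip_inner[OF f f0 T0 Y])
  have i2: "integrable (M \<Otimes>\<^sub>M lborel) (\<lambda>z. f z \<bullet> ?Y' z)"
    by (rule integrable_strip_inner[OF f f0 T0 Y'm]) (use Y(2) in auto)
  let ?g = "\<lambda>z. f z \<bullet> ?Y' z"
  have gm: "?g \<in> borel_measurable (M \<Otimes>\<^sub>M lborel)" using i2 by auto
  have "integrable (distr (M \<Otimes>\<^sub>M lborel) (M \<Otimes>\<^sub>M lborel) (\<lambda>(w, t). (w, t - h))) ?g"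
    unfolding shift_distr[OF prob_space_axioms] by (rule i2)
  then have "integrable (M \<Otimes>\<^sub>M lborel) (\<lambda>z. ?g (case z of (w, t) \<Rightarrow> (w, t - h)))"
    by (subst (asm) integrable_distr_eq[OF shift_measurable gm])
  then have i3: "integrable (M \<Otimes>\<^sub>M lborel) (\<lambda>z. f (fst z, snd z - h) \<bullet> Y z)"
    by (simp add: split_beta)
  have "(\<integral>z. shift_diff h f z \<bullet> Y z \<partial>(M \<Otimes>\<^sub>M lborel)) = (\<integral>z. f z \<bullet> Y z - f (fst z, snd z - h) \<bullet> Y z \<partial>(M \<Otimes>\<^sub>M lborel))"
    by (intro Bochner_Integration.integral_cong refl) (simp add: shift_diff_def split_beta inner_diff_left)
  also have "\<dots> = (\<integral>z. f z \<bullet> Y z \<partial>(M \<Otimes>\<^sub>M lborel)) - (\<integral>z. f (fst z, snd z - h) \<bullet> Y z \<partial>(M \<Otimes>\<^sub>M lborel))"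
    by (rule Bochner_Integration.integral_diff[OF i1 i3])
  also have "(\<integral>z. f (fst z, snd z - h) \<bullet> Y z \<partial>(M \<Otimes>\<^sub>M lborel)) = (\<integral>z. f z \<bullet> ?Y' z \<partial>(M \<Otimes>\<^sub>M lborel))"
    using shift_integral[OF prob_space_axioms gm, of h] by simp
  also have "(\<integral>z. f z \<bullet> Y z \<partial>(M \<Otimes>\<^sub>M lborel)) - (\<integral>z. f z \<bullet> ?Y' z \<partial>(M \<Otimes>\<^sub>M lborel)) = (\<integral>z. f z \<bullet> (Y z - ?Y' z) \<partial>(M \<Otimes>\<^sub>M lborel))"
    by (simp add: inner_diff_right Bochner_Integration.integral_diff[OF i1 i2])
  finally show ?thesis .
qed

lemma shift_diff_L2:
  assumes f: "f \<in> Lp (M \<Otimes>\<^sub>M lborel) 2"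
  shows "shift_diff h f \<in> Lp (M \<Otimes>\<^sub>M lborel) 2"
proof -
  have fm: "f \<in> borel_measurable (M \<Otimes>\<^sub>M lborel)" by (rule Lp2_measurable[OF f])
  have "msq (M \<Otimes>\<^sub>M lborel) (\<lambda>z. f (fst z, snd z - h)) = msq (M \<Otimes>\<^sub>M lborel) f"
    unfolding msq_def
    by (rule shift_nn_integral[OF prob_space_axioms]) (rule measurable_compose[OF fm], measurable)
  then have "(\<lambda>z. f (fst z, snd z - h)) \<in> Lp (M \<Otimes>\<^sub>M lborel) 2"
    using f shift_compose_measurable[OF fm, of h] by (simp add: Lp2_iff)
  moreover have "shift_diff h f = (\<lambda>z. f z - f (fst z, snd z - h))" by (auto simp: shift_diff_def fun_eq_iff)
  ultimately show ?thesis using Lp2_diff[OF f] by simp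
qed

text \<open>By \<open>shift_diff_inner\<close> a bounded test of the time difference is a test of
  the process itself by a function bounded by \<open>2 * c\<close>. Hence the differences converge
  weakly as well and \<open>msq_weak_lower_bound\<close> applies; their support reaches up to
  \<open>T + h\<close>.\<close>

lemma limit_modulus:
  assumes h: "h > 0" and e: "e \<ge> 0" and bd: "\<And>n. msq (M \<Otimes>\<^sub>M lborel) (shift_diff h (\<Psi>n n)) \<le> ennreal e"
  shows "msq (M \<Otimes>\<^sub>M lborel) (shift_diff h \<Psi>) \<le> ennreal e"
proof (rule msq_weak_lower_bound[OF shift_diff_meas[OF \<Psi>_meas] strip_measurable[of "T + h"] strip_finite _ shift_diff_L2[OF \<Psi>n_L2]])
  show "T + h \<ge> 0" using T h by simp
  show "shift_diff h \<Psi> x = 0" if "x \<in> space (M \<Otimes>\<^sub>M lborel)" "x \<notin> space M \<times> {0<..T + h}" for x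
    using that h by (auto simp: shift_diff_def zero_extension_def space_pair_measure indicator_def split_beta')
  show "(\<lambda>n. \<integral>x. shift_diff h (\<Psi>n n) x \<bullet> Y x \<partial>(M \<Otimes>\<^sub>M lborel)) \<longlonglongrightarrow> (\<integral>x. shift_diff h \<Psi> x \<bullet> Y x \<partial>(M \<Otimes>\<^sub>M lborel))"
    if Y: "Y \<in> borel_measurable (M \<Otimes>\<^sub>M lborel)" "\<And>x. norm (Y x) \<le> c" for Y c
  proof -
    have "(\<lambda>z. Y z - Y (fst z, snd z + h)) \<in> borel_measurable (M \<Otimes>\<^sub>M lborel)"
      using shift_compose_measurable[OF Y(1), of "- h"] Y(1) by simp
    moreover have "norm (Y z - Y (fst z, snd z + h)) \<le> 2 * c" for z
      using norm_triangle_ineq4[of "Y z" "Y (fst z, snd z + h)"] Y(2)[of z] Y(2)[of "(fst z, snd z + h)"] by linarith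
    ultimately have lim: "(\<lambda>n. \<integral>z. \<Psi>n n z \<bullet> (Y z - Y (fst z, snd z + h)) \<partial>(M \<Otimes>\<^sub>M lborel))
        \<longlonglongrightarrow> (\<integral>z. \<Psi> z \<bullet> (Y z - Y (fst z, snd z + h)) \<partial>(M \<Otimes>\<^sub>M lborel))"
      by (rule weak)
    have "(\<integral>z. shift_diff h (\<Psi>n n) z \<bullet> Y z \<partial>(M \<Otimes>\<^sub>M lborel)) = (\<integral>z. \<Psi>n n z \<bullet> (Y z - Y (fst z, snd z + h)) \<partial>(M \<Otimes>\<^sub>M lborel))" for n
      by (rule shift_diff_inner[OF \<Psi>n_L2 zero_extension_strip Y])
    moreover have "(\<integral>z. shift_diff h \<Psi> z \<bullet> Y z \<partial>(M \<Otimes>\<^sub>M lborel)) = (\<integral>z. \<Psi> z \<bullet> (Y z - Y (fst z, snd z + h)) \<partial>(M \<Otimes>\<^sub>M lborel))"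
      by (rule shift_diff_inner[OF \<Psi>_L2 zero_extension_strip Y])
    ultimately show ?thesis using lim by (simp only:)
  qed
qed (use bd e in auto)

lemma regular_limit: "regular_integrand M T F \<Phi>"
  unfolding regular_integrand_def
proof (intro conjI allI impI \<Phi>_meas \<Phi>_prog \<Psi>_L2)
  fix e :: real assume e: "e > 0"
  obtain d where d: "d > 0" "\<And>h n. 0 < h \<Longrightarrow> h < d \<Longrightarrow> msq (M \<Otimes>\<^sub>M lborel) (shift_diff h (\<Psi>n n)) \<le> ennreal e"
    by (rule uniform_modulus[OF e]) blast
  show "\<exists>d>0. \<forall>h. 0 < h \<and> h < d \<longrightarrow> msq (M \<Otimes>\<^sub>M lborel) (\<lambda>(w, t). \<Psi> (w, t) - \<Psi> (w, t - h)) \<le> ennreal e"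
  proof (intro exI conjI allI impI)
    fix h assume h: "0 < h \<and> h < d"
    have "msq (M \<Otimes>\<^sub>M lborel) (shift_diff h \<Psi>) \<le> ennreal e"
      using h d(2) e by (intro limit_modulus) auto
    then show "msq (M \<Otimes>\<^sub>M lborel) (\<lambda>(w, t). \<Psi> (w, t) - \<Psi> (w, t - h)) \<le> ennreal e"
      by (simp only: shift_diff_def)
  qed (rule d(1))
qed

text \<open>One grid for all \<open>n\<close> and for the limit at once, which is what allows
  \<open>n\<close> to go to infinity with the grid held fixed.\<close>

lemma uniform_step_error:
  assumes e: "e > 0"
  obtains N \<delta> where "\<delta> > 0" "real N * \<delta> = T"
    "\<And>n. msq (M \<Otimes>\<^sub>M lborel) (\<lambda>z. \<Psi>n n z - step_process \<delta> N (\<Psi>n n) z) \<le> ennreal e"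
    "msq (M \<Otimes>\<^sub>M lborel) (\<lambda>z. \<Psi> z - step_process \<delta> N \<Psi> z) \<le> ennreal e"
proof -
  obtain d where d: "d > 0" "\<And>h n. 0 < h \<Longrightarrow> h < d \<Longrightarrow> msq (M \<Otimes>\<^sub>M lborel) (shift_diff h (\<Psi>n n)) \<le> ennreal (e/2)"
    by (rule uniform_modulus[of "e/2"]) (use e in auto)
  obtain N :: nat where N: "2 * T / d < real N" using reals_Archimedean2 by blast
  have N0: "real N > 0" using N d T by (meson divide_pos_pos less_trans mult_pos_pos zero_less_numeral)
  define \<delta> where "\<delta> = T / real N"
  have \<delta>: "\<delta> > 0" "real N * \<delta> = T" "2 * \<delta> < d" using N N0 T d by (auto simp: \<delta>_def field_simps)
  have two: "2 * ennreal (e/2) = ennreal e" using e by (simp add: ennreal_mult[symmetric] flip: ennreal_numeral)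
  have ext: "zero_extension T f (w, t) = 0" if "t \<notin> {0<..real N * \<delta>}" for f :: "real \<Rightarrow> 'w \<Rightarrow> real^'k^'m" and w t
    using that \<delta> by (simp add: zero_extension_def)
  have "msq (M \<Otimes>\<^sub>M lborel) (\<lambda>z. \<Psi>n n z - step_process \<delta> N (\<Psi>n n) z) \<le> 2 * ennreal (e/2)" for n
    using d \<delta> by (intro step_process_error \<Psi>n_L2 ext) (auto simp: shift_diff_def)
  moreover have "msq (M \<Otimes>\<^sub>M lborel) (\<lambda>z. \<Psi> z - step_process \<delta> N \<Psi> z) \<le> 2 * ennreal (e/2)"
  proof (intro step_process_error \<Psi>_L2 ext \<delta>(1))
    fix h assume "0 < h" "h < 2 * \<delta>"
    then show "msq (M \<Otimes>\<^sub>M lborel) (\<lambda>(w, t). \<Psi> (w, t) - \<Psi> (w, t - h)) \<le> ennreal (e/2)"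
      using limit_modulus[of h "e/2"] d \<delta> e by (simp add: shift_diff_def)
  qed
  ultimately show ?thesis using that[OF \<delta>(1,2)] unfolding two by blast
qed

end

section \<open>Passage to the limit on a fixed grid\<close>

context ito_convergence
begin

lemma block_average_inner:
  assumes f: "f \<in> Lp (M \<Otimes>\<^sub>M lborel) 2" and f0: "\<And>z. z \<notin> space M \<times> {0<..T} \<Longrightarrow> z \<in> space (M \<Otimes>\<^sub>M lborel) \<Longrightarrow> f z = 0"
    and \<delta>: "\<delta> > 0" and Y: "Y \<in> borel_measurable M" "\<And>w. norm (Y w) \<le> c"
  shows "(\<integral>w. block_average \<delta> f j w \<bullet> Y w \<partial>M)
    = (1/\<delta>) * (\<integral>z. f z \<bullet> (indicator (block \<delta> j) (snd z) *\<^sub>R Y (fst z)) \<partial>(M \<Otimes>\<^sub>M lborel))"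
proof -
  interpret pair_sigma_finite M "lborel :: real measure" ..
  let ?Y = "\<lambda>z. indicator (block \<delta> j) (snd z) *\<^sub>R Y (fst z)"
  have Ym: "?Y \<in> borel_measurable (M \<Otimes>\<^sub>M lborel)"
    by (intro borel_measurable_scaleR measurable_compose[OF measurable_fst Y(1)] measurable_compose[OF measurable_snd]) measurable
  have Yb: "norm (?Y z) \<le> c" for z
    using Y(2)[of "fst z"] order_trans[OF norm_ge_zero Y(2)] by (auto simp: indicator_def)
  have int: "integrable (M \<Otimes>\<^sub>M lborel) (\<lambda>z. f z \<bullet> ?Y z)"
    by (rule integrable_strip_inner[OF f f0 less_imp_le[OF T] Ym Yb])
  have "(\<integral>w. block_average \<delta> f j w \<bullet> Y w \<partial>M) = (\<integral>w. (1/\<delta>) * (\<integral>s. f (w, s) \<bullet> ?Y (w, s) \<partial>lborel) \<partial>M)"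
  proof (rule integral_cong_AE)
    show "(\<lambda>w. block_average \<delta> f j w \<bullet> Y w) \<in> borel_measurable M"
      by (intro borel_measurable_inner Y Lp2_measurable[OF block_average_Lp2[OF f \<delta>]])
    have "(\<lambda>w. (\<integral>s. f (w, s) \<bullet> ?Y (w, s) \<partial>lborel)) \<in> borel_measurable M"
      using int by (intro lborel.borel_measurable_lebesgue_integral) (simp add: split_beta')
    then show "(\<lambda>w. (1/\<delta>) * (\<integral>s. f (w, s) \<bullet> ?Y (w, s) \<partial>lborel)) \<in> borel_measurable M"
      by (intro borel_measurable_times borel_measurable_const)
    show "AE w in M. block_average \<delta> f j w \<bullet> Y w = (1/\<delta>) * (\<integral>s. f (w, s) \<bullet> ?Y (w, s) \<partial>lborel)"
      using AE_sections_integrable[OF f \<delta>]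
    proof eventually_elim
      case (elim w)
      have "(\<integral>s. f (w, s) \<bullet> ?Y (w, s) \<partial>lborel) = (\<integral>s. (indicator (block \<delta> j) s *\<^sub>R f (w, s)) \<bullet> Y w \<partial>lborel)"
        by (intro Bochner_Integration.integral_cong refl) simp
      also have "\<dots> = (\<integral>s. indicator (block \<delta> j) s *\<^sub>R f (w, s) \<partial>lborel) \<bullet> Y w"
        using elim by (intro integral_inner_left) auto
      finally show ?case by (simp add: block_average_def)
    qed
  qed
  also have "\<dots> = (1/\<delta>) * (\<integral>w. (\<integral>s. f (w, s) \<bullet> ?Y (w, s) \<partial>lborel) \<partial>M)" by simp
  also have "(\<integral>w. (\<integral>s. f (w, s) \<bullet> ?Y (w, s) \<partial>lborel) \<partial>M) = (\<integral>z. f z \<bullet> ?Y z \<partial>(M \<Otimes>\<^sub>M lborel))"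
    by (rule integral_fst'[OF int])
  finally show ?thesis .
qed

text \<open>The test \<open>h\<close> is only square-integrable: it will be the outer product of a
  bounded vector with a Wiener increment, which is unbounded. The uniform L2 bound of the averages
  extends the convergence from bounded tests to such \<open>h\<close>.\<close>

lemma block_average_weak:
  assumes \<delta>: "\<delta> > 0" and h: "h \<in> Lp M 2"
  shows "(\<lambda>n. \<integral>w. block_average \<delta> (\<Psi>n n) j w \<bullet> h w \<partial>M) \<longlonglongrightarrow> (\<integral>w. block_average \<delta> \<Psi> j w \<bullet> h w \<partial>M)"
proof (rule Lp2_weakly_bounded_tests[OF finite_measure_axioms block_average_Lp2[OF \<Psi>n_L2 \<delta>] block_average_Lp2[OF \<Psi>_L2 \<delta>] _ _ _ h])
  show "msq M (block_average \<delta> (\<Psi>n n) j) \<le> ennreal (1/\<delta>) * ennreal (T + B)" for n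
    by (rule order_trans[OF block_average_msq[OF \<Psi>n_L2 \<delta>]]) (intro mult_left_mono \<Psi>n_msq, simp)
  show "ennreal (1/\<delta>) * ennreal (T + B) < \<infinity>" by (simp add: ennreal_mult_less_top)
  fix Y :: "'w \<Rightarrow> real^'k^'m" and c assume Y: "Y \<in> borel_measurable M" "\<And>w. norm (Y w) \<le> c"
  let ?Y = "\<lambda>z. indicator (block \<delta> j) (snd z) *\<^sub>R Y (fst z)"
  have Ym: "?Y \<in> borel_measurable (M \<Otimes>\<^sub>M lborel)"
    by (intro borel_measurable_scaleR measurable_compose[OF measurable_fst Y(1)] measurable_compose[OF measurable_snd]) measurable
  have Yb: "norm (?Y z) \<le> c" for z
    using Y(2)[of "fst z"] order_trans[OF norm_ge_zero Y(2)] by (auto simp: indicator_def)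
  have "(\<lambda>n. (1/\<delta>) * (\<integral>z. \<Psi>n n z \<bullet> ?Y z \<partial>(M \<Otimes>\<^sub>M lborel))) \<longlonglongrightarrow> (1/\<delta>) * (\<integral>z. \<Psi> z \<bullet> ?Y z \<partial>(M \<Otimes>\<^sub>M lborel))"
    by (intro tendsto_mult tendsto_const weak[OF Ym Yb])
  moreover have "(\<integral>w. block_average \<delta> (\<Psi>n n) j w \<bullet> Y w \<partial>M) = (1/\<delta>) * (\<integral>z. \<Psi>n n z \<bullet> ?Y z \<partial>(M \<Otimes>\<^sub>M lborel))" for n
    by (rule block_average_inner[OF \<Psi>n_L2 zero_extension_strip \<delta> Y])
  moreover have "(\<integral>w. block_average \<delta> \<Psi> j w \<bullet> Y w \<partial>M) = (1/\<delta>) * (\<integral>z. \<Psi> z \<bullet> ?Y z \<partial>(M \<Otimes>\<^sub>M lborel))"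
    by (rule block_average_inner[OF \<Psi>_L2 zero_extension_strip \<delta> Y])
  ultimately show "(\<lambda>n. \<integral>w. block_average \<delta> (\<Psi>n n) j w \<bullet> Y w \<partial>M) \<longlonglongrightarrow> (\<integral>w. block_average \<delta> \<Psi> j w \<bullet> Y w \<partial>M)"
    by (simp only:)
qed

lemma increment_converges:
  assumes "0 \<le> s" "s \<le> u" "u \<le> T"
  shows "(\<lambda>n. msq M (\<lambda>w. (Wn n u w - Wn n s w) - (W u w - W s w))) \<longlonglongrightarrow> 0"
proof (rule msq_tendsto_of_norm_eq)
  show "(\<lambda>w. Wn n u w - Wn n s w) \<in> Lp M 2" for n by (rule brownian.incr_Lp2[OF bn assms])
  show "(\<lambda>w. W u w - W s w) \<in> Lp M 2" by (rule brownian.incr_Lp2[OF b assms])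
  show "msq M (\<lambda>w. Wn n u w - Wn n s w) = msq M (\<lambda>w. W u w - W s w)" for n
    by (simp only: brownian.incr_msq[OF bn assms] brownian.incr_msq[OF b assms])
  show "AE w in M. (\<lambda>n. Wn n u w - Wn n s w) \<longlonglongrightarrow> W u w - W s w"
    using noise
  proof eventually_elim
    case (elim w)
    show ?case
      using assms by (intro tendsto_diff tendsto_uniform_limitI[OF elim]) auto
  qed
qed

text \<open>Product of a weak and a strong limit. The increment of \<open>Wn n\<close> is split into
  that of \<open>W\<close>, which gives a fixed square-integrable test for the weakly convergent
  averages, and a remainder that vanishes in L2 while the averages stay bounded by
  \<open>sqrt ((T + B) / \<delta>)\<close>. That bound depends on the mesh, not on
  \<open>n\<close>.\<close>

lemma step_term_converges:
  assumes \<delta>: "\<delta> > 0" and su: "0 \<le> s" "s \<le> u" "u \<le> T" and Y: "Y \<in> borel_measurable M" "\<And>w. norm (Y w) \<le> c"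
  shows "(\<lambda>n. \<integral>w. (block_average \<delta> (\<Psi>n n) j w *v (Wn n u w - Wn n s w)) \<bullet> Y w \<partial>M)
    \<longlonglongrightarrow> (\<integral>w. (block_average \<delta> \<Psi> j w *v (W u w - W s w)) \<bullet> Y w \<partial>M)"
proof -
  let ?A = "\<lambda>n. block_average \<delta> (\<Psi>n n) j"
  let ?D = "\<lambda>n w. (Wn n u w - Wn n s w) - (W u w - W s w)"
  have AL2: "?A n \<in> Lp M 2" for n by (rule block_average_Lp2[OF \<Psi>n_L2 \<delta>])
  have WL2: "(\<lambda>w. W u w - W s w) \<in> Lp M 2" by (rule brownian.incr_Lp2[OF b su])
  have DL2: "?D n \<in> Lp M 2" for n by (intro Lp2_diff[OF brownian.incr_Lp2[OF bn su] WL2])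
  have oW: "(\<lambda>w. outer (Y w) (W u w - W s w)) \<in> Lp M 2" by (rule outer_Lp2(1)[OF Y WL2])
  have oD: "(\<lambda>w. outer (Y w) (?D n w)) \<in> Lp M 2" for n by (rule outer_Lp2(1)[OF Y DL2])
  have split: "(\<integral>w. (?A n w *v (Wn n u w - Wn n s w)) \<bullet> Y w \<partial>M)
    = (\<integral>w. ?A n w \<bullet> outer (Y w) (W u w - W s w) \<partial>M) + (\<integral>w. ?A n w \<bullet> outer (Y w) (?D n w) \<partial>M)" for n
  proof -
    have "(?A n w *v (Wn n u w - Wn n s w)) \<bullet> Y w = ?A n w \<bullet> outer (Y w) (W u w - W s w) + ?A n w \<bullet> outer (Y w) (?D n w)" for w
      unfolding inner_outer[symmetric] outer_diff by (simp add: inner_diff_right)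
    then show ?thesis
      by (simp add: Bochner_Integration.integral_add[OF Lp2_integrable_inner[OF AL2 oW] Lp2_integrable_inner[OF AL2 oD]])
  qed
  have "(\<lambda>n. ennreal (c\<^sup>2) * msq M (?D n)) \<longlonglongrightarrow> ennreal (c\<^sup>2) * 0"
    by (intro ennreal_tendsto_cmult increment_converges[OF su]) simp
  then have lim: "(\<lambda>n. ennreal (c\<^sup>2) * msq M (?D n)) \<longlonglongrightarrow> 0" by simp
  have "(\<lambda>n. msq M (\<lambda>w. outer (Y w) (?D n w))) \<longlonglongrightarrow> 0"
    by (rule tendsto_sandwich[OF _ _ tendsto_const lim]) (use outer_Lp2(2)[OF Y DL2] in auto)
  from Lp_norm2_tendsto_0[OF oD this]
  have "(\<lambda>n. sqrt ((T + B) / \<delta>) * Lp_norm M 2 (\<lambda>w. outer (Y w) (?D n w))) \<longlonglongrightarrow> sqrt ((T + B) / \<delta>) * 0"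
    by (intro tendsto_mult tendsto_const)
  then have lim2: "(\<lambda>n. sqrt ((T + B) / \<delta>) * Lp_norm M 2 (\<lambda>w. outer (Y w) (?D n w))) \<longlonglongrightarrow> 0" by simp
  have nA: "Lp_norm M 2 (?A n) \<le> sqrt ((T + B) / \<delta>)" for n
  proof (rule Lp_norm2_le[OF AL2])
    have "msq M (?A n) \<le> ennreal (1/\<delta>) * ennreal (T + B)"
      by (rule order_trans[OF block_average_msq[OF \<Psi>n_L2 \<delta>]]) (intro mult_left_mono \<Psi>n_msq, simp)
    also have "\<dots> = ennreal ((sqrt ((T + B) / \<delta>))\<^sup>2)"
      using T B \<delta> by (simp add: ennreal_mult[symmetric] del: ennreal_plus)
    finally show "msq M (?A n) \<le> ennreal ((sqrt ((T + B) / \<delta>))\<^sup>2)" .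
  qed (use T B \<delta> in auto)
  have "(\<lambda>n. \<integral>w. ?A n w \<bullet> outer (Y w) (?D n w) \<partial>M) \<longlonglongrightarrow> 0"
  proof (rule Lim_null_comparison[OF always_eventually[OF allI] lim2])
    fix n
    have "\<bar>\<integral>w. ?A n w \<bullet> outer (Y w) (?D n w) \<partial>M\<bar> \<le> Lp_norm M 2 (?A n) * Lp_norm M 2 (\<lambda>w. outer (Y w) (?D n w))"
      by (rule Lp2_inner_bound[OF AL2 oD])
    also have "\<dots> \<le> sqrt ((T + B) / \<delta>) * Lp_norm M 2 (\<lambda>w. outer (Y w) (?D n w))"
      by (intro mult_right_mono nA Lp_norm2_nonneg)
    finally show "norm (\<integral>w. ?A n w \<bullet> outer (Y w) (?D n w) \<partial>M) \<le> sqrt ((T + B) / \<delta>) * Lp_norm M 2 (\<lambda>w. outer (Y w) (?D n w))"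
      by simp
  qed
  from tendsto_add[OF block_average_weak[OF \<delta> oW] this]
  show ?thesis unfolding split by (simp add: inner_outer)
qed

lemma step_integral_converges:
  assumes t: "0 \<le> t" "t \<le> T" and \<delta>: "\<delta> > 0" "real N * \<delta> = T" and Y: "Y \<in> borel_measurable M" "\<And>w. norm (Y w) \<le> c"
  defines "S \<equiv> \<lambda>W \<Psi>. family_integral W {..<N} (\<lambda>j. real j * \<delta>) (\<lambda>j. real (Suc j) * \<delta>) (block_average \<delta> \<Psi>) t"
  shows "(\<lambda>n. \<integral>w. S (Wn n) (\<Psi>n n) w \<bullet> Y w \<partial>M) \<longlonglongrightarrow> (\<integral>w. S W \<Psi> w \<bullet> Y w \<partial>M)"
proof -
  let ?s = "\<lambda>j. min t (real j * \<delta>)" and ?u = "\<lambda>j. min t (real (Suc j) * \<delta>)"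
  have su: "0 \<le> ?s j" "?s j \<le> ?u j" "?u j \<le> T" for j
    using t \<delta> by (auto simp: algebra_simps intro: min.coboundedI1 min.coboundedI2)
  have int: "(\<integral>w. family_integral W' {..<N} (\<lambda>j. real j * \<delta>) (\<lambda>j. real (Suc j) * \<delta>) (block_average \<delta> f) t w \<bullet> Y w \<partial>M)
     = (\<Sum>j<N. \<integral>w. (block_average \<delta> f j w *v (W' (?u j) w - W' (?s j) w)) \<bullet> Y w \<partial>M)"
    if br: "brownian M T F' W'" and f: "f \<in> Lp (M \<Otimes>\<^sub>M lborel) 2" for W' :: "real \<Rightarrow> 'w \<Rightarrow> real^'k" and F' f
  proof -
    have "integrable M (\<lambda>w. (block_average \<delta> f j w *v (W' (?u j) w - W' (?s j) w)) \<bullet> Y w)" for j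
      unfolding inner_outer[symmetric]
      by (intro Lp2_integrable_inner block_average_Lp2[OF f \<delta>(1)] outer_Lp2(1)[OF Y brownian.incr_Lp2[OF br su]])
    then show ?thesis
      by (simp add: family_integral_def inner_sum_left Bochner_Integration.integral_sum)
  qed
  show ?thesis
    unfolding S_def int[OF bn \<Psi>n_L2] int[OF b \<Psi>_L2]
    by (intro tendsto_sum step_term_converges[OF \<delta>(1) su Y])
qed

text \<open>After testing, every stochastic integral is within \<open>r/4\<close> of its step
  integral, uniformly in \<open>n\<close>, and the step integrals on the common grid
  converge.\<close>

theorem ito_integral_tested:
  assumes t: "0 \<le> t" "t \<le> T"
    and Jn: "\<And>n. is_ito_integral M T (Fn n) (Wn n) (\<Phi>n n) t (Jn n)" and J: "is_ito_integral M T F W \<Phi> t J"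
    and Y: "Y \<in> borel_measurable M" "\<And>w. norm (Y w) \<le> c"
  shows "(\<lambda>n. \<integral>w. Jn n w \<bullet> Y w \<partial>M) \<longlonglongrightarrow> (\<integral>w. J w \<bullet> Y w \<partial>M)"
proof (rule LIMSEQ_I)
  fix r :: real assume r: "r > 0"
  define D where "D = 1 + Lp_norm M 2 Y"
  have D: "D > 0" "Lp_norm M 2 Y \<le> D" using Lp_norm2_nonneg[of M Y] by (auto simp: D_def)
  define a where "a = r / (4 * D)"
  have a: "a > 0" "a * D = r / 4" using r D by (auto simp: a_def)
  \<comment> \<open>Cancels the factor \<open>4 * CARD('k)\<close> of
    \<open>ito_integral_approx\<close> and leaves an L2 error of at most \<open>a\<close>; tested
    against \<open>Y\<close> it becomes at most \<open>a * D = r / 4\<close>.\<close>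
  define e where "e = a\<^sup>2 / (4 * real CARD('k))"
  have e: "e > 0" using a by (simp add: e_def)
  obtain N \<delta> where \<delta>: "\<delta> > 0" "real N * \<delta> = T"
    and en: "\<And>n. msq (M \<Otimes>\<^sub>M lborel) (\<lambda>z. \<Psi>n n z - step_process \<delta> N (\<Psi>n n) z) \<le> ennreal e"
    and el: "msq (M \<Otimes>\<^sub>M lborel) (\<lambda>z. \<Psi> z - step_process \<delta> N \<Psi> z) \<le> ennreal e"
    by (rule uniform_step_error[OF e]) blast
  define S where "S W' f = family_integral W' {..<N} (\<lambda>j. real j * \<delta>) (\<lambda>j. real (Suc j) * \<delta>) (block_average \<delta> f) t"
    for W' :: "real \<Rightarrow> 'w \<Rightarrow> real^'k" and f :: "'w \<times> real \<Rightarrow> real^'k^'m"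
  have YL2: "Y \<in> Lp M 2" using Y by (intro Lp2_bounded finite_measure_axioms) auto
  have approx: "\<bar>(\<integral>w. I w \<bullet> Y w \<partial>M) - (\<integral>w. S W' (zero_extension T \<phi>) w \<bullet> Y w \<partial>M)\<bar> \<le> r / 4"
    if br: "brownian M T F' W'" and I: "is_ito_integral M T F' W' \<phi> t I"
      and prog: "progressive T F' (zero_extension T \<phi>)" and L2: "zero_extension T \<phi> \<in> Lp (M \<Otimes>\<^sub>M lborel) 2"
      and err: "msq (M \<Otimes>\<^sub>M lborel) (\<lambda>z. zero_extension T \<phi> z - step_process \<delta> N (zero_extension T \<phi>) z) \<le> ennreal e"
    for F' W' \<phi> I
  proof -
    interpret br: brownian M T F' W' by (rule br)
    have IL2: "I \<in> Lp M 2" using I unfolding is_ito_integral_def Lp_converges_def by blast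
    have SL2: "S W' (zero_extension T \<phi>) \<in> Lp M 2"
      unfolding S_def by (intro br.family_integral_bound(1)[OF t] br.step_process_family[OF prog L2 \<delta>]) auto
    have "msq M (\<lambda>w. I w - S W' (zero_extension T \<phi>) w) \<le> ennreal (4 * real CARD('k)) * ennreal e"
      unfolding S_def
      by (rule order_trans[OF br.ito_integral_approx[OF t I]])
         (use br.step_process_family[OF prog L2 \<delta>] err in \<open>auto intro!: mult_left_mono simp: step_process_def\<close>)
    also have "\<dots> = ennreal (a\<^sup>2)" using e by (simp add: ennreal_mult[symmetric] e_def)
    finally have "Lp_norm M 2 (\<lambda>w. I w - S W' (zero_extension T \<phi>) w) \<le> a"
      using a by (intro Lp_norm2_le Lp2_diff IL2 SL2) auto
    then have "Lp_norm M 2 (\<lambda>w. I w - S W' (zero_extension T \<phi>) w) * Lp_norm M 2 Y \<le> a * D"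
      using D a by (intro mult_mono Lp_norm2_nonneg) auto
    moreover have "(\<integral>w. I w \<bullet> Y w \<partial>M) - (\<integral>w. S W' (zero_extension T \<phi>) w \<bullet> Y w \<partial>M) = (\<integral>w. (I w - S W' (zero_extension T \<phi>) w) \<bullet> Y w \<partial>M)"
      by (simp add: inner_diff_left Bochner_Integration.integral_diff[OF Lp2_integrable_inner[OF IL2 YL2] Lp2_integrable_inner[OF SL2 YL2]])
    ultimately show ?thesis using Lp2_inner_bound[OF Lp2_diff[OF IL2 SL2] YL2] a by simp
  qed
  have an: "\<bar>(\<integral>w. Jn n w \<bullet> Y w \<partial>M) - (\<integral>w. S (Wn n) (\<Psi>n n) w \<bullet> Y w \<partial>M)\<bar> \<le> r / 4" for n
    by (rule approx[OF bn Jn \<Phi>n_prog \<Psi>n_L2 en])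
  have al: "\<bar>(\<integral>w. J w \<bullet> Y w \<partial>M) - (\<integral>w. S W \<Psi> w \<bullet> Y w \<partial>M)\<bar> \<le> r / 4"
    by (rule approx[OF b J \<Phi>_prog \<Psi>_L2 el])
  have "(\<lambda>n. \<integral>w. S (Wn n) (\<Psi>n n) w \<bullet> Y w \<partial>M) \<longlonglongrightarrow> (\<integral>w. S W \<Psi> w \<bullet> Y w \<partial>M)"
    unfolding S_def by (rule step_integral_converges[OF t \<delta> Y])
  from LIMSEQ_D[OF this, of "r/4"] r obtain n0 where
    n0: "\<And>n. n \<ge> n0 \<Longrightarrow> \<bar>(\<integral>w. S (Wn n) (\<Psi>n n) w \<bullet> Y w \<partial>M) - (\<integral>w. S W \<Psi> w \<bullet> Y w \<partial>M)\<bar> < r / 4" by auto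
  have "norm ((\<integral>w. Jn n w \<bullet> Y w \<partial>M) - (\<integral>w. J w \<bullet> Y w \<partial>M)) < r" if "n \<ge> n0" for n
    using an[of n] al n0[OF that] r unfolding real_norm_def by linarith
  then show "\<exists>n0. \<forall>n\<ge>n0. norm ((\<integral>w. Jn n w \<bullet> Y w \<partial>M) - (\<integral>w. J w \<bullet> Y w \<partial>M)) < r" by blast
qed

theorem ito_integral_converges_weakly:
  assumes t: "0 \<le> t" "t \<le> T"
  shows "Lp_converges_weakly M 2 (\<lambda>n. ito_integral M T (Fn n) (Wn n) (\<Phi>n n) t) (ito_integral M T F W \<Phi> t)"
proof -
  \<comment> \<open>Existence makes the \<open>SOME\<close> choice a genuine version; from here on
    it is treated like any other one.\<close>
  have Jn: "is_ito_integral M T (Fn n) (Wn n) (\<Phi>n n) t (ito_integral M T (Fn n) (Wn n) (\<Phi>n n) t)" for n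
    unfolding ito_integral_def by (rule someI_ex[OF brownian.ito_integral_exists[OF bn T t regular_n]])
  have J: "is_ito_integral M T F W \<Phi> t (ito_integral M T F W \<Phi> t)"
    unfolding ito_integral_def by (rule someI_ex[OF brownian.ito_integral_exists[OF b T t regular_limit]])
  have L2: "I \<in> Lp M 2" if "is_ito_integral M T F' W' \<phi> t I" for F' I and W' :: "real \<Rightarrow> 'w \<Rightarrow> real^'k" and \<phi> :: "real \<Rightarrow> 'w \<Rightarrow> real^'k^'m"
    using that unfolding is_ito_integral_def Lp_converges_def by blast
  show ?thesis
  proof (rule Lp2_converges_weaklyI[OF finite_measure_axioms L2[OF Jn] L2[OF J]])
    show "msq M (ito_integral M T (Fn n) (Wn n) (\<Phi>n n) t) \<le> ennreal (4 * real CARD('k)) * ennreal (T + B)" for n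
      by (rule order_trans[OF brownian.ito_integral_msq[OF bn t Jn]]) (intro mult_left_mono \<Psi>n_msq, simp)
    show "ennreal (4 * real CARD('k)) * ennreal (T + B) < \<infinity>" by (simp add: ennreal_mult_less_top)
    show "(\<lambda>n. \<integral>w. ito_integral M T (Fn n) (Wn n) (\<Phi>n n) t w \<bullet> Y w \<partial>M) \<longlonglongrightarrow> (\<integral>w. ito_integral M T F W \<Phi> t w \<bullet> Y w \<partial>M)"
      if "Y \<in> borel_measurable M" "\<And>w. norm (Y w) \<le> c" for Y c
      by (rule ito_integral_tested[OF t Jn J that])
  qed
qed

end

section \<open>Pairing with the Sobolev function\<close>

lemma self_le_one_plus_powr: "x \<le> 1 + x powr r" if "x \<ge> 0" "r \<ge> 1" for x r :: real
proof (cases "x \<le> 1")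
  case True then show ?thesis using powr_ge_zero[of x r] by linarith
next
  case False
  then have "x powr 1 \<le> x powr r" using that by (intro powr_mono) auto
  then show ?thesis using False by simp
qed

lemma Lp_integrable_norm:
  assumes "finite_measure P" "r \<ge> 1" "f \<in> Lp P r"
  shows "integrable P (\<lambda>z. norm (f z))"
proof -
  interpret finite_measure P by fact
  show ?thesis
  proof (rule Bochner_Integration.integrable_bound)
    show "integrable P (\<lambda>z. 1 + norm (f z) powr r)" using assms(3) by (auto simp: Lp_def)
    show "AE z in P. norm (norm (f z)) \<le> norm (1 + norm (f z) powr r)"
      using self_le_one_plus_powr[OF _ assms(2)] by (intro AE_I2) (smt (verit) norm_ge_zero powr_ge_zero real_norm_def)
  qed (use assms(3) in \<open>auto simp: Lp_def\<close>)
qed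

text \<open>For \<open>N > 0\<close> the inequality \<open>x \<le> 1 + x\<^sup>r\<close> at \<open>x = |f| / N\<close> replaces Hoelder's inequality.\<close>

lemma Lp_integral_norm_bound:
  assumes P: "finite_measure P" and r: "r \<ge> 1" and f: "f \<in> Lp P r"
  shows "(\<integral>z. norm (f z) \<partial>P) \<le> (measure P (space P) + 1) * Lp_norm P r f"
proof -
  interpret finite_measure P by fact
  let ?N = "Lp_norm P r f" and ?I = "\<integral>z. norm (f z) powr r \<partial>P"
  have fm [measurable]: "f \<in> borel_measurable P" and int: "integrable P (\<lambda>z. norm (f z) powr r)" using f by (auto simp: Lp_def)
  have I0: "?I \<ge> 0" by simp
  have intf: "integrable P (\<lambda>z. norm (f z))" by (rule Lp_integrable_norm[OF P r f])
  show ?thesis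
  proof (cases "?I = 0")
    case True
    then have "AE z in P. norm (f z) powr r = 0"
      using integral_nonneg_eq_0_iff_AE[OF int] by simp
    then have "AE z in P. norm (f z) = 0" by eventually_elim auto
    then have "(\<integral>z. norm (f z) \<partial>P) = 0" using integral_nonneg_eq_0_iff_AE[OF intf] by simp
    then show ?thesis by (simp add: Lp_norm_def)
  next
    case False
    then have N: "?N > 0" "?N powr r = ?I" using I0 r by (auto simp: Lp_norm_def powr_powr)
    have "(\<integral>z. norm (f z) / ?N \<partial>P) \<le> (\<integral>z. 1 + norm (f z) powr r / ?N powr r \<partial>P)"
    proof (rule integral_mono)
      fix z
      show "norm (f z) / ?N \<le> 1 + norm (f z) powr r / ?N powr r"
        using self_le_one_plus_powr[of "norm (f z) / ?N" r] N r by (simp add: powr_divide)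
    qed (use intf int in auto)
    also have "\<dots> = measure P (space P) + 1"
      using int N False by simp
    finally show ?thesis using N by (simp add: field_simps)
  qed
qed

text \<open>On a finite measure space bounded functions act continuously on \<open>Lp P r\<close>
  for every \<open>r \<ge> 1\<close>. These are the functionals through which the assumed weak
  convergence of the \<open>Vn\<close> is exploited.\<close>

lemma bounded_test_dual:
  assumes P: "finite_measure P" and r: "r \<ge> 1" and Z: "Z \<in> borel_measurable P" "\<And>z. norm (Z z) \<le> c"
  shows "(\<lambda>f. \<integral>z. f z \<bullet> Z z \<partial>P) \<in> Lp_dual P r"
proof -
  have c0: "c \<ge> 0" using order_trans[OF norm_ge_zero Z(2)] by blast
  have le: "norm (f z \<bullet> Z z) \<le> norm (f z) * c" for f z
    using Cauchy_Schwarz_ineq2[of "f z" "Z z"] mult_left_mono[OF Z(2)[of z] norm_ge_zero[of "f z"]] by simp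
  have int: "integrable P (\<lambda>z. f z \<bullet> Z z)" if f: "f \<in> Lp P r" for f
  proof (rule Bochner_Integration.integrable_bound)
    show "integrable P (\<lambda>z. norm (f z) * c)" using Lp_integrable_norm[OF P r f] by simp
    show "(\<lambda>z. f z \<bullet> Z z) \<in> borel_measurable P" using f Z by (auto simp: Lp_def)
    show "AE z in P. norm (f z \<bullet> Z z) \<le> norm (norm (f z) * c)" using le c0 by auto
  qed
  have "\<bar>\<integral>z. f z \<bullet> Z z \<partial>P\<bar> \<le> (c * (measure P (space P) + 1)) * Lp_norm P r f" if f: "f \<in> Lp P r" for f
  proof -
    have "\<bar>\<integral>z. f z \<bullet> Z z \<partial>P\<bar> \<le> (\<integral>z. norm (f z \<bullet> Z z) \<partial>P)"
      using integral_norm_bound[of P "\<lambda>z. f z \<bullet> Z z"] by simp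
    also have "\<dots> \<le> (\<integral>z. norm (f z) * c \<partial>P)"
      using le int[OF f] Lp_integrable_norm[OF P r f] by (intro integral_mono) auto
    also have "\<dots> = c * (\<integral>z. norm (f z) \<partial>P)" by simp
    also have "\<dots> \<le> c * ((measure P (space P) + 1) * Lp_norm P r f)"
      by (intro mult_left_mono Lp_integral_norm_bound P r f c0)
    finally show ?thesis by (simp add: mult.assoc)
  qed
  then show ?thesis
    unfolding Lp_dual_def using int
    by (auto simp: inner_add_left)
qed

lemma torus_pairing_integrable:
  fixes f :: "real^'d \<Rightarrow> 'b::euclidean_space"
  assumes \<beta>: "\<beta> \<in> borel_measurable torus" "AE x in torus. \<bar>\<beta> x\<bar> \<le> C" and f: "integrable torus f"
  shows "integrable torus (\<lambda>x. \<beta> x *\<^sub>R f x)"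
proof (rule Bochner_Integration.integrable_bound)
  show "integrable torus (\<lambda>x. C * norm (f x))" using f by simp
  show "AE x in torus. norm (\<beta> x *\<^sub>R f x) \<le> norm (C * norm (f x))"
    using \<beta>(2)
  proof eventually_elim
    case (elim x)
    then have "\<bar>\<beta> x\<bar> * norm (f x) \<le> \<bar>C\<bar> * norm (f x)" by (intro mult_right_mono) auto
    then show ?case by (simp add: abs_mult)
  qed
qed (use \<beta> f in auto)

lemma torus_pairing_bound:
  fixes f :: "real^'d \<Rightarrow> 'b::euclidean_space"
  assumes \<beta>: "\<beta> \<in> borel_measurable torus" "AE x in torus. \<bar>\<beta> x\<bar> \<le> C" and f: "integrable torus f"
  shows "norm (torus_pairing \<beta> f) \<le> C * (\<integral>x. norm (f x) \<partial>torus)"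
proof -
  have "norm (torus_pairing \<beta> f) \<le> (\<integral>x. norm (\<beta> x *\<^sub>R f x) \<partial>torus)"
    unfolding torus_pairing_def by (rule integral_norm_bound)
  also have "\<dots> \<le> (\<integral>x. C * norm (f x) \<partial>torus)"
  proof (rule integral_mono_AE)
    show "AE x in torus. norm (\<beta> x *\<^sub>R f x) \<le> C * norm (f x)"
      using \<beta>(2) by eventually_elim (auto intro: mult_right_mono)
    show "integrable torus (\<lambda>x. norm (\<beta> x *\<^sub>R f x))"
      by (rule integrable_norm[OF torus_pairing_integrable[OF \<beta> f]])
  qed (use f in auto)
  finally show ?thesis by simp
qed

lemma torus_pairing_diff:
  assumes \<beta>: "\<beta> \<in> borel_measurable torus" "AE x in torus. \<bar>\<beta> x\<bar> \<le> C" and f: "integrable torus f" "integrable torus g"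
  shows "torus_pairing \<beta> (\<lambda>x. f x - g x) = torus_pairing \<beta> f - torus_pairing \<beta> g"
  unfolding torus_pairing_def scaleR_diff_right
  by (rule Bochner_Integration.integral_diff[OF torus_pairing_integrable[OF \<beta> f(1)] torus_pairing_integrable[OF \<beta> f(2)]])

text \<open>Pairing is Lipschitz with constant \<open>C\<close> for the L1 pseudometric, so
  preimages of open sets are open for it and belong to the generator of
  \<open>L1_borel\<close>.\<close>

lemma torus_pairing_measurable:
  fixes \<beta> :: "real^'d \<Rightarrow> real"
  assumes \<beta>: "\<beta> \<in> borel_measurable torus" "AE x in torus. \<bar>\<beta> x\<bar> \<le> C" and C: "C \<ge> 0"
  shows "(torus_pairing \<beta> :: (real^'d \<Rightarrow> 'b::euclidean_space) \<Rightarrow> 'b) \<in> borel_measurable (L1_borel torus)"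
proof (rule borel_measurableI)
  fix S :: "'b set" assume S: "open S"
  let ?G = "{U. U \<subseteq> {f::real^'d \<Rightarrow> 'b. integrable torus f} \<and>
         (\<forall>f\<in>U. \<exists>e>0. \<forall>g. integrable torus g \<and> (\<integral>x. norm (g x - f x) \<partial>torus) < e \<longrightarrow> g \<in> U)}"
  let ?U = "torus_pairing \<beta> -` S \<inter> {f::real^'d \<Rightarrow> 'b. integrable torus f}"
  have G: "?G \<subseteq> Pow {f. integrable torus f}" by blast
  have "?U \<in> ?G"
  proof (intro CollectI conjI ballI)
    fix f assume f: "f \<in> ?U"
    then obtain e where e: "e > 0" "ball (torus_pairing \<beta> f) e \<subseteq> S" using S openE by blast
    show "\<exists>e>0. \<forall>g. integrable torus g \<and> (\<integral>x. norm (g x - f x) \<partial>torus) < e \<longrightarrow> g \<in> ?U"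
    proof (intro exI conjI allI impI)
      \<comment> \<open>The denominator is \<open>C + 1\<close> because \<open>C\<close> may be
        zero.\<close>
      show "e / (C + 1) > 0" using e C by simp
      fix g assume g: "integrable torus g \<and> (\<integral>x. norm (g x - f x) \<partial>torus) < e / (C + 1)"
      then have gi: "integrable torus g" and fi: "integrable torus f" using f by auto
      have "norm (torus_pairing \<beta> g - torus_pairing \<beta> f) \<le> C * (\<integral>x. norm (g x - f x) \<partial>torus)"
        using torus_pairing_bound[OF \<beta> Bochner_Integration.integrable_diff[OF gi fi]] torus_pairing_diff[OF \<beta> gi fi] by simp
      also have "\<dots> \<le> (C + 1) * (\<integral>x. norm (g x - f x) \<partial>torus)" by (intro mult_right_mono) auto
      also have "\<dots> < e" using g C by (simp add: field_simps)
      finally have "torus_pairing \<beta> g \<in> ball (torus_pairing \<beta> f) e" by (simp add: dist_norm norm_minus_commute)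
      then show "g \<in> ?U" using e gi by auto
    qed
  qed auto
  then show "torus_pairing \<beta> -` S \<inter> space (L1_borel torus) \<in> sets (L1_borel torus)"
    unfolding L1_borel_def space_measure_of[OF G] sets_measure_of[OF G] by (rule sigma_sets.Basic)
qed

section \<open>Measurability drawn from predictability\<close>

lemma space_L1_borel: "space (L1_borel N) = {f. integrable N f}"
  unfolding L1_borel_def by (rule space_measure_of) blast

lemma predictable_generators:
  assumes filt: "filtration_upto M T F" and T: "T > 0"
  shows "{A \<times> {0} | A. A \<in> sets (F 0)} \<union> {A \<times> {s<..t} | A s t. 0 \<le> s \<and> s < t \<and> t \<le> T \<and> A \<in> sets (F s)}
    \<subseteq> Pow (space M \<times> {0..T})"
proof -
  have "A \<subseteq> space M" if "A \<in> sets (F s)" "0 \<le> s" "s \<le> T" for A s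
  proof -
    have "subalgebra M (F s)" using filt that by (simp add: filtration_upto_def)
    then show ?thesis using sets.sets_into_space[OF that(1)] by (simp add: subalgebra_def)
  qed
  then show ?thesis using T by fastforce
qed

lemma space_predictable:
  assumes "filtration_upto M T F" "T > 0"
  shows "space (predictable_algebra M T F) = space M \<times> {0..T}"
  unfolding predictable_algebra_def by (rule space_measure_of[OF predictable_generators[OF assms]])

lemma predictable_measurable_product:
  assumes filt: "filtration_upto M T F" and T: "T > 0" and f: "f \<in> measurable (predictable_algebra M T F) N"
  shows "f \<in> measurable (M \<Otimes>\<^sub>M time_measure T) N"
proof (rule measurable_from_subalg[OF _ f])
  have sub: "A \<in> sets M" if "A \<in> sets (F s)" "0 \<le> s" "s \<le> T" for A s
    using filt that by (auto simp: filtration_upto_def subalgebra_def)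
  have I: "{s<..t} \<in> sets (time_measure T)" if "0 \<le> s" "t \<le> T" for s t
    using that unfolding time_measure_def by (subst sets_restrict_space_iff) auto
  have Z: "{0} \<in> sets (time_measure T)"
    using T unfolding time_measure_def by (subst sets_restrict_space_iff) auto
  have sp: "space (M \<Otimes>\<^sub>M time_measure T) = space M \<times> {0..T}" by (simp add: space_pair_measure space_time_measure)
  have "sets (predictable_algebra M T F) \<subseteq> sets (M \<Otimes>\<^sub>M time_measure T)"
    unfolding predictable_algebra_def sets_measure_of[OF predictable_generators[OF filt T]]
  proof (rule sets.sigma_sets_subset[of _ "M \<Otimes>\<^sub>M time_measure T", unfolded sp], rule subsetI)
    fix S assume "S \<in> {A \<times> {0} | A. A \<in> sets (F 0)} \<union> {A \<times> {s<..t} | A s t. 0 \<le> s \<and> s < t \<and> t \<le> T \<and> A \<in> sets (F s)}"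
    then show "S \<in> sets (M \<Otimes>\<^sub>M time_measure T)"
      using sub[of _ 0] T sub I Z by (auto intro!: pair_measureI)
  qed
  then show "subalgebra (M \<Otimes>\<^sub>M time_measure T) (predictable_algebra M T F)"
    by (simp add: subalgebra_def sp space_predictable[OF filt T])
qed

text \<open>The trace of the predictable sigma-algebra on the strip over \<open>(0,b]\<close> lies
  in the product of \<open>F b\<close> with the Borel sets: a generating rectangle that meets the
  strip starts at some \<open>s < b\<close>, and its base in \<open>F s\<close> belongs to
  \<open>F b\<close>. The generators at time \<open>0\<close> miss the strip, in line with
  \<open>zero_extension\<close>.\<close>

lemma predictable_progressive:
  fixes \<Phi> :: "real \<Rightarrow> 'w \<Rightarrow> 'b::euclidean_space"
  assumes filt: "filtration_upto M T F" and T: "T > 0"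
    and f: "(\<lambda>(w, t). \<Phi> t w) \<in> borel_measurable (predictable_algebra M T F)"
  shows "progressive T F (zero_extension T \<Phi>)"
  unfolding progressive_def
proof
  fix b assume b: "b \<in> {0..T}"
  let ?X = "space M \<times> {0<..b}" and ?N = "F b \<Otimes>\<^sub>M (lborel :: real measure)"
  have spF: "space (F b) = space M" using filt b by (auto simp: filtration_upto_def subalgebra_def)
  have X: "?X \<in> sets ?N" unfolding spF[symmetric] by (intro pair_measureI) auto
  have trace: "A \<inter> ?X \<in> sets ?N" if "A \<in> sets (predictable_algebra M T F)" for A
    using that unfolding predictable_algebra_def sets_measure_of[OF predictable_generators[OF filt T]]
  proof (induction rule: sigma_sets.induct)
    case (Basic A)
    then consider (zero) A' where "A = A' \<times> {0}" | (int) A' s t where "A = A' \<times> {s<..t}" "0 \<le> s" "s < t" "t \<le> T" "A' \<in> sets (F s)"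
      by blast
    then show ?case
    proof cases
      case zero
      then have "A \<inter> ?X = {}" by auto
      then show ?thesis by (metis sets.empty_sets)
    next
      case int
      show ?thesis
      proof (cases "s < b")
        case True
        then have "A' \<in> sets (F b)" using int filt b unfolding filtration_upto_def by (meson atLeastAtMost_iff less_eq_real_def order_trans subsetD)
        moreover have "A \<inter> ?X = (A' \<inter> space M) \<times> ({s<..t} \<inter> {0<..b})" using int by auto
        moreover have "A' \<inter> space M = A'" using sets.sets_into_space[OF calculation(1)] spF by auto
        ultimately show ?thesis by (auto intro!: pair_measureI)
      next
        case False
        then have "A \<inter> ?X = {}" using int by auto
        then show ?thesis by (metis sets.empty_sets)
      qed
    qed
  next
    case (Compl A)
    have "(space M \<times> {0..T} - A) \<inter> ?X = ?X - (A \<inter> ?X)" using b by auto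
    then show ?case using X Compl by auto
  next
    case (Union A)
    have "(\<Union>i. A i \<inter> ?X) \<in> sets ?N" using Union by (intro sets.countable_UN) auto
    moreover have "\<Union> (range A) \<inter> ?X = (\<Union>i. A i \<inter> ?X)" by auto
    ultimately show ?case by (simp only:)
  qed auto
  let ?g = "\<lambda>z. indicator {..b} (snd z) *\<^sub>R zero_extension T \<Phi> z"
  have g1: "?g z = \<Phi> (snd z) (fst z)" if "z \<in> ?X" for z using that b by (auto simp: zero_extension_def)
  have g0: "?g z = 0" if "z \<in> space ?N - ?X" for z
    using that b by (cases z) (auto simp: zero_extension_def space_pair_measure spF indicator_def)
  show "?g \<in> borel_measurable ?N"
  proof (rule measurableI)
    fix S :: "'b set" assume S: "S \<in> sets borel"
    have "?g -` S \<inter> space ?N = (((\<lambda>(w, t). \<Phi> t w) -` S \<inter> space (predictable_algebra M T F)) \<inter> ?X) \<union> (if 0 \<in> S then space ?N - ?X else {})"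
    proof (rule set_eqI)
      fix z
      have "?X \<subseteq> space ?N" using sets.sets_into_space[OF X] .
      moreover have "?X \<subseteq> space (predictable_algebra M T F)" using b by (auto simp: space_predictable[OF filt T])
      ultimately show "z \<in> ?g -` S \<inter> space ?N \<longleftrightarrow> z \<in> (((\<lambda>(w, t). \<Phi> t w) -` S \<inter> space (predictable_algebra M T F)) \<inter> ?X) \<union> (if 0 \<in> S then space ?N - ?X else {})"
        using g1[of z] g0[of z] by (cases "z \<in> ?X"; cases "z \<in> space ?N") (auto simp: split_beta)
    qed
    also have "\<dots> \<in> sets ?N"
      by (rule sets.Un[OF trace[OF measurable_sets[OF f S]]]) (cases "0 \<in> S"; simp only: if_True if_False sets.empty_sets sets.compl_sets[OF X])
    finally show "?g -` S \<inter> space ?N \<in> sets ?N" .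
  qed simp
qed

lemma sigma_finite_torus: "sigma_finite_measure (torus :: (real^'d) measure)"
  by (rule prob_space_imp_sigma_finite[OF prob_space_torus])

lemma finite_time_measure: "finite_measure (time_measure T)"
  by (rule finite_measureI) (simp add: time_measure_def space_restrict_space emeasure_restrict_space emeasure_lborel_Icc_eq)

section \<open>The paired process and its tests\<close>

text \<open>Two kinds of measurability are carried along. \<open>pred\<close> concerns
  \<open>V\<close> as a map into L1 and makes the pairing predictable; \<open>joint\<close> concerns
  \<open>V\<close> as a function of \<open>(w, t, x)\<close> and serves Fubini. In the application
  \<open>joint\<close> is read off from membership in \<open>Lp\<close> over the product.\<close>

locale torus_process = prob_space M for M :: "'w measure" +
  fixes T C :: real and F :: "real \<Rightarrow> 'w measure" and \<beta> :: "real^'d \<Rightarrow> real"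
    and V :: "real \<Rightarrow> 'w \<Rightarrow> real^'d \<Rightarrow> 'b::euclidean_space"
  assumes T: "T > 0" and filt: "filtration_upto M T F"
    and \<beta>_meas: "\<beta> \<in> borel_measurable torus" and \<beta>_bound: "AE x in torus. \<bar>\<beta> x\<bar> \<le> C" and C: "C \<ge> 0"
    and pred: "L1_predictable M T F V"
    and joint: "(\<lambda>(w, t, x). V t w x) \<in> borel_measurable (M \<Otimes>\<^sub>M time_measure T \<Otimes>\<^sub>M torus)"
begin

definition paired :: "real \<Rightarrow> 'w \<Rightarrow> 'b" where
  "paired t w = torus_pairing \<beta> (V t w)"

lemma V_integrable: "w \<in> space M \<Longrightarrow> t \<in> {0..T} \<Longrightarrow> integrable torus (V t w)"
  using measurable_space[OF pred[unfolded L1_predictable_def], of "(w, t)"]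
  by (simp add: space_predictable[OF filt T] space_L1_borel)

lemma paired_predictable: "(\<lambda>(w, t). paired t w) \<in> borel_measurable (predictable_algebra M T F)"
  using measurable_compose[OF pred[unfolded L1_predictable_def] torus_pairing_measurable[OF \<beta>_meas \<beta>_bound C]]
  by (simp add: paired_def split_beta')

lemma paired_measurable: "(\<lambda>(w, t). paired t w) \<in> borel_measurable (M \<Otimes>\<^sub>M time_measure T)"
  by (rule predictable_measurable_product[OF filt T paired_predictable])

lemma paired_progressive: "progressive T F (zero_extension T paired)"
  by (rule predictable_progressive[OF filt T paired_predictable])

lemma paired_diff:
  assumes "w \<in> space M" "s \<in> {0..T}" "t \<in> {0..T}"
  shows "torus_pairing \<beta> (\<lambda>x. V t w x - V s w x) = paired t w - paired s w"
  unfolding paired_def by (intro torus_pairing_diff[OF \<beta>_meas \<beta>_bound] V_integrable assms)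

lemma paired_bound:
  assumes "w \<in> space M" "t \<in> {0..T}"
  shows "norm (paired t w) \<le> C * (\<integral>x. norm (V t w x) \<partial>torus)"
  unfolding paired_def by (intro torus_pairing_bound[OF \<beta>_meas \<beta>_bound] V_integrable assms)

lemma extension_measurable: "zero_extension T paired \<in> borel_measurable (M \<Otimes>\<^sub>M lborel)"
  using time_extension_measurable[OF less_imp_le[OF T] paired_measurable] by (simp add: zero_extension_def split_beta')

text \<open>Serves both the Lp bound and the integrability of the extension; \<open>g 0 = 0\<close>
  disposes of the times outside \<open>(0,T]\<close>.\<close>

lemma nn_integral_extension_le:
  assumes g: "g \<in> borel_measurable borel" "g 0 = 0"
    and le: "\<And>w t. w \<in> space M \<Longrightarrow> t \<in> {0..T} \<Longrightarrow> g (paired t w) \<le> k t w"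
  shows "(\<integral>\<^sup>+z. g (zero_extension T paired z) \<partial>(M \<Otimes>\<^sub>M lborel)) \<le> (\<integral>\<^sup>+w. (\<integral>\<^sup>+t. k t w \<partial>time_measure T) \<partial>M)"
proof -
  have "(\<integral>\<^sup>+z. g (zero_extension T paired z) \<partial>(M \<Otimes>\<^sub>M lborel)) = (\<integral>\<^sup>+w. \<integral>\<^sup>+t. g (zero_extension T paired (w, t)) \<partial>lborel \<partial>M)"
    by (rule lborel.nn_integral_fst[symmetric]) (rule measurable_compose[OF extension_measurable g(1)])
  also have "\<dots> \<le> (\<integral>\<^sup>+w. (\<integral>\<^sup>+t. k t w \<partial>time_measure T) \<partial>M)"
  proof (rule nn_integral_mono)
    fix w assume w: "w \<in> space M"
    have "(\<integral>\<^sup>+t. g (zero_extension T paired (w, t)) \<partial>lborel) \<le> (\<integral>\<^sup>+t. k t w * indicator {0..T} t \<partial>lborel)"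
      using le[OF w] g(2) by (intro nn_integral_mono) (auto simp: zero_extension_def indicator_def)
    also have "\<dots> = (\<integral>\<^sup>+t. k t w \<partial>time_measure T)"
      unfolding time_measure_def by (subst nn_integral_restrict_space) auto
    finally show "(\<integral>\<^sup>+t. g (zero_extension T paired (w, t)) \<partial>lborel) \<le> (\<integral>\<^sup>+t. k t w \<partial>time_measure T)" .
  qed
  finally show ?thesis .
qed

lemma mass_measurable: "(\<lambda>(w, t). \<integral>x. norm (V t w x) \<partial>torus) \<in> borel_measurable (M \<Otimes>\<^sub>M time_measure T)"
proof -
  interpret torus: sigma_finite_measure "torus :: (real^'d) measure" by (rule sigma_finite_torus)
  have "(\<lambda>z. (fst (fst z), snd (fst z), snd z)) \<in> measurable ((M \<Otimes>\<^sub>M time_measure T) \<Otimes>\<^sub>M torus) (M \<Otimes>\<^sub>M time_measure T \<Otimes>\<^sub>M torus)"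
    by measurable
  from measurable_compose[OF this joint]
  have "(\<lambda>z. V (snd (fst z)) (fst (fst z)) (snd z)) \<in> borel_measurable ((M \<Otimes>\<^sub>M time_measure T) \<Otimes>\<^sub>M torus)"
    by (simp only: prod.case)
  from measurable_compose[OF this borel_measurable_norm] have "(\<lambda>y. \<integral>x. norm (V (snd y) (fst y) x) \<partial>torus) \<in> borel_measurable (M \<Otimes>\<^sub>M time_measure T)"
    by (intro torus.borel_measurable_lebesgue_integral) (simp add: split_beta')
  then show ?thesis by (simp add: split_beta')
qed

lemma paired_Lp_bound:
  assumes p: "p > 0"
    and bd: "(\<integral>\<^sup>+w. (\<integral>\<^sup>+t. ennreal ((\<integral>x. norm (V t w x) \<partial>torus) powr p) \<partial>time_measure T) \<partial>M) \<le> ennreal b"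
  shows "(\<integral>\<^sup>+z. ennreal (norm (zero_extension T paired z) powr p) \<partial>(M \<Otimes>\<^sub>M lborel)) \<le> ennreal (C powr p) * ennreal b"
proof -
  interpret time: finite_measure "time_measure T" by (rule finite_time_measure)
  let ?m = "\<lambda>t w. (\<integral>x. norm (V t w x) \<partial>torus)"
  have m1: "(\<lambda>z. ennreal (?m (snd z) (fst z) powr p)) \<in> borel_measurable (M \<Otimes>\<^sub>M time_measure T)"
    using mass_measurable by (simp add: split_beta')
  have "(\<integral>\<^sup>+z. ennreal (norm (zero_extension T paired z) powr p) \<partial>(M \<Otimes>\<^sub>M lborel))
    \<le> (\<integral>\<^sup>+w. (\<integral>\<^sup>+t. ennreal (C powr p) * ennreal (?m t w powr p) \<partial>time_measure T) \<partial>M)"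
  proof (rule nn_integral_extension_le)
    fix w t assume wt: "w \<in> space M" "t \<in> {0..T}"
    have "norm (paired t w) powr p \<le> (C * ?m t w) powr p"
      using p paired_bound[OF wt] by (intro powr_mono2) auto
    also have "\<dots> = C powr p * ?m t w powr p" by (rule powr_mult)
    finally show "ennreal (norm (paired t w) powr p) \<le> ennreal (C powr p) * ennreal (?m t w powr p)"
      by (simp add: ennreal_leI flip: ennreal_mult)
  qed auto
  also have "\<dots> = (\<integral>\<^sup>+w. ennreal (C powr p) * (\<integral>\<^sup>+t. ennreal (?m t w powr p) \<partial>time_measure T) \<partial>M)"
  proof (intro nn_integral_cong nn_integral_cmult)
    fix w assume "w \<in> space M"
    then show "(\<lambda>t. ennreal (?m t w powr p)) \<in> borel_measurable (time_measure T)"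
      using measurable_compose[OF measurable_Pair1' m1, of w] by simp
  qed
  also have "\<dots> = ennreal (C powr p) * (\<integral>\<^sup>+w. (\<integral>\<^sup>+t. ennreal (?m t w powr p) \<partial>time_measure T) \<partial>M)"
    using m1 by (intro nn_integral_cmult time.borel_measurable_nn_integral) (simp add: split_beta')
  also have "\<dots> \<le> ennreal (C powr p) * ennreal b" by (intro mult_left_mono bd) auto
  finally show ?thesis .
qed

lemma finite_product: "finite_measure (M \<Otimes>\<^sub>M time_measure T \<Otimes>\<^sub>M (torus :: (real^'d) measure))"
proof -
  interpret torus: prob_space "torus :: (real^'d) measure" by (rule prob_space_torus)
  show ?thesis
    by (intro finite_measure_pair_measure finite_measure_axioms finite_time_measure torus.finite_measure_axioms)
qed

text \<open>Truncating \<open>\<beta>\<close> changes it only on a null set and makes the test function bounded everywhere.\<close>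

definition test_function :: "('w \<times> real \<Rightarrow> 'b) \<Rightarrow> 'w \<times> real \<times> (real^'d) \<Rightarrow> 'b" where
  "test_function Y = (\<lambda>(w, t, x). max (- C) (min C (\<beta> x)) *\<^sub>R Y (w, t))"

lemma test_function_bound:
  assumes "\<And>z. norm (Y z) \<le> c" shows "norm (test_function Y z) \<le> C * c"
proof -
  have "\<bar>max (- C) (min C (\<beta> x))\<bar> \<le> C" for x using C by auto
  then show ?thesis using C assms by (auto simp: test_function_def split_beta intro!: mult_mono)
qed

lemma test_function_measurable:
  assumes "Y \<in> borel_measurable (M \<Otimes>\<^sub>M lborel)"
  shows "test_function Y \<in> borel_measurable (M \<Otimes>\<^sub>M time_measure T \<Otimes>\<^sub>M torus)"
proof -
  have [measurable]: "Y \<in> borel_measurable (M \<Otimes>\<^sub>M time_measure T)" by (rule measurable_lborel_time[OF assms])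
  note [measurable] = \<beta>_meas
  show ?thesis unfolding test_function_def by measurable
qed

text \<open>Fubini: pairing the integrand against a test function on \<open>\<Omega> \<times> [0,T]\<close> is a test of \<open>V\<close> itself.\<close>

lemma paired_test:
  assumes V: "(\<lambda>(w, t, x). V t w x) \<in> Lp (M \<Otimes>\<^sub>M time_measure T \<Otimes>\<^sub>M torus) r" and r: "r \<ge> 1"
    and Y: "Y \<in> borel_measurable (M \<Otimes>\<^sub>M lborel)" "\<And>z. norm (Y z) \<le> c"
  shows "(\<integral>z. (\<lambda>(w, t, x). V t w x) z \<bullet> test_function Y z \<partial>(M \<Otimes>\<^sub>M time_measure T \<Otimes>\<^sub>M torus))
     = (\<integral>z. zero_extension T paired z \<bullet> Y z \<partial>(M \<Otimes>\<^sub>M lborel))"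
proof -
  let ?P = "M \<Otimes>\<^sub>M time_measure T \<Otimes>\<^sub>M (torus :: (real^'d) measure)"
  interpret torus: prob_space "torus :: (real^'d) measure" by (rule prob_space_torus)
  interpret time: finite_measure "time_measure T" by (rule finite_time_measure)
  interpret tt: pair_sigma_finite "time_measure T" "torus :: (real^'d) measure" ..
  interpret full: pair_sigma_finite M "time_measure T \<Otimes>\<^sub>M (torus :: (real^'d) measure)" ..
  interpret ml: pair_sigma_finite M "lborel :: real measure" ..
  have c0: "c \<ge> 0" using order_trans[OF norm_ge_zero Y(2)] by blast
  let ?h = "\<lambda>(w, t, x). V t w x \<bullet> test_function Y (w, t, x)"
  have intV: "integrable ?P (\<lambda>z. norm ((\<lambda>(w, t, x). V t w x) z))"
    by (rule Lp_integrable_norm[OF finite_product r V])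
  have int: "integrable ?P ?h"
  proof (rule Bochner_Integration.integrable_bound)
    show "integrable ?P (\<lambda>z. norm ((\<lambda>(w, t, x). V t w x) z) * (C * c))" using intV by simp
    show "?h \<in> borel_measurable ?P"
      using borel_measurable_inner[OF joint test_function_measurable[OF Y(1)]] by (simp add: split_beta')
    show "AE z in ?P. norm (?h z) \<le> norm (norm ((\<lambda>(w, t, x). V t w x) z) * (C * c))"
    proof (rule AE_I2, clarify)
      fix w t x
      have "\<bar>V t w x \<bullet> test_function Y (w, t, x)\<bar> \<le> norm (V t w x) * (C * c)"
        by (rule order_trans[OF Cauchy_Schwarz_ineq2]) (intro mult_left_mono test_function_bound Y(2), simp)
      then show "norm (V t w x \<bullet> test_function Y (w, t, x)) \<le> norm (norm (V t w x) * (C * c))"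
        using C c0 by simp
    qed
  qed
  \<comment> \<open>The truncation inside \<open>test_function\<close> differs from \<beta> on a
    null set only, so the inner integral over the torus is the pairing itself.\<close>
  have pair: "(\<integral>x. ?h (w, t, x) \<partial>torus) = paired t w \<bullet> Y (w, t)" if wt: "w \<in> space M" "t \<in> {0..T}" for w t
  proof -
    have "(\<integral>x. ?h (w, t, x) \<partial>torus) = (\<integral>x. (\<beta> x *\<^sub>R V t w x) \<bullet> Y (w, t) \<partial>torus)"
    proof (rule integral_cong_AE)
      show "AE x in torus. ?h (w, t, x) = (\<beta> x *\<^sub>R V t w x) \<bullet> Y (w, t)"
        using \<beta>_bound by eventually_elim (auto simp: test_function_def min_def max_def)
      have [measurable]: "V t w \<in> borel_measurable torus" "\<beta> \<in> borel_measurable torus"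
        using V_integrable[OF wt] \<beta>_meas by auto
      show "(\<lambda>x. ?h (w, t, x)) \<in> borel_measurable torus" "(\<lambda>x. (\<beta> x *\<^sub>R V t w x) \<bullet> Y (w, t)) \<in> borel_measurable torus"
        unfolding test_function_def split_conv by measurable
    qed
    also have "\<dots> = paired t w \<bullet> Y (w, t)"
      unfolding paired_def torus_pairing_def
      by (intro integral_inner_left torus_pairing_integrable[OF \<beta>_meas \<beta>_bound] V_integrable wt)
    finally show ?thesis .
  qed
  have "(\<integral>z. ?h z \<partial>?P) = (\<integral>w. \<integral>y. ?h (w, y) \<partial>(time_measure T \<Otimes>\<^sub>M torus) \<partial>M)"
    by (rule full.integral_fst'[symmetric, OF int])
  also have "\<dots> = (\<integral>w. \<integral>t. paired t w \<bullet> Y (w, t) \<partial>time_measure T \<partial>M)"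
  proof (rule integral_cong_AE)
    show "(\<lambda>w. \<integral>y. ?h (w, y) \<partial>(time_measure T \<Otimes>\<^sub>M torus)) \<in> borel_measurable M"
      using int by (intro tt.borel_measurable_lebesgue_integral) simp
    show "(\<lambda>w. \<integral>t. paired t w \<bullet> Y (w, t) \<partial>time_measure T) \<in> borel_measurable M"
      using borel_measurable_inner[OF paired_measurable measurable_lborel_time[OF Y(1)]]
      by (intro time.borel_measurable_lebesgue_integral) (simp add: split_beta')
    \<comment> \<open>Integrability of the section in \<open>(t, x)\<close> is available for almost
      every \<open>w\<close> only.\<close>
    show "AE w in M. (\<integral>y. ?h (w, y) \<partial>(time_measure T \<Otimes>\<^sub>M torus)) = (\<integral>t. paired t w \<bullet> Y (w, t) \<partial>time_measure T)"
      using full.AE_integrable_fst'[OF int] AE_space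
    proof eventually_elim
      case (elim w)
      have "(\<integral>y. ?h (w, y) \<partial>(time_measure T \<Otimes>\<^sub>M torus)) = (\<integral>t. \<integral>x. ?h (w, t, x) \<partial>torus \<partial>time_measure T)"
        using tt.integral_fst'[OF elim(1)] by simp
      also have "\<dots> = (\<integral>t. paired t w \<bullet> Y (w, t) \<partial>time_measure T)"
        by (intro Bochner_Integration.integral_cong refl pair elim(2)) (simp add: space_time_measure)
      finally show ?case .
    qed
  qed
  also have "\<dots> = (\<integral>w. \<integral>t. zero_extension T paired (w, t) \<bullet> Y (w, t) \<partial>lborel \<partial>M)"
  proof (rule Bochner_Integration.integral_cong[OF refl])
    fix w assume w: "w \<in> space M"
    have Yw [measurable]: "(\<lambda>t. Y (w, t)) \<in> borel_measurable borel"
      using measurable_compose[OF measurable_Pair1'[OF w] Y(1)] by simp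
    have "(\<integral>t. paired t w \<bullet> Y (w, t) \<partial>time_measure T) = (\<integral>t. indicator {0..T} t *\<^sub>R (paired t w \<bullet> Y (w, t)) \<partial>lborel)"
      unfolding time_measure_def by (subst integral_restrict_space) auto
    also have "\<dots> = (\<integral>t. zero_extension T paired (w, t) \<bullet> Y (w, t) \<partial>lborel)"
    proof (rule integral_cong_AE)
      have pm: "(\<lambda>t. paired t w) \<in> borel_measurable (time_measure T)"
        using measurable_compose[OF measurable_Pair1'[OF w] paired_measurable] by simp
      have "(\<lambda>t. paired t w \<bullet> Y (w, t)) \<in> borel_measurable (restrict_space lborel {0..T})"
        by (rule borel_measurable_inner[OF pm[unfolded time_measure_def]]) (rule measurable_restrict_space1, simp)
      then show "(\<lambda>t. indicator {0..T} t *\<^sub>R (paired t w \<bullet> Y (w, t))) \<in> borel_measurable lborel"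
        by (subst (asm) borel_measurable_restrict_space_iff) auto
      have "(\<lambda>t. zero_extension T paired (w, t)) \<in> borel_measurable lborel"
        by (rule measurable_compose[OF measurable_Pair1'[OF w] extension_measurable])
      then show "(\<lambda>t. zero_extension T paired (w, t) \<bullet> Y (w, t)) \<in> borel_measurable lborel"
        by (intro borel_measurable_inner) auto
      show "AE t in lborel. indicator {0..T} t *\<^sub>R (paired t w \<bullet> Y (w, t)) = zero_extension T paired (w, t) \<bullet> Y (w, t)"
        using AE_lborel_singleton[of "0::real"] by eventually_elim (auto simp: zero_extension_def indicator_def)
    qed
    finally show "(\<integral>t. paired t w \<bullet> Y (w, t) \<partial>time_measure T) = (\<integral>t. zero_extension T paired (w, t) \<bullet> Y (w, t) \<partial>lborel)" .
  qed
  also have "\<dots> = (\<integral>z. zero_extension T paired z \<bullet> Y z \<partial>(M \<Otimes>\<^sub>M lborel))"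
  proof (rule ml.integral_fst')
    \<comment> \<open>The pairing is at most \<open>C\<close> times the spatial L1 norm of
      \<open>V\<close>, whose integral over sample and time is finite because \<open>V\<close> lies
      in \<open>Lp\<close> over a finite measure.\<close>
    have norm_fin: "(\<integral>\<^sup>+z. ennreal (norm (zero_extension T paired z)) \<partial>(M \<Otimes>\<^sub>M lborel)) < \<infinity>"
    proof -
      have "(\<integral>\<^sup>+z. ennreal (norm (zero_extension T paired z)) \<partial>(M \<Otimes>\<^sub>M lborel))
        \<le> (\<integral>\<^sup>+w. (\<integral>\<^sup>+t. (\<integral>\<^sup>+x. ennreal C * ennreal (norm (V t w x)) \<partial>torus) \<partial>time_measure T) \<partial>M)"
      proof (rule nn_integral_extension_le)
        fix w t assume wt: "w \<in> space M" "t \<in> {0..T}"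
        have "ennreal (norm (paired t w)) \<le> ennreal C * ennreal (\<integral>x. norm (V t w x) \<partial>torus)"
          using ennreal_leI[OF paired_bound[OF wt]] C by (simp add: ennreal_mult)
        also have "ennreal (\<integral>x. norm (V t w x) \<partial>torus) = (\<integral>\<^sup>+x. ennreal (norm (V t w x)) \<partial>torus)"
          using V_integrable[OF wt] by (intro nn_integral_eq_integral[symmetric]) auto
        also have "ennreal C * \<dots> = (\<integral>\<^sup>+x. ennreal C * ennreal (norm (V t w x)) \<partial>torus)"
          using V_integrable[OF wt] by (intro nn_integral_cmult[symmetric]) auto
        finally show "ennreal (norm (paired t w)) \<le> (\<integral>\<^sup>+x. ennreal C * ennreal (norm (V t w x)) \<partial>torus)" .
      qed auto
      also have "\<dots> = (\<integral>\<^sup>+z. ennreal C * ennreal (norm ((\<lambda>(w, t, x). V t w x) z)) \<partial>?P)"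
      proof -
        let ?k = "\<lambda>z. ennreal C * ennreal (norm ((\<lambda>(w, t, x). V t w x) z))"
        have km: "?k \<in> borel_measurable ?P"
          by (rule measurable_compose[OF joint]) measurable
        have "(\<integral>\<^sup>+z. ?k z \<partial>?P) = (\<integral>\<^sup>+w. \<integral>\<^sup>+y. ?k (w, y) \<partial>(time_measure T \<Otimes>\<^sub>M torus) \<partial>M)"
          by (rule tt.nn_integral_fst[symmetric, OF km])
        also have "\<dots> = (\<integral>\<^sup>+w. (\<integral>\<^sup>+t. (\<integral>\<^sup>+x. ennreal C * ennreal (norm (V t w x)) \<partial>torus) \<partial>time_measure T) \<partial>M)"
        proof (rule nn_integral_cong)
          fix w assume w: "w \<in> space M"
          show "(\<integral>\<^sup>+y. ?k (w, y) \<partial>(time_measure T \<Otimes>\<^sub>M torus)) = (\<integral>\<^sup>+t. (\<integral>\<^sup>+x. ennreal C * ennreal (norm (V t w x)) \<partial>torus) \<partial>time_measure T)"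
            using torus.nn_integral_fst[OF measurable_compose[OF measurable_Pair1'[OF w] km]] by simp
        qed
        finally show ?thesis by simp
      qed
      also have "\<dots> = ennreal C * (\<integral>\<^sup>+z. ennreal (norm ((\<lambda>(w, t, x). V t w x) z)) \<partial>?P)"
        by (rule nn_integral_cmult) (rule measurable_compose[OF joint], measurable)
      also have "\<dots> < \<infinity>"
        using intV unfolding integrable_iff_bounded by (simp add: ennreal_mult_less_top)
      finally show ?thesis .
    qed
    show "integrable (M \<Otimes>\<^sub>M lborel) (\<lambda>z. zero_extension T paired z \<bullet> Y z)"
    proof (rule Bochner_Integration.integrable_bound)
      show "integrable (M \<Otimes>\<^sub>M lborel) (\<lambda>z. c *\<^sub>R zero_extension T paired z)"
        using norm_fin extension_measurable by (intro integrable_scaleR_right integrableI_bounded) auto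
      show "(\<lambda>z. zero_extension T paired z \<bullet> Y z) \<in> borel_measurable (M \<Otimes>\<^sub>M lborel)"
        by (intro borel_measurable_inner extension_measurable Y)
      show "AE z in M \<Otimes>\<^sub>M lborel. norm (zero_extension T paired z \<bullet> Y z) \<le> norm (c *\<^sub>R zero_extension T paired z)"
      proof (rule AE_I2)
        fix z
        have "\<bar>zero_extension T paired z \<bullet> Y z\<bar> \<le> norm (zero_extension T paired z) * c"
          by (rule order_trans[OF Cauchy_Schwarz_ineq2]) (intro mult_left_mono Y(2), simp)
        then show "norm (zero_extension T paired z \<bullet> Y z) \<le> norm (c *\<^sub>R zero_extension T paired z)"
          using c0 by (simp add: mult.commute)
      qed
    qed
  qed
  finally show ?thesis by (simp add: split_beta')
qed

end

theorem theorem3p1: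
  fixes M :: "'w measure"
    and T p r q :: real
    and Fn :: "nat \<Rightarrow> real \<Rightarrow> 'w measure" and F :: "real \<Rightarrow> 'w measure"
    and Wn :: "nat \<Rightarrow> real \<Rightarrow> 'w \<Rightarrow> real^'k" and W :: "real \<Rightarrow> 'w \<Rightarrow> real^'k"
    and Vn :: "nat \<Rightarrow> real \<Rightarrow> 'w \<Rightarrow> real^'d \<Rightarrow> real^'k^'m"
    and V :: "real \<Rightarrow> 'w \<Rightarrow> real^'d \<Rightarrow> real^'k^'m"
    and \<beta> :: "real^'d \<Rightarrow> real"
  assumes "prob_space M" and "T > 0" and "p > 2" and "r \<ge> 1"
    and "\<And>n. filtration_upto M T (Fn n)" and "filtration_upto M T F"
    and "\<And>n. wiener_process M T (Fn n) (Wn n)" and "wiener_process M T F W"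
    and "\<And>n. L1_predictable M T (Fn n) (Vn n)" and "L1_predictable M T F V"
    and "Lp_converges_weakly (M \<Otimes>\<^sub>M time_measure T \<Otimes>\<^sub>M torus) r
           (\<lambda>n (\<omega>, t, x). Vn n t \<omega> x) (\<lambda>(\<omega>, t, x). V t \<omega> x)"
    and "(SUP n. \<integral>\<^sup>+\<omega>. (\<integral>\<^sup>+t. ennreal ((\<integral>x. norm (Vn n t \<omega> x) \<partial>torus) powr p)
           \<partial>time_measure T) \<partial>M) < \<infinity>"
    and "AE \<omega> in M. uniform_limit {0..T} (\<lambda>n t. Wn n t \<omega>) (\<lambda>t. W t \<omega>) sequentially"
    and "q > real CARD('d) / 2" and "\<beta> \<in> sobolev_torus q"
    and "\<And>\<epsilon>. \<epsilon> > 0 \<Longrightarrow> \<forall>\<^sub>F h in at_right 0. \<forall>n.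
           (\<integral>\<^sup>+\<omega>. (\<integral>\<^sup>+t\<in>{h..T}.
              ennreal (norm (torus_pairing \<beta> (\<lambda>x. Vn n t \<omega> x - Vn n (t - h) \<omega> x))) \<partial>lborel) \<partial>M) < \<epsilon>"
  shows "\<forall>t\<in>{0..T}. Lp_converges_weakly M 2
           (\<lambda>n. ito_integral M T (Fn n) (Wn n) (\<lambda>s \<omega>. torus_pairing \<beta> (Vn n s \<omega>)) t)
           (ito_integral M T F W (\<lambda>s \<omega>. torus_pairing \<beta> (V s \<omega>)) t)"
proof -
  let ?P = "M \<Otimes>\<^sub>M time_measure T \<Otimes>\<^sub>M (torus :: (real^'d) measure)"
  interpret prob_space M by fact
  obtain C where C: "C \<ge> 0" and \<beta>_bound: "AE x in torus. \<bar>\<beta> x\<bar> \<le> C"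
    using sobolev_essentially_bounded[OF assms(14,15)] by blast
  have \<beta>_meas: "\<beta> \<in> borel_measurable torus" using sobolev_integrable[OF assms(15)] by simp
  have Vn_Lp: "\<And>n. (\<lambda>(\<omega>, t, x). Vn n t \<omega> x) \<in> Lp ?P r" and V_Lp: "(\<lambda>(\<omega>, t, x). V t \<omega> x) \<in> Lp ?P r"
    and V_weak: "\<And>\<phi>. \<phi> \<in> Lp_dual ?P r \<Longrightarrow> (\<lambda>n. \<phi> (\<lambda>(\<omega>, t, x). Vn n t \<omega> x)) \<longlonglongrightarrow> \<phi> (\<lambda>(\<omega>, t, x). V t \<omega> x)"
    using assms(11) unfolding Lp_converges_weakly_def by blast+
  have vn: "torus_process M T C (Fn n) \<beta> (Vn n)" for n
    by (intro torus_process.intro torus_process_axioms.intro prob_space_axioms assms(2,5,9) \<beta>_meas \<beta>_bound C)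
       (use Vn_Lp[of n] in \<open>simp add: Lp_def\<close>)
  interpret v: torus_process M T C F \<beta> V
    by (intro torus_process.intro torus_process_axioms.intro prob_space_axioms assms(2,6,10) \<beta>_meas \<beta>_bound C)
       (use V_Lp in \<open>simp add: Lp_def\<close>)
  let ?\<Phi>n = "\<lambda>n s \<omega>. torus_pairing \<beta> (Vn n s \<omega>)" and ?\<Phi> = "\<lambda>s \<omega>. torus_pairing \<beta> (V s \<omega>)"
  have pn: "torus_process.paired \<beta> (Vn n) = ?\<Phi>n n" for n
    by (simp add: fun_eq_iff torus_process.paired_def[OF vn])
  have pl: "v.paired = ?\<Phi>"
    by (simp add: fun_eq_iff v.paired_def)
  define S where "S = (SUP n. \<integral>\<^sup>+\<omega>. (\<integral>\<^sup>+t. ennreal ((\<integral>x. norm (Vn n t \<omega> x) \<partial>torus) powr p) \<partial>time_measure T) \<partial>M)"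
  define b where "b = enn2real S"
  have S: "S = ennreal b" using assms(12) unfolding S_def[symmetric] by (simp add: b_def)
  have Sn: "(\<integral>\<^sup>+\<omega>. (\<integral>\<^sup>+t. ennreal ((\<integral>x. norm (Vn n t \<omega> x) \<partial>torus) powr p) \<partial>time_measure T) \<partial>M) \<le> ennreal b" for n
    unfolding S[symmetric] S_def by (rule SUP_upper) simp
  \<comment> \<open>\<open>B\<close> is \<open>C powr p\<close> times the moment bound of the
    \<open>Vn\<close>, since the pairing is at most \<open>C\<close> times the spatial L1
    norm.\<close>
  interpret ito_convergence M T p "C powr p * b" Fn F Wn W ?\<Phi>n ?\<Phi>
  proof (intro ito_convergence.intro ito_convergence_axioms.intro prob_space_axioms assms(2,3,13))
    show "0 \<le> C powr p * b" by (simp add: b_def)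
    show "brownian M T (Fn n) (Wn n)" for n
      by (intro brownian.intro brownian_axioms.intro prob_space_axioms assms(5,7))
    show "brownian M T F W" by (intro brownian.intro brownian_axioms.intro prob_space_axioms assms(6,8))
    show "(\<lambda>(w, s). ?\<Phi>n n s w) \<in> borel_measurable (M \<Otimes>\<^sub>M time_measure T)" for n
      using torus_process.paired_measurable[OF vn[of n]] by (simp only: pn)
    show "(\<lambda>(w, s). ?\<Phi> s w) \<in> borel_measurable (M \<Otimes>\<^sub>M time_measure T)"
      using v.paired_measurable by (simp only: pl)
    show "progressive T (Fn n) (zero_extension T (?\<Phi>n n))" for n
      using torus_process.paired_progressive[OF vn[of n]] by (simp only: pn)
    show "progressive T F (zero_extension T ?\<Phi>)"
      using v.paired_progressive by (simp only: pl)
    show "(\<integral>\<^sup>+z. ennreal (norm (zero_extension T (?\<Phi>n n) z) powr p) \<partial>(M \<Otimes>\<^sub>M lborel)) \<le> ennreal (C powr p * b)" for n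
      using torus_process.paired_Lp_bound[OF vn[of n] _ Sn] assms(3) by (simp add: pn ennreal_mult b_def)
    show "\<forall>\<^sub>F h in at_right 0. \<forall>n.
        (\<integral>\<^sup>+w. (\<integral>\<^sup>+t\<in>{h..T}. ennreal (norm (?\<Phi>n n t w - ?\<Phi>n n (t - h) w)) \<partial>lborel) \<partial>M) \<le> ennreal \<epsilon>"
      if "\<epsilon> > 0" for \<epsilon>
    proof -
      have "\<forall>\<^sub>F h in at_right 0. h > (0::real)" by (rule eventually_at_right_less)
      moreover have "\<forall>\<^sub>F h in at_right 0. \<forall>n. (\<integral>\<^sup>+\<omega>. (\<integral>\<^sup>+t\<in>{h..T}.
              ennreal (norm (torus_pairing \<beta> (\<lambda>x. Vn n t \<omega> x - Vn n (t - h) \<omega> x))) \<partial>lborel) \<partial>M) < ennreal \<epsilon>"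
        using that by (intro assms(16)) simp
      ultimately show ?thesis
      proof eventually_elim
        case (elim h)
        show ?case
        proof
          fix n
          have "(\<integral>\<^sup>+w. (\<integral>\<^sup>+t\<in>{h..T}. ennreal (norm (?\<Phi>n n t w - ?\<Phi>n n (t - h) w)) \<partial>lborel) \<partial>M)
            = (\<integral>\<^sup>+\<omega>. (\<integral>\<^sup>+t\<in>{h..T}. ennreal (norm (torus_pairing \<beta> (\<lambda>x. Vn n t \<omega> x - Vn n (t - h) \<omega> x))) \<partial>lborel) \<partial>M)"
          \<comment> \<open>Linearity of the pairing is used with both time arguments in
            \<open>[0,T]\<close>; for \<open>h > 0\<close> and \<open>t\<close> in
            \<open>[h,T]\<close> they are.\<close>
          proof (intro nn_integral_cong)
            fix w t assume w: "w \<in> space M"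
            show "ennreal (norm (?\<Phi>n n t w - ?\<Phi>n n (t - h) w)) * indicator {h..T} t
              = ennreal (norm (torus_pairing \<beta> (\<lambda>x. Vn n t w x - Vn n (t - h) w x))) * indicator {h..T} t"
              using torus_process.paired_diff[OF vn[of n] w, of "t - h" t] elim(1)
              by (cases "t \<in> {h..T}") (auto simp: pn)
          qed
          with elim(2) show "(\<integral>\<^sup>+w. (\<integral>\<^sup>+t\<in>{h..T}. ennreal (norm (?\<Phi>n n t w - ?\<Phi>n n (t - h) w)) \<partial>lborel) \<partial>M) \<le> ennreal \<epsilon>"
            by (simp add: less_imp_le)
        qed
      qed
    qed
    show "(\<lambda>n. \<integral>z. zero_extension T (?\<Phi>n n) z \<bullet> Y z \<partial>(M \<Otimes>\<^sub>M lborel)) \<longlonglongrightarrow> (\<integral>z. zero_extension T ?\<Phi> z \<bullet> Y z \<partial>(M \<Otimes>\<^sub>M lborel))"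
      if Y: "Y \<in> borel_measurable (M \<Otimes>\<^sub>M lborel)" "\<And>z. norm (Y z) \<le> c" for Y :: "'w \<times> real \<Rightarrow> real^'k^'m" and c
    proof -
      \<comment> \<open>\<open>test_function\<close> is built from \<beta>, \<open>C\<close> and
        \<open>Y\<close> alone, so one functional serves every \<open>n\<close> and the
        limit.\<close>
      have "(\<lambda>f. \<integral>z. f z \<bullet> v.test_function Y z \<partial>?P) \<in> Lp_dual ?P r"
        by (rule bounded_test_dual[OF v.finite_product assms(4) v.test_function_measurable[OF Y(1)] v.test_function_bound[OF Y(2)]])
      note lim = V_weak[OF this]
      have "(\<integral>z. (\<lambda>(w, t, x). Vn n t w x) z \<bullet> v.test_function Y z \<partial>?P)
          = (\<integral>z. zero_extension T (?\<Phi>n n) z \<bullet> Y z \<partial>(M \<Otimes>\<^sub>M lborel))" for n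
        using torus_process.paired_test[OF vn[of n] Vn_Lp assms(4) Y] unfolding pn .
      moreover have "(\<integral>z. (\<lambda>(w, t, x). V t w x) z \<bullet> v.test_function Y z \<partial>?P)
          = (\<integral>z. zero_extension T ?\<Phi> z \<bullet> Y z \<partial>(M \<Otimes>\<^sub>M lborel))"
        using v.paired_test[OF V_Lp assms(4) Y] unfolding pl .
      ultimately show ?thesis using lim by (simp only:)
    qed
  qed
  show ?thesis
    using ito_integral_converges_weakly by simp
qed

end
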